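(* Let $\alpha>0$ and let $g\in V_\alpha$. Let $a,b>0$ satisfy $\alpha\le a<2\alpha$ and $ab\in\left[\frac{M-1}{M},\frac{M}{M+1}\right[$ for some integer $M\ge 2$. Let $\kappa\in\{0,1,\dots,M-1\}$ be the largest integer with $(1-ab)\kappa\le b\alpha$. For $n\in\{1,\dots,\kappa\}$ (when $\kappa\neq0$) define, wherever the denominators do not vanish, $$R_n(y)=\frac{1}{g(y)}\prod_{k=1}^{n-1}\frac{g\big(y+(1-ab)\frac{k}{b}-a\big)}{g\big(y+(1-ab)\frac{k}{b}\big)},\qquad y\in\Big]a-\alpha,\ \alpha-(1-ab)\tfrac{n}{b}\Big],$$ $$L_n(y)=\frac{1}{g(y)}\prod_{k=1}^{n-1}\frac{g\big(y-(1-ab)\frac{k}{b}+a\big)}{g\big(y-(1-ab)\frac{k}{b}\big)},\qquad y\in\Big[-\alpha+(1-ab)\tfrac{n}{b},\ \alpha-a\Big[,$$ with the convention that the empty product equals $1$. Then the Gabor system $\{E_{mb}T_{na}g\}_{m,n\in\mathbb{Z}}$ is a frame for $L^2(\mathbb{R})$ if and only if the following conditions hold: (i) $|g(x)|+|g(x+a)|>0$ for all $x\in[-a,0]$; (ii) if $\kappa\neq0$ and there exist $n_+\in\{1,\dots,\kappa\}$ and $y_+\in\,]a-\alpha,\alpha-(1-ab)\frac{n_+}{b}]$ with $g(y_+)=0$ and $\lim_{y\to y_+}|R_{n_+}(y)|=\infty$, then $g\big(y_++(1-ab)\frac{n_+}{b}-a\big)\neq0$; (iii) if $\kappa\neq0$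 and there exist $n_-\in\{1,\dots,\kappa\}$ and $y_-\in[-\alpha+(1-ab)\frac{n_-}{b},\alpha-a[$ with $g(y_-)=0$ and $\lim_{y\to y_-}|L_{n_-}(y)|=\infty$, then $g\big(y_--(1-ab)\frac{n_-}{b}+a\big)\neq0$; (iv) for any $y_+,n_+$ as in (ii) and $y_-,n_-$ as in (iii), $y_++(1-ab)\frac{n_+}{b}\neq y_--(1-ab)\frac{n_-}{b}+a$. Moreover, in the affirmative case there exists a dual window $h\in L^2(\mathbb{R})$ with $\operatorname{supp} h\subseteq[-aM,aM]$, i.e. $\{E_{mb}T_{na}g\}_{m,n\in\mathbb{Z}}$ and $\{E_{mb}T_{na}h\}_{m,n\in\mathbb{Z}}$ are dual frames.
   Context: For $x,y\in\mathbb{R}$ and $f\in L^2(\mathbb{R})$: $T_af(x)=f(x-a)$ (translation) and $E_bf(x)=e^{2\pi i b x}f(x)$ (modulation). For $\alpha>0$, $V_\alpha$ denotes the set of continuous functions $f:\mathbb{R}\to\mathbb{R}$ (or $\mathbb{C}$) with $\operatorname{supp} f=[-\alpha,\alpha]$ and having only finitely many zeros in $[-\alpha,\alpha]$. A system $\{f_k\}$ in a Hilbert space $H$ is a frame if there are $0<A\le B$ with $A\|f\|^2\le\sum_k|\langle f,f_k\rangle|^2\le B\|f\|^2$ for all $f\in H$. *)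

theory Defs
  imports "HOL-Analysis.Analysis"
begin

definition L2 :: "(real \<Rightarrow> complex) \<Rightarrow> bool" where
  "L2 f \<longleftrightarrow> f \<in> borel_measurable lborel \<and> integrable lborel (\<lambda>x. (cmod (f x))\<^sup>2)"

definition L2_inner :: "(real \<Rightarrow> complex) \<Rightarrow> (real \<Rightarrow> complex) \<Rightarrow> complex" where
  "L2_inner f h = (LINT x|lborel. f x * cnj (h x))"

definition L2_normsq :: "(real \<Rightarrow> complex) \<Rightarrow> real" where
  "L2_normsq f = (LINT x|lborel. (cmod (f x))\<^sup>2)"

definition transl :: "real \<Rightarrow> (real \<Rightarrow> complex) \<Rightarrow> real \<Rightarrow> complex" where
  "transl a f = (\<lambda>x. f (x - a))"

definition modul :: "real \<Rightarrow> (real \<Rightarrow> complex) \<Rightarrow> real \<Rightarrow> complex" where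
  "modul b f = (\<lambda>x. exp (2 * pi * \<i> * complex_of_real (b * x)) * f x)"

definition gabor :: "real \<Rightarrow> real \<Rightarrow> (real \<Rightarrow> complex) \<Rightarrow> int \<times> int \<Rightarrow> real \<Rightarrow> complex" where
  "gabor a b g = (\<lambda>(m, n). modul (real_of_int m * b) (transl (real_of_int n * a) g))"

definition frame_L2 :: "(int \<times> int \<Rightarrow> real \<Rightarrow> complex) \<Rightarrow> bool" where
  "frame_L2 \<phi> \<longleftrightarrow> (\<forall>k. L2 (\<phi> k)) \<and>
     (\<exists>A B. 0 < A \<and> A \<le> B \<and>
        (\<forall>f. L2 f \<longrightarrow>
           (\<lambda>k. (cmod (L2_inner f (\<phi> k)))\<^sup>2) summable_on UNIV \<and>
           A * L2_normsq f \<le> (\<Sum>\<^sub>\<infinity>k. (cmod (L2_inner f (\<phi> k)))\<^sup>2) \<and>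
           (\<Sum>\<^sub>\<infinity>k. (cmod (L2_inner f (\<phi> k)))\<^sup>2) \<le> B * L2_normsq f))"

text \<open>Dual frames: both are frames and f = sum_k <f, psi_k> phi_k (weakly, unconditionally).\<close>
definition dual_frames_L2 :: "(int \<times> int \<Rightarrow> real \<Rightarrow> complex) \<Rightarrow> (int \<times> int \<Rightarrow> real \<Rightarrow> complex) \<Rightarrow> bool" where
  "dual_frames_L2 \<phi> \<psi> \<longleftrightarrow> frame_L2 \<phi> \<and> frame_L2 \<psi> \<and>
     (\<forall>f f'. L2 f \<longrightarrow> L2 f' \<longrightarrow>
        ((\<lambda>k. L2_inner f (\<psi> k) * L2_inner (\<phi> k) f') has_sum L2_inner f f') UNIV)"

definition V :: "real \<Rightarrow> (real \<Rightarrow> complex) set" where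
  "V \<alpha> = {f. continuous_on UNIV f \<and> closure {x. f x \<noteq> 0} = {-\<alpha>..\<alpha>}
              \<and> finite {x \<in> {-\<alpha>..\<alpha>}. f x = 0}}"

definition kappa :: "real \<Rightarrow> real \<Rightarrow> real \<Rightarrow> nat \<Rightarrow> nat" where
  "kappa \<alpha> a b M = (GREATEST k::nat. k \<le> M - 1 \<and> (1 - a * b) * real k \<le> b * \<alpha>)"

definition Rfun :: "(real \<Rightarrow> complex) \<Rightarrow> real \<Rightarrow> real \<Rightarrow> nat \<Rightarrow> real \<Rightarrow> complex" where
  "Rfun g a b n y = (1 / g y) * (\<Prod>k\<in>{1..<n}.
      g (y + (1 - a*b) * real k / b - a) / g (y + (1 - a*b) * real k / b))"

definition Lfun :: "(real \<Rightarrow> complex) \<Rightarrow> real \<Rightarrow> real \<Rightarrow> nat \<Rightarrow> real \<Rightarrow> complex" where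
  "Lfun g a b n y = (1 / g y) * (\<Prod>k\<in>{1..<n}.
      g (y - (1 - a*b) * real k / b + a) / g (y - (1 - a*b) * real k / b))"

definition plus_pt :: "(real \<Rightarrow> complex) \<Rightarrow> real \<Rightarrow> real \<Rightarrow> real \<Rightarrow> nat \<Rightarrow> nat \<Rightarrow> real \<Rightarrow> bool" where
  "plus_pt g \<alpha> a b M n y \<longleftrightarrow> kappa \<alpha> a b M \<noteq> 0 \<and> 1 \<le> n \<and> n \<le> kappa \<alpha> a b M \<and>
     a - \<alpha> < y \<and> y \<le> \<alpha> - (1 - a*b) * real n / b \<and> g y = 0 \<and>
     filterlim (\<lambda>t. cmod (Rfun g a b n t)) at_top
        (at y within {a - \<alpha> <.. \<alpha> - (1 - a*b) * real n / b})"

definition minus_pt :: "(real \<Rightarrow> complex) \<Rightarrow> real \<Rightarrow> real \<Rightarrow> real \<Rightarrow> nat \<Rightarrow> nat \<Rightarrow> real \<Rightarrow> bool" where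
  "minus_pt g \<alpha> a b M n y \<longleftrightarrow> kappa \<alpha> a b M \<noteq> 0 \<and> 1 \<le> n \<and> n \<le> kappa \<alpha> a b M \<and>
     -\<alpha> + (1 - a*b) * real n / b \<le> y \<and> y < \<alpha> - a \<and> g y = 0 \<and>
     filterlim (\<lambda>t. cmod (Lfun g a b n t)) at_top
        (at y within {-\<alpha> + (1 - a*b) * real n / b ..< \<alpha> - a})"

end

theory Submission
  imports Defs "HOL-Complex_Analysis.Cauchy_Integral_Theorem"
begin

text \<open>
  Put c = 1/b - a. Parseval's identity for Fourier series on an interval of length 1/b turns the frame sums
  into integrals over x of quadratic forms given by the matrices with entries g(x + k/b - na). As g vanishes
  outside ]-a,a[, these matrices split into finite bidiagonal blocks: the block through y in [0,a] has columns
  with entries g(y+jc), g(y+jc-a), where 0 \<le> y+jc \<le> a. A block fails to be injective iff g(y+ic) = 0 = g(y+jc-a)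
  for some i \<le> j. By compactness, if this never happens the blocks have uniformly bounded left inverses,
  obtained by forward and backward substitution, and their entries are the values of a dual window.
  If it does happen, a kernel vector of the block spread over a short interval violates the lower frame bound.
  Finally, (i) and (ii) exclude all pairs of zeros: if (ii) holds for 1,...,n-1 at a zero y of g, then
  the numerator of R_n(y) does not vanish, so |R_n| automatically tends to infinity at y.
\<close>

section \<open>Square-integrable functions\<close>

text \<open>Duality of \<open>g\<close> and \<open>h\<close> says that the sum over n of conj h(x +
  k/b - n*a) * g(x - n*a) is b for k = 0 and 0 for every other k. With z = x + k/b fixed and k
  varying, only the values of \<open>h\<close> on z + a*Z occur. So \<open>h\<close> may be
  prescribed on each coset of a*Z separately; a coset asks for one row of a left inverse, the row
  recovering the column through y = z mod a. That row can be found by eliminating the columns before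
  y, with pivots g(y - l*c), or those after y, with pivots g(y + l*c - a). If a pivot of each kind
  vanished, the two zeros would form the forbidden pair, so one direction always works. A uniform
  threshold in place of mere nonvanishing decides which, and keeps \<open>h\<close> bounded. The
  bound ab < M/(M+1) says exactly a < M*c: an elimination takes fewer than M steps, hence the
  support in [-aM, aM]. The lower frame bound comes from the expansion of f by the two systems
  together with their Bessel bounds.\<close>

definition sq_integrable :: "'a measure \<Rightarrow> ('a \<Rightarrow> complex) \<Rightarrow> bool" where
  "sq_integrable M f \<longleftrightarrow> f \<in> borel_measurable M \<and> integrable M (\<lambda>x. (cmod (f x))\<^sup>2)"

lemma sq_integrable_measurable[measurable_dest]: "sq_integrable M f \<Longrightarrow> f \<in> borel_measurable M"
  and sq_integrable_norm_sq: "sq_integrable M f \<Longrightarrow> integrable M (\<lambda>x. (cmod (f x))\<^sup>2)"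
  by (auto simp: sq_integrable_def)

lemma borel_measurable_cnj[measurable]: "cnj \<in> borel_measurable borel"
  by (intro borel_measurable_continuous_onI continuous_intros)

lemma norm_add_sq_eq: "(cmod (x + y))\<^sup>2 = (cmod x)\<^sup>2 + (cmod y)\<^sup>2 + 2 * Re (x * cnj y)"
  unfolding cmod_power2 by (simp add: power2_eq_square algebra_simps)

lemma norm_add_sq_le: "(cmod (x + y))\<^sup>2 \<le> 2 * (cmod x)\<^sup>2 + 2 * (cmod y)\<^sup>2"
proof -
  have "(cmod (x + y))\<^sup>2 \<le> (cmod x + cmod y)\<^sup>2"
    by (intro power_mono norm_triangle_ineq) auto
  also have "\<dots> \<le> 2 * (cmod x)\<^sup>2 + 2 * (cmod y)\<^sup>2"
    using sum_squares_bound[of "cmod x" "cmod y"] by (simp add: power2_sum)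
  finally show ?thesis .
qed

lemma sq_integrable_add:
  assumes "sq_integrable M f" "sq_integrable M g"
  shows "sq_integrable M (\<lambda>x. f x + g x)"
  unfolding sq_integrable_def
proof
  note [measurable] = assms[THEN sq_integrable_measurable]
  show "(\<lambda>x. f x + g x) \<in> borel_measurable M" by measurable
  have "integrable M (\<lambda>x. 2 * (cmod (f x))\<^sup>2 + 2 * (cmod (g x))\<^sup>2)"
    using assms by (auto simp: sq_integrable_def)
  then show "integrable M (\<lambda>x. (cmod (f x + g x))\<^sup>2)"
    by (rule Bochner_Integration.integrable_bound) (auto simp: norm_add_sq_le)
qed

lemma sq_integrable_cmult: "sq_integrable M f \<Longrightarrow> sq_integrable M (\<lambda>x. c * f x)"
  by (auto simp: sq_integrable_def norm_mult power_mult_distrib)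

lemma sq_integrable_diff:
  assumes "sq_integrable M f" "sq_integrable M g"
  shows "sq_integrable M (\<lambda>x. f x - g x)"
  using sq_integrable_add[OF assms(1) sq_integrable_cmult[OF assms(2), of "-1"]] by simp

lemma sq_integrable_0: "sq_integrable M (\<lambda>x. 0)"
  by (auto simp: sq_integrable_def)

lemma sq_integrable_sum:
  "(\<And>i. i \<in> S \<Longrightarrow> sq_integrable M (f i)) \<Longrightarrow> sq_integrable M (\<lambda>x. \<Sum>i\<in>S. f i x)"
  by (induction S rule: infinite_finite_induct) (auto simp: sq_integrable_0 intro!: sq_integrable_add)

text \<open>Weighted arithmetic-geometric mean, from (s|x| - |y|)^2 >= 0. The free weight
  \<open>s\<close> lets it stand in for Cauchy-Schwarz termwise, under sums and integrals alike; the
  weight is tuned at each use.\<close>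

lemma norm_mult_cnj_le:
  assumes "s > 0"
  shows "cmod (x * cnj y) \<le> s / 2 * (cmod x)\<^sup>2 + 1 / (2 * s) * (cmod y)\<^sup>2"
proof -
  have "0 \<le> (s * cmod x - cmod y)\<^sup>2" by simp
  then have "2 * s * (cmod x * cmod y) \<le> s\<^sup>2 * (cmod x)\<^sup>2 + (cmod y)\<^sup>2"
    by (simp add: power2_diff power_mult_distrib mult_ac)
  then have "(2 * s * (cmod x * cmod y)) / (2 * s) \<le> (s\<^sup>2 * (cmod x)\<^sup>2 + (cmod y)\<^sup>2) / (2 * s)"
    using assms by (intro divide_right_mono) auto
  then show ?thesis using assms by (simp add: norm_mult field_simps power2_eq_square)
qed

lemma integrable_mult_cnj:
  assumes "sq_integrable M f" "sq_integrable M g"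
  shows "integrable M (\<lambda>x. f x * cnj (g x))"
proof -
  note [measurable] = assms[THEN sq_integrable_measurable]
  have "integrable M (\<lambda>x. 1 / 2 * (cmod (f x))\<^sup>2 + 1 / (2 * 1) * (cmod (g x))\<^sup>2)"
    using assms by (auto simp: sq_integrable_def)
  then show ?thesis
    by (rule Bochner_Integration.integrable_bound)
       (auto intro!: AE_I2 order_trans[OF norm_mult_cnj_le[of 1]])
qed

lemma integral_mult_cnj_le:
  assumes "sq_integrable M f" "sq_integrable M g" "s > 0"
  shows "cmod (\<integral>x. f x * cnj (g x) \<partial>M)
    \<le> s / 2 * (\<integral>x. (cmod (f x))\<^sup>2 \<partial>M) + 1 / (2 * s) * (\<integral>x. (cmod (g x))\<^sup>2 \<partial>M)"
proof -
  have i: "integrable M (\<lambda>x. (cmod (f x))\<^sup>2)" "integrable M (\<lambda>x. (cmod (g x))\<^sup>2)"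
    using assms by (auto simp: sq_integrable_def)
  have "cmod (\<integral>x. f x * cnj (g x) \<partial>M) \<le> (\<integral>x. cmod (f x * cnj (g x)) \<partial>M)"
    by (rule integral_norm_bound)
  also have "\<dots> \<le> (\<integral>x. s / 2 * (cmod (f x))\<^sup>2 + 1 / (2 * s) * (cmod (g x))\<^sup>2 \<partial>M)"
    using i integrable_mult_cnj[OF assms(1,2)]
    by (intro integral_mono Bochner_Integration.integrable_add integrable_mult_right integrable_norm
        norm_mult_cnj_le assms(3)) auto
  also have "\<dots> = s / 2 * (\<integral>x. (cmod (f x))\<^sup>2 \<partial>M) + 1 / (2 * s) * (\<integral>x. (cmod (g x))\<^sup>2 \<partial>M)"
    using i by (subst Bochner_Integration.integral_add) auto
  finally show ?thesis .
qed

text \<open>A partial sum of the expansion is the best approximation of \<open>F\<close> among the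
  combinations over the same finite set. A good combination over one set thus forces good partial
  sums over every larger finite set, which is the convergence that \<open>has_sum\<close>
  demands.\<close>

lemma orthogonal_expansion_has_sum:
  fixes e :: "'i \<Rightarrow> 'a \<Rightarrow> complex"
  assumes e: "\<And>m. sq_integrable M (e m)" and T: "T > 0"
    and orth: "\<And>m n. (\<integral>x. e m x * cnj (e n x) \<partial>M) = (if m = n then of_real T else 0)"
    and F: "sq_integrable M F" and G: "sq_integrable M G"
    and dense: "\<And>\<epsilon>::real. \<epsilon> > 0 \<Longrightarrow> \<exists>S c. finite S \<and> (\<integral>x. (cmod (F x - (\<Sum>m\<in>S. c m * e m x)))\<^sup>2 \<partial>M) < \<epsilon>"
  shows "((\<lambda>m. (\<integral>x. F x * cnj (e m x) \<partial>M) * (\<integral>x. e m x * cnj (G x) \<partial>M)) has_sum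
     (T * (\<integral>x. F x * cnj (G x) \<partial>M))) UNIV"
proof -
  \<comment> \<open>The orthogonal projection of \<open>F\<close> onto the span of the
    \<open>e m\<close> with m in \<open>S\<close>; the division by \<open>T\<close> accounts for
    their squared norm.\<close>
  define P where "P S x = (\<Sum>m\<in>S. (\<integral>x. F x * cnj (e m x) \<partial>M) / T * e m x)" for S x
  have P: "sq_integrable M (P S)" for S
    unfolding P_def by (intro sq_integrable_sum sq_integrable_cmult e)
  have FP: "sq_integrable M (\<lambda>x. F x - P S x)" for S by (intro sq_integrable_diff P F)
  have Pi: "(\<integral>x. P S x * cnj (H x) \<partial>M) = (\<Sum>m\<in>S. (\<integral>x. F x * cnj (e m x) \<partial>M) / T * (\<integral>x. e m x * cnj (H x) \<partial>M))"
    if "sq_integrable M H" for S H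
    unfolding P_def sum_distrib_right mult.assoc
    by (subst Bochner_Integration.integral_sum) (auto intro!: integrable_mult_cnj e that)
  have ortho: "(\<integral>x. (F x - P S x) * cnj (e n x) \<partial>M) = 0" if "finite S" "n \<in> S" for S n
  proof -
    have "(\<integral>x. (F x - P S x) * cnj (e n x) \<partial>M) = (\<integral>x. F x * cnj (e n x) \<partial>M) - (\<integral>x. P S x * cnj (e n x) \<partial>M)"
      unfolding left_diff_distrib
      by (intro Bochner_Integration.integral_diff integrable_mult_cnj F P e)
    also have "\<dots> = 0"
      using that T by (simp add: Pi e orth sum.delta' if_distrib[of "\<lambda>x. _ * x"] cong: if_cong)
    finally show ?thesis .
  qed
  have best: "(\<integral>x. (cmod (F x - P S x))\<^sup>2 \<partial>M) \<le> (\<integral>x. (cmod (F x - (\<Sum>m\<in>S. c m * e m x)))\<^sup>2 \<partial>M)"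
    if "finite S" for S c
  proof -
    \<comment> \<open>The projection minus the competitor. It lies in the span, hence is orthogonal
      to \<open>F - P S\<close>, and Pythagoras gives the comparison.\<close>
    define Q where "Q x = (\<Sum>m\<in>S. ((\<integral>x. F x * cnj (e m x) \<partial>M) / T - c m) * e m x)" for x
    have Q: "sq_integrable M Q" unfolding Q_def by (intro sq_integrable_sum sq_integrable_cmult e)
    have Q_eq: "F x - (\<Sum>m\<in>S. c m * e m x) = (F x - P S x) + Q x" for x
      by (simp add: Q_def P_def left_diff_distrib sum_subtractf)
    have z: "(\<integral>x. (F x - P S x) * cnj (Q x) \<partial>M) = 0"
    proof -
      have "(\<integral>x. (F x - P S x) * cnj (Q x) \<partial>M)
         = (\<integral>x. (\<Sum>m\<in>S. cnj ((\<integral>x. F x * cnj (e m x) \<partial>M) / T - c m) * ((F x - P S x) * cnj (e m x))) \<partial>M)"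
        by (intro Bochner_Integration.integral_cong refl) (simp add: Q_def sum_distrib_left mult_ac)
      also have "\<dots> = (\<Sum>m\<in>S. cnj ((\<integral>x. F x * cnj (e m x) \<partial>M) / T - c m) * (\<integral>x. (F x - P S x) * cnj (e m x) \<partial>M))"
        by (subst Bochner_Integration.integral_sum) (auto intro!: integrable_mult_right integrable_mult_cnj FP e)
      also have "\<dots> = 0" using that by (simp add: ortho)
      finally show ?thesis .
    qed
    have "(\<integral>x. (cmod (F x - P S x))\<^sup>2 \<partial>M) \<le> (\<integral>x. (cmod (F x - P S x))\<^sup>2 \<partial>M) + (\<integral>x. (cmod (Q x))\<^sup>2 \<partial>M)
        + 2 * Re (\<integral>x. (F x - P S x) * cnj (Q x) \<partial>M)"
      by (simp add: z)
    also have "\<dots> = (\<integral>x. (cmod (F x - P S x))\<^sup>2 + (cmod (Q x))\<^sup>2 + 2 * Re ((F x - P S x) * cnj (Q x)) \<partial>M)"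
    proof -
      have "integrable M (\<lambda>x. (cmod (F x - P S x))\<^sup>2)" "integrable M (\<lambda>x. (cmod (Q x))\<^sup>2)"
        "integrable M (\<lambda>x. (F x - P S x) * cnj (Q x))"
        using FP Q by (auto intro: sq_integrable_norm_sq integrable_mult_cnj)
      note i = this
      have r: "integrable M (\<lambda>x. 2 * Re ((F x - P S x) * cnj (Q x)))"
        using i(3) by (intro integrable_mult_right integrable_Re)
      show ?thesis
        using i r integral_Re[OF i(3)] by (simp only: Bochner_Integration.integral_add
            Bochner_Integration.integrable_add integral_mult_right_zero)
    qed
    also have "\<dots> = (\<integral>x. (cmod (F x - (\<Sum>m\<in>S. c m * e m x)))\<^sup>2 \<partial>M)"
      by (simp only: Q_eq norm_add_sq_eq)
    finally show ?thesis .
  qed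
  show ?thesis
    unfolding has_sum_def
  proof (rule tendstoI)
    fix \<eta> :: real assume \<eta>: "\<eta> > 0"
    define B where "B = (\<integral>x. (cmod (G x))\<^sup>2 \<partial>M)"
    have B: "B \<ge> 0" by (simp add: B_def)
    \<comment> \<open>This weight makes both terms of the final estimate \<eta>/2: one from the
      approximation error \<eta>/(T*s), the other from \<open>B + 1\<close>, which is positive even
      when \<open>B\<close> is zero.\<close>
    define s where "s = T * (B + 1) / \<eta>"
    have s: "s > 0" using B T \<eta> by (simp add: s_def)
    obtain S0 c where S0: "finite S0" and c: "(\<integral>x. (cmod (F x - (\<Sum>m\<in>S0. c m * e m x)))\<^sup>2 \<partial>M) < \<eta> / (T * s)"
      using dense[of "\<eta> / (T * s)"] \<eta> T s by auto
    show "\<forall>\<^sub>F S in finite_subsets_at_top UNIV.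
       dist (\<Sum>m\<in>S. (\<integral>x. F x * cnj (e m x) \<partial>M) * (\<integral>x. e m x * cnj (G x) \<partial>M)) (T * (\<integral>x. F x * cnj (G x) \<partial>M)) < \<eta>"
      unfolding eventually_finite_subsets_at_top
    proof (intro exI[of _ S0] conjI allI impI S0 subset_UNIV)
      fix S :: "'i set" assume "finite S \<and> S0 \<subseteq> S \<and> S \<subseteq> UNIV"
      then have S: "finite S" "S0 \<subseteq> S" by auto
      \<comment> \<open>Padding the coefficients with zeros on S - S0 makes the approximant over
        \<open>S0\<close> a competitor over \<open>S\<close>.\<close>
      have "(\<integral>x. (cmod (F x - P S x))\<^sup>2 \<partial>M) \<le> (\<integral>x. (cmod (F x - (\<Sum>m\<in>S. (if m \<in> S0 then c m else 0) * e m x)))\<^sup>2 \<partial>M)"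
        by (rule best[OF S(1)])
      also have "(\<lambda>x. \<Sum>m\<in>S. (if m \<in> S0 then c m else 0) * e m x) = (\<lambda>x. \<Sum>m\<in>S0. c m * e m x)"
        by (intro ext sum.mono_neutral_cong_right S) auto
      then have "(\<integral>x. (cmod (F x - (\<Sum>m\<in>S. (if m \<in> S0 then c m else 0) * e m x)))\<^sup>2 \<partial>M)
          = (\<integral>x. (cmod (F x - (\<Sum>m\<in>S0. c m * e m x)))\<^sup>2 \<partial>M)" by (metis (lifting))
      also have "\<dots> < \<eta> / (T * s)" by (rule c)
      finally have FPs: "(\<integral>x. (cmod (F x - P S x))\<^sup>2 \<partial>M) < \<eta> / (T * s)" .
      have "T * (\<integral>x. F x * cnj (G x) \<partial>M) - (\<Sum>m\<in>S. (\<integral>x. F x * cnj (e m x) \<partial>M) * (\<integral>x. e m x * cnj (G x) \<partial>M))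
          = T * ((\<integral>x. F x * cnj (G x) \<partial>M) - (\<integral>x. P S x * cnj (G x) \<partial>M))"
        using T by (simp add: Pi[OF G] right_diff_distrib sum_distrib_left)
      also have "\<dots> = T * (\<integral>x. (F x - P S x) * cnj (G x) \<partial>M)"
        unfolding left_diff_distrib
        by (subst Bochner_Integration.integral_diff) (intro integrable_mult_cnj F P G refl)+
      finally have "dist (\<Sum>m\<in>S. (\<integral>x. F x * cnj (e m x) \<partial>M) * (\<integral>x. e m x * cnj (G x) \<partial>M)) (T * (\<integral>x. F x * cnj (G x) \<partial>M))
          = T * cmod (\<integral>x. (F x - P S x) * cnj (G x) \<partial>M)"
        using T by (simp add: dist_commute dist_norm norm_mult)
      also have "\<dots> \<le> T * (s / 2 * (\<integral>x. (cmod (F x - P S x))\<^sup>2 \<partial>M) + 1 / (2 * s) * B)"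
        unfolding B_def using T by (intro mult_left_mono integral_mult_cnj_le FP G s) auto
      also have "\<dots> < T * (s / 2 * (\<eta> / (T * s)) + 1 / (2 * s) * (B + 1))"
        using T s FPs by (intro mult_strict_left_mono add_strict_mono) auto
      also have "\<dots> = \<eta>"
      proof -
        have "T * (B + 1) = \<eta> * s" using \<eta> by (simp add: s_def)
        then have "T * (1 / (2 * s) * (B + 1)) = \<eta> / 2" using s by (simp add: mult.left_commute)
        moreover have "T * (s / 2 * (\<eta> / (T * s))) = \<eta> / 2" using s T by simp
        ultimately show ?thesis by (simp only: distrib_left field_sum_of_halves)
      qed
      finally show "dist (\<Sum>m\<in>S. (\<integral>x. F x * cnj (e m x) \<partial>M) * (\<integral>x. e m x * cnj (G x) \<partial>M)) (T * (\<integral>x. F x * cnj (G x) \<partial>M)) < \<eta>" .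
    qed
  qed
qed


section \<open>Parseval's identity on a period\<close>

definition trig_poly :: "real \<Rightarrow> (real \<Rightarrow> complex) \<Rightarrow> bool" where
  "trig_poly T p \<longleftrightarrow> (\<exists>S c. finite S \<and> (\<forall>x. p x = (\<Sum>m\<in>S. c m * cis (2 * pi * real_of_int m * x / T))))"

lemma trig_polyI:
  "finite S \<Longrightarrow> (\<And>x. p x = (\<Sum>m\<in>S. c m * cis (2 * pi * real_of_int m * x / T))) \<Longrightarrow> trig_poly T p"
  unfolding trig_poly_def by blast

lemma trig_poly_cis: "trig_poly T (\<lambda>x. c * cis (2 * pi * real_of_int m * x / T))"
  by (rule trig_polyI[of "{m}" _ "\<lambda>_. c"]) auto

lemma trig_poly_const: "trig_poly T (\<lambda>x. c)"
  using trig_poly_cis[of T c 0] by (simp add: cis_zero)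

lemma trig_poly_add:
  assumes "trig_poly T p" "trig_poly T q"
  shows "trig_poly T (\<lambda>x. p x + q x)"
proof -
  obtain S c where S: "finite S" "\<And>x. p x = (\<Sum>m\<in>S. c m * cis (2 * pi * real_of_int m * x / T))"
    using assms(1) unfolding trig_poly_def by blast
  obtain S' c' where S': "finite S'" "\<And>x. q x = (\<Sum>m\<in>S'. c' m * cis (2 * pi * real_of_int m * x / T))"
    using assms(2) unfolding trig_poly_def by blast
  have 1: "p x = (\<Sum>m\<in>S \<union> S'. (if m \<in> S then c m else 0) * cis (2 * pi * real_of_int m * x / T))" for x
    unfolding S(2) by (rule sum.mono_neutral_cong_left) (use S(1) S'(1) in auto)
  have 2: "q x = (\<Sum>m\<in>S \<union> S'. (if m \<in> S' then c' m else 0) * cis (2 * pi * real_of_int m * x / T))" for x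
    unfolding S'(2) by (rule sum.mono_neutral_cong_left) (use S(1) S'(1) in auto)
  show ?thesis
    by (rule trig_polyI[of "S \<union> S'" _ "\<lambda>m. (if m \<in> S then c m else 0) + (if m \<in> S' then c' m else 0)"])
       (use S(1) S'(1) in \<open>auto simp only: 1 2 distrib_right sum.distrib finite_Un\<close>)
qed

lemma trig_poly_sum: "(\<And>i. i \<in> A \<Longrightarrow> trig_poly T (p i)) \<Longrightarrow> trig_poly T (\<lambda>x. \<Sum>i\<in>A. p i x)"
  by (induction A rule: infinite_finite_induct) (auto intro!: trig_poly_add trig_poly_const)

lemma trig_poly_mult:
  assumes "trig_poly T p" "trig_poly T q"
  shows "trig_poly T (\<lambda>x. p x * q x)"
proof -
  obtain S c where S: "finite S" "\<And>x. p x = (\<Sum>m\<in>S. c m * cis (2 * pi * real_of_int m * x / T))"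
    using assms(1) unfolding trig_poly_def by blast
  obtain S' c' where S': "finite S'" "\<And>x. q x = (\<Sum>m\<in>S'. c' m * cis (2 * pi * real_of_int m * x / T))"
    using assms(2) unfolding trig_poly_def by blast
  have "p x * q x = (\<Sum>m\<in>S. \<Sum>n\<in>S'. (c m * c' n) * cis (2 * pi * real_of_int (m + n) * x / T))" for x
    unfolding S(2) S'(2) sum_product
    by (intro sum.cong refl) (simp add: cis_mult[symmetric] ring_distribs add_divide_distrib)
  then show ?thesis by (simp only:) (intro trig_poly_sum trig_poly_cis)
qed

text \<open>Stone-Weierstrass delivers polynomials in the real coordinates of a point z of the
  circle. There conj z = 1/z, so a linear form is a combination of two exponentials, and
  trigonometric polynomials are closed under sums and products.\<close>

lemma real_polynomial_function_trig_poly: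
  assumes "real_polynomial_function (p :: complex \<Rightarrow> real)"
  shows "trig_poly T (\<lambda>x. complex_of_real (p (cis (2 * pi * x / T))))"
  using assms
proof induction
  case (linear f)
  interpret bounded_linear f by fact
  have f: "f z = Re z * f 1 + Im z * f \<i>" for z
  proof -
    have "f (Re z *\<^sub>R 1 + Im z *\<^sub>R \<i>) = Re z * f 1 + Im z * f \<i>" by (simp only: add scaleR) simp
    then show ?thesis by (simp add: scaleR_conv_of_real complex_eq[symmetric] mult.commute)
  qed
  \<comment> \<open>The coefficients of z and conj z in \<open>f z\<close>, from Re z = (z + conj
    z)/2 and Im z = (z - conj z)/(2i).\<close>
  define A B where "A = complex_of_real (f 1) / 2 + complex_of_real (f \<i>) / (2 * \<i>)"
    and "B = complex_of_real (f 1) / 2 - complex_of_real (f \<i>) / (2 * \<i>)"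
  have "complex_of_real (f (cis (2 * pi * x / T))) =
      A * cis (2 * pi * real_of_int 1 * x / T) + B * cis (2 * pi * real_of_int (-1) * x / T)" for x
    by (subst f) (simp add: A_def B_def complex_eq_iff field_simps)
  then show ?case by (simp only:) (intro trig_poly_add trig_poly_cis)
next
  case (mult f g)
  then show ?case using trig_poly_mult by simp
next
  case (add f g)
  then show ?case using trig_poly_add by simp
qed (rule trig_poly_const)

section \<open>The L2-closure of the trigonometric polynomials on one period\<close>

abbreviation period_measure :: "real \<Rightarrow> real measure" where
  "period_measure T \<equiv> restrict_space lborel {0<..T}"

lemma finite_measure_period: "finite_measure (period_measure T)"
  by (intro finite_measureI, cases "T \<ge> 0") (auto simp: emeasure_restrict_space space_restrict_space)

text \<open>Naming the closure turns density into closure properties: it will contain the continuous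
  functions on the circle, then indicators, simple functions, and finally every square-integrable
  function.\<close>

definition trig_approx :: "real \<Rightarrow> (real \<Rightarrow> complex) \<Rightarrow> bool" where
  "trig_approx T F \<longleftrightarrow> sq_integrable (period_measure T) F \<and>
     (\<forall>\<epsilon>>0. \<exists>p. trig_poly T p \<and> (\<integral>x. (cmod (F x - p x))\<^sup>2 \<partial>period_measure T) < \<epsilon>)"

lemma sq_integrable_period_bounded:
  assumes [measurable]: "f \<in> borel_measurable (period_measure T)"
    and "\<And>x. cmod (f x) \<le> C"
  shows "sq_integrable (period_measure T) f"
proof -
  interpret finite_measure "period_measure T" by (rule finite_measure_period)
  have "(cmod (f x))\<^sup>2 \<le> C\<^sup>2" for x by (intro power_mono assms) auto
  then have "integrable (period_measure T) (\<lambda>x. (cmod (f x))\<^sup>2)"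
    by (intro integrable_const_bound[of _ "C\<^sup>2"]) auto
  then show ?thesis by (simp add: sq_integrable_def)
qed

lemma borel_measurable_cis[measurable]: "cis \<in> borel_measurable borel"
  by (intro borel_measurable_continuous_onI continuous_intros)

lemma measurable_period: "f \<in> borel_measurable borel \<Longrightarrow> f \<in> borel_measurable (period_measure T)"
  by (intro measurable_restrict_space1) simp

lemma sq_integrable_cis: "sq_integrable (period_measure T) (\<lambda>x. cis (2 * pi * real_of_int m * x / T))"
  by (intro sq_integrable_period_bounded[where C=1] measurable_period) auto

lemma sq_integrable_trig_poly: "trig_poly T p \<Longrightarrow> sq_integrable (period_measure T) p"
proof -
  assume "trig_poly T p"
  then obtain S c where S: "finite S" "\<And>x. p x = (\<Sum>m\<in>S. c m * cis (2 * pi * real_of_int m * x / T))"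
    unfolding trig_poly_def by blast
  have "sq_integrable (period_measure T) (\<lambda>x. \<Sum>m\<in>S. c m * cis (2 * pi * real_of_int m * x / T))"
    by (intro sq_integrable_sum sq_integrable_cmult sq_integrable_cis)
  then show ?thesis by (simp only: S(2)[symmetric])
qed

lemma integral_norm_add_sq_le:
  assumes "sq_integrable M f" "sq_integrable M g"
  shows "(\<integral>x. (cmod (f x + g x))\<^sup>2 \<partial>M) \<le> 2 * (\<integral>x. (cmod (f x))\<^sup>2 \<partial>M) + 2 * (\<integral>x. (cmod (g x))\<^sup>2 \<partial>M)"
proof -
  have "(\<integral>x. (cmod (f x + g x))\<^sup>2 \<partial>M) \<le> (\<integral>x. 2 * (cmod (f x))\<^sup>2 + 2 * (cmod (g x))\<^sup>2 \<partial>M)"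
    using sq_integrable_norm_sq[OF sq_integrable_add[OF assms]] assms[THEN sq_integrable_norm_sq]
    by (intro integral_mono norm_add_sq_le) auto
  then show ?thesis
    using assms[THEN sq_integrable_norm_sq] by (subst (asm) Bochner_Integration.integral_add) auto
qed

lemma trig_approx_trig_poly: "trig_poly T p \<Longrightarrow> trig_approx T p"
  unfolding trig_approx_def by (auto intro!: sq_integrable_trig_poly exI[of _ p])

lemma trig_approx_limit:
  assumes F: "sq_integrable (period_measure T) F"
    and approx: "\<And>\<epsilon>. \<epsilon> > 0 \<Longrightarrow> \<exists>H. trig_approx T H \<and> (\<integral>x. (cmod (F x - H x))\<^sup>2 \<partial>period_measure T) < \<epsilon>"
  shows "trig_approx T F"
  unfolding trig_approx_def
proof (intro conjI allI impI F)
  fix \<epsilon> :: real assume "\<epsilon> > 0"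
  then obtain H where H: "trig_approx T H" "(\<integral>x. (cmod (F x - H x))\<^sup>2 \<partial>period_measure T) < \<epsilon> / 4"
    using approx[of "\<epsilon> / 4"] by auto
  then obtain p where p: "trig_poly T p" "(\<integral>x. (cmod (H x - p x))\<^sup>2 \<partial>period_measure T) < \<epsilon> / 4"
    using \<open>\<epsilon> > 0\<close> unfolding trig_approx_def by (metis zero_less_divide_iff zero_less_numeral)
  have H': "sq_integrable (period_measure T) H" using H(1) by (simp add: trig_approx_def)
  have "(\<integral>x. (cmod ((F x - H x) + (H x - p x)))\<^sup>2 \<partial>period_measure T) < \<epsilon>"
    using integral_norm_add_sq_le[OF sq_integrable_diff[OF F H'] sq_integrable_diff[OF H' sq_integrable_trig_poly[OF p(1)]]]
      H(2) p(2) by linarith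
  then show "\<exists>p. trig_poly T p \<and> (\<integral>x. (cmod (F x - p x))\<^sup>2 \<partial>period_measure T) < \<epsilon>"
    using p(1) by auto
qed

lemma trig_approx_add:
  assumes "trig_approx T F" "trig_approx T G"
  shows "trig_approx T (\<lambda>x. F x + G x)"
  unfolding trig_approx_def
proof (intro conjI allI impI)
  have FG: "sq_integrable (period_measure T) F" "sq_integrable (period_measure T) G"
    using assms by (auto simp: trig_approx_def)
  then show "sq_integrable (period_measure T) (\<lambda>x. F x + G x)" by (rule sq_integrable_add)
  fix \<epsilon> :: real assume "\<epsilon> > 0"
  then have e: "\<epsilon> / 4 > 0" by simp
  obtain p where p: "trig_poly T p" "(\<integral>x. (cmod (F x - p x))\<^sup>2 \<partial>period_measure T) < \<epsilon> / 4"
    using assms(1) e unfolding trig_approx_def by meson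
  obtain q where q: "trig_poly T q" "(\<integral>x. (cmod (G x - q x))\<^sup>2 \<partial>period_measure T) < \<epsilon> / 4"
    using assms(2) e unfolding trig_approx_def by meson
  have "(\<integral>x. (cmod ((F x - p x) + (G x - q x)))\<^sup>2 \<partial>period_measure T) < \<epsilon>"
    using integral_norm_add_sq_le[OF sq_integrable_diff[OF FG(1) sq_integrable_trig_poly[OF p(1)]]
        sq_integrable_diff[OF FG(2) sq_integrable_trig_poly[OF q(1)]]]
      p(2) q(2) by linarith
  then show "\<exists>p. trig_poly T p \<and> (\<integral>x. (cmod (F x + G x - p x))\<^sup>2 \<partial>period_measure T) < \<epsilon>"
    using trig_poly_add[OF p(1) q(1)] by (intro exI[of _ "\<lambda>x. p x + q x"]) (simp add: algebra_simps)
qed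

lemma trig_approx_cmult:
  assumes "trig_approx T F"
  shows "trig_approx T (\<lambda>x. c * F x)"
  unfolding trig_approx_def
proof (intro conjI allI impI)
  show "sq_integrable (period_measure T) (\<lambda>x. c * F x)"
    using assms by (auto simp: trig_approx_def intro: sq_integrable_cmult)
  fix \<epsilon> :: real assume "\<epsilon> > 0"
  then have "\<epsilon> / ((cmod c)\<^sup>2 + 1) > 0" by (simp add: add_nonneg_pos)
  then obtain p where p: "trig_poly T p" "(\<integral>x. (cmod (F x - p x))\<^sup>2 \<partial>period_measure T) < \<epsilon> / ((cmod c)\<^sup>2 + 1)"
    using assms unfolding trig_approx_def by meson
  have "(\<integral>x. (cmod (c * F x - c * p x))\<^sup>2 \<partial>period_measure T) = (cmod c)\<^sup>2 * (\<integral>x. (cmod (F x - p x))\<^sup>2 \<partial>period_measure T)"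
    by (simp add: right_diff_distrib[symmetric] norm_mult power_mult_distrib)
  also have "\<dots> \<le> ((cmod c)\<^sup>2 + 1) * (\<integral>x. (cmod (F x - p x))\<^sup>2 \<partial>period_measure T)"
    by (intro mult_right_mono) auto
  also have "\<dots> < \<epsilon>" using p(2) by (simp add: pos_less_divide_eq add_nonneg_pos mult.commute)
  finally show "\<exists>p. trig_poly T p \<and> (\<integral>x. (cmod (c * F x - p x))\<^sup>2 \<partial>period_measure T) < \<epsilon>"
    using trig_poly_mult[OF trig_poly_const p(1)] by blast
qed

lemma trig_approx_sum:
  "(\<And>i. i \<in> S \<Longrightarrow> trig_approx T (F i)) \<Longrightarrow> trig_approx T (\<lambda>x. \<Sum>i\<in>S. F i x)"
  by (induction S rule: infinite_finite_induct)
     (simp_all add: trig_approx_add trig_approx_trig_poly trig_poly_const)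

text \<open>The later enlargements of the closure are all pointwise limits under a square-integrable
  majorant, so a single use of dominated convergence serves them all.\<close>

lemma trig_approx_dominated:
  assumes F: "F \<in> borel_measurable (period_measure T)"
    and H: "\<And>i. trig_approx T (H i)"
    and lim: "\<And>x. x \<in> {0<..T} \<Longrightarrow> (\<lambda>i. H i x) \<longlonglongrightarrow> F x"
    and w: "integrable (period_measure T) (\<lambda>x. (w x)\<^sup>2)"
    and bound: "\<And>i x. x \<in> {0<..T} \<Longrightarrow> cmod (H i x) \<le> w x"
  shows "trig_approx T F"
proof (rule trig_approx_limit)
  have sp: "space (period_measure T) = {0<..T}" by (simp add: space_restrict_space)
  have H': "sq_integrable (period_measure T) (H i)" for i using H by (simp add: trig_approx_def)
  note [measurable] = F H'[THEN sq_integrable_measurable]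
  have Fw: "cmod (F x) \<le> w x" if "x \<in> {0<..T}" for x
    using tendsto_norm[OF lim[OF that]] bound[OF that] by (intro LIMSEQ_le_const2) auto
  have "integrable (period_measure T) (\<lambda>x. (cmod (F x))\<^sup>2)"
    by (rule Bochner_Integration.integrable_bound[OF w])
       (auto intro!: AE_I2 power_mono Fw simp: sp)
  then show "sq_integrable (period_measure T) F" by (simp add: sq_integrable_def F)
  have "(\<lambda>i. \<integral>x. (cmod (F x - H i x))\<^sup>2 \<partial>period_measure T) \<longlonglongrightarrow> (\<integral>x. 0 \<partial>period_measure T)"
  proof (rule integral_dominated_convergence[where w="\<lambda>x. 4 * (w x)\<^sup>2"])
    show "integrable (period_measure T) (\<lambda>x. 4 * (w x)\<^sup>2)" using w by simp
    show "AE x in period_measure T. (\<lambda>i. (cmod (F x - H i x))\<^sup>2) \<longlonglongrightarrow> 0"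
    proof (rule AE_I2)
      fix x assume "x \<in> space (period_measure T)"
      then have "(\<lambda>i. (cmod (F x - H i x))\<^sup>2) \<longlonglongrightarrow> (cmod (F x - F x))\<^sup>2"
        by (intro tendsto_intros lim) (simp add: sp)
      then show "(\<lambda>i. (cmod (F x - H i x))\<^sup>2) \<longlonglongrightarrow> 0" by simp
    qed
    show "AE x in period_measure T. norm ((cmod (F x - H i x))\<^sup>2) \<le> 4 * (w x)\<^sup>2" for i
    proof (rule AE_I2)
      fix x assume "x \<in> space (period_measure T)"
      then have x: "x \<in> {0<..T}" by (simp add: sp)
      have "cmod (F x - H i x) \<le> 2 * w x"
        using norm_triangle_ineq4[of "F x" "H i x"] Fw[OF x] bound[OF x, of i] by linarith
      then have "(cmod (F x - H i x))\<^sup>2 \<le> (2 * w x)\<^sup>2" by (intro power_mono) auto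
      then show "norm ((cmod (F x - H i x))\<^sup>2) \<le> 4 * (w x)\<^sup>2" by (simp add: power_mult_distrib)
    qed
  qed measurable
  then have "(\<lambda>i. \<integral>x. (cmod (F x - H i x))\<^sup>2 \<partial>period_measure T) \<longlonglongrightarrow> 0" by simp
  note lim0 = this
  fix \<epsilon> :: real assume "\<epsilon> > 0"
  then obtain i where "(\<integral>x. (cmod (F x - H i x))\<^sup>2 \<partial>period_measure T) < \<epsilon>"
    using order_tendstoD(2)[OF lim0, of \<epsilon>] by (auto simp: eventually_sequentially)
  then show "\<exists>G. trig_approx T G \<and> (\<integral>x. (cmod (F x - G x))\<^sup>2 \<partial>period_measure T) < \<epsilon>"
    using H by blast
qed

lemma trig_approx_bounded_limit:
  assumes F: "F \<in> borel_measurable (period_measure T)"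
    and H: "\<And>i. trig_approx T (H i)"
    and lim: "\<And>x. x \<in> {0<..T} \<Longrightarrow> (\<lambda>i. H i x) \<longlonglongrightarrow> F x"
    and bound: "\<And>i x. x \<in> {0<..T} \<Longrightarrow> cmod (H i x) \<le> C"
  shows "trig_approx T F"
proof -
  interpret finite_measure "period_measure T" by (rule finite_measure_period)
  show ?thesis by (rule trig_approx_dominated[OF F H lim _ bound]) auto
qed

text \<open>Composing with \<open>cis\<close> makes periodicity automatic, so no matching of values
  at the ends of the period has to be arranged. Uniform approximation on the circle gives bounded
  pointwise convergence.\<close>

lemma trig_approx_continuous:
  fixes \<phi> :: "complex \<Rightarrow> real"
  assumes "continuous_on UNIV \<phi>"
  shows "trig_approx T (\<lambda>x. complex_of_real (\<phi> (cis (2 * pi * x / T))))"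
proof -
  have cs: "continuous_on (sphere 0 1) \<phi>" using assms by (rule continuous_on_subset) simp
  have "\<exists>p. real_polynomial_function p \<and> (\<forall>z\<in>sphere 0 1. \<bar>\<phi> z - p z\<bar> < 1 / Suc i)" for i
    using Stone_Weierstrass_real_polynomial_function[OF compact_sphere cs, of "1 / Suc i"]
    by (metis zero_less_divide_1_iff of_nat_0_less_iff zero_less_Suc)
  then obtain p where p: "\<And>i. real_polynomial_function (p i)"
      "\<And>i z. z \<in> sphere 0 1 \<Longrightarrow> \<bar>\<phi> z - p i z\<bar> < 1 / Suc i"
    by metis
  obtain C where "\<forall>t\<in>\<phi> ` sphere 0 1. norm t \<le> C"
    using compact_imp_bounded[OF compact_continuous_image[OF cs compact_sphere]]
    unfolding bounded_iff by blast
  then have C: "\<bar>\<phi> z\<bar> \<le> C" if "z \<in> sphere 0 1" for z using that by auto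
  have s: "cis t \<in> sphere 0 1" for t by simp
  show ?thesis
  proof (rule trig_approx_bounded_limit)
    show "trig_approx T (\<lambda>x. complex_of_real (p i (cis (2 * pi * x / T))))" for i
      by (intro trig_approx_trig_poly real_polynomial_function_trig_poly p)
    show "(\<lambda>i. complex_of_real (p i (cis (2 * pi * x / T)))) \<longlonglongrightarrow> complex_of_real (\<phi> (cis (2 * pi * x / T)))" for x
    proof (intro tendsto_of_real)
      have "(\<lambda>i. p i (cis (2 * pi * x / T)) - \<phi> (cis (2 * pi * x / T))) \<longlonglongrightarrow> 0"
      proof (rule Lim_null_comparison)
        show "\<forall>\<^sub>F i in sequentially. norm (p i (cis (2 * pi * x / T)) - \<phi> (cis (2 * pi * x / T))) \<le> 1 / real (Suc i)"
          using p(2)[OF s] by (intro always_eventually allI) (simp add: abs_minus_commute less_imp_le)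
        show "(\<lambda>i. 1 / real (Suc i)) \<longlonglongrightarrow> 0"
          using LIMSEQ_inverse_real_of_nat by (simp add: inverse_eq_divide)
      qed
      then show "(\<lambda>i. p i (cis (2 * pi * x / T))) \<longlonglongrightarrow> \<phi> (cis (2 * pi * x / T))"
        by (simp add: LIM_zero_iff)
    qed
    show "cmod (complex_of_real (p i (cis (2 * pi * x / T)))) \<le> C + 1" for i x
      using p(2)[OF s, of "2 * pi * x / T" i] C[OF s, of "2 * pi * x / T"]
      by (simp add: norm_of_real) (smt (verit) divide_le_eq_1_pos of_nat_0_le_iff)
    have [measurable]: "\<phi> \<in> borel_measurable borel"
      using assms by (rule borel_measurable_continuous_onI)
    show "(\<lambda>x. complex_of_real (\<phi> (cis (2 * pi * x / T)))) \<in> borel_measurable (period_measure T)"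
      by (intro measurable_period) measurable
  qed
qed

text \<open>Closed sets generate the Borel sets and are stable under intersection, so sigma-algebra
  induction applies. The indicator of a closed set is a limit of tent functions of the distance;
  complements and disjoint unions are handled by linearity and bounded limits.\<close>

lemma trig_approx_indicator_circle:
  assumes "B \<in> sets (borel :: complex measure)"
  shows "trig_approx T (\<lambda>x. indicator B (cis (2 * pi * x / T)))"
proof -
  have meas: "(\<lambda>x. indicator B (cis (2 * pi * x / T)) :: complex) \<in> borel_measurable (period_measure T)"
    if [measurable]: "B \<in> sets (borel :: complex measure)" for B
    by (intro measurable_period) measurable
  have eq: "sets (borel :: complex measure) = sigma_sets UNIV (Collect closed)"
    by (simp add: borel_eq_closed)
  have "Int_stable (Collect closed :: complex set set)" "(Collect closed :: complex set set) \<subseteq> Pow UNIV"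
    by (auto simp: Int_stable_def)
  from this assms[unfolded eq] show ?thesis
  proof (induction rule: sigma_sets_induct_disjoint)
    case (basic C)
    then have C: "closed C" by simp
    show ?case
    \<comment> \<open>By convention \<open>infdist\<close> to the empty set is 0, so the tent
      functions below would converge to 1 instead of 0.\<close>
    proof (cases "C = {}")
      case True
      then show ?thesis using trig_approx_trig_poly[OF trig_poly_const[of T 0]] by simp
    next
      case False
      define \<phi> where "\<phi> i z = max 0 (1 - real i * infdist z C)" for i :: nat and z
      show ?thesis
      proof (rule trig_approx_bounded_limit)
        show "trig_approx T (\<lambda>x. complex_of_real (\<phi> i (cis (2 * pi * x / T))))" for i
          by (rule trig_approx_continuous) (auto simp: \<phi>_def intro!: continuous_intros)
        show "cmod (complex_of_real (\<phi> i (cis (2 * pi * x / T)))) \<le> 1" for i x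
          by (auto simp: \<phi>_def infdist_nonneg)
        show "(\<lambda>x. indicator C (cis (2 * pi * x / T)) :: complex) \<in> borel_measurable (period_measure T)"
          using C by (intro meas) auto
        show "(\<lambda>i. complex_of_real (\<phi> i (cis (2 * pi * x / T)))) \<longlonglongrightarrow> indicator C (cis (2 * pi * x / T))" for x
        proof (cases "cis (2 * pi * x / T) \<in> C")
          case True
          then show ?thesis by (simp add: \<phi>_def)
        next
          case False
          define d where "d = infdist (cis (2 * pi * x / T)) C"
          have d: "d > 0"
            using in_closed_iff_infdist_zero[OF C \<open>C \<noteq> {}\<close>] False infdist_nonneg[of _ C]
            by (auto simp: d_def less_le)
          obtain N :: nat where N: "1 < real N * d" using reals_Archimedean3[OF d] by blast
          have "\<phi> i (cis (2 * pi * x / T)) = 0" if "i \<ge> N" for i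
          proof -
            have "real N * d \<le> real i * d" using that d by (intro mult_right_mono) auto
            then show ?thesis using N by (simp add: \<phi>_def d_def[symmetric])
          qed
          then have "\<forall>\<^sub>F i in sequentially. complex_of_real (\<phi> i (cis (2 * pi * x / T))) = 0"
            by (auto simp: eventually_sequentially)
          then show ?thesis using False by (simp add: tendsto_eventually)
        qed
      qed
    qed
  next
    case empty
    then show ?case using trig_approx_trig_poly[OF trig_poly_const[of T 0]] by simp
  next
    case (compl A)
    have "(\<lambda>x. indicator (UNIV - A) (cis (2 * pi * x / T)) :: complex)
        = (\<lambda>x. 1 + (-1) * indicator A (cis (2 * pi * x / T)))"
      by (auto simp: indicator_def)
    then show ?case
      using trig_approx_add[OF trig_approx_trig_poly[OF trig_poly_const[of T 1]] trig_approx_cmult[OF compl(2), of "-1"]]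
      by simp
  next
    case (union A)
    have A: "A i \<in> sets borel" for i using union(2) by (auto simp: eq)
    show ?case
    proof (rule trig_approx_bounded_limit)
      show "trig_approx T (\<lambda>x. \<Sum>i<n. indicator (A i) (cis (2 * pi * x / T)))" for n :: nat
        by (intro trig_approx_sum union(3))
      show "(\<lambda>x. indicator (\<Union> (range A)) (cis (2 * pi * x / T)) :: complex) \<in> borel_measurable (period_measure T)"
        using A by (intro meas) auto
      have ind: "(\<Sum>i<n. indicator (A i) z :: complex) = indicator (\<Union>i<n. A i) z" for n z
        using union(1) by (intro indicator_UN_disjoint[symmetric]) (auto intro: disjoint_family_on_mono)
      show "cmod (\<Sum>i<n. indicator (A i) (cis (2 * pi * x / T))) \<le> 1" for n x
        unfolding ind by (auto simp: indicator_def)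
      show "(\<lambda>n. \<Sum>i<n. indicator (A i) (cis (2 * pi * x / T)) :: complex)
          \<longlonglongrightarrow> indicator (\<Union> (range A)) (cis (2 * pi * x / T))" for x
        unfolding ind by (rule LIMSEQ_indicator_UN)
    qed
  qed
qed

text \<open>The map x -> cis(2*pi*x/T) is a bijection of ]0,T] onto the circle with a Borel inverse,
  so within the period \<open>A\<close> is the preimage of a Borel set of the circle.\<close>

lemma trig_approx_indicator:
  assumes T: "T > 0" and A: "A \<in> sets (borel :: real measure)"
  shows "trig_approx T (indicator A)"
proof -
  \<comment> \<open>The inverse map written with the principal logarithm. Using
    \<open>Ln (- z)\<close> puts its jump at z = 1, the end of the period, and ]0,T] then
    corresponds to the range ]-pi,pi] of the argument; this is why the period is open on the
    left.\<close>
  define B where "B = {z. T / 2 + T / (2 * pi) * Im (Ln (- z)) \<in> A}"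
  have [measurable]: "A \<in> sets (borel :: real measure)" by (rule A)
  have "{z \<in> space borel. T / 2 + T / (2 * pi) * Im (Ln (- z)) \<in> A} \<in> sets borel" by measurable
  then have B: "B \<in> sets borel" by (simp add: B_def)
  have eq: "indicator A x = (indicator B (cis (2 * pi * x / T)) :: complex)" if "x \<in> {0<..T}" for x
  proof -
    define t where "t = 2 * pi * x / T - pi"
    have t: "-pi < t" "t \<le> pi" using that T by (auto simp: t_def field_simps)
    have "- cis (2 * pi * x / T) = cis t"
      by (simp add: t_def complex_eq_iff cos_diff sin_diff)
    then have "- cis (2 * pi * x / T) = exp (\<i> * t)" by (simp only: cis_conv_exp)
    then have "Ln (- cis (2 * pi * x / T)) = \<i> * t" using t by (simp add: Ln_exp)
    then have "Im (Ln (- cis (2 * pi * x / T))) = t" by simp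
    then have "T / 2 + T / (2 * pi) * Im (Ln (- cis (2 * pi * x / T))) = x"
      using T by (simp only:) (simp add: t_def field_simps)
    then show ?thesis by (auto simp: B_def indicator_def)
  qed
  have a: "trig_approx T (\<lambda>x. indicator B (cis (2 * pi * x / T)))" by (rule trig_approx_indicator_circle[OF B])
  show ?thesis
  proof (rule trig_approx_bounded_limit[where H = "\<lambda>_ x. indicator B (cis (2 * pi * x / T))"])
    show "(indicator A :: real \<Rightarrow> complex) \<in> borel_measurable (period_measure T)"
      by (intro measurable_period) measurable
    show "cmod (indicator B (cis (2 * pi * x / T))) \<le> 1" for x by (auto simp: indicator_def)
  qed (use a eq in auto)
qed

lemma trig_approx_sq_integrable:
  assumes T: "T > 0" and F: "sq_integrable (period_measure T) F"
  shows "trig_approx T F"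
proof -
  have sp: "space (period_measure T) = {0<..T}" by (simp add: space_restrict_space)
  obtain s where s: "\<And>i. simple_function (period_measure T) (s i)"
      "\<And>x. x \<in> {0<..T} \<Longrightarrow> (\<lambda>i. s i x) \<longlonglongrightarrow> F x"
      "\<And>i x. x \<in> {0<..T} \<Longrightarrow> cmod (s i x) \<le> 2 * cmod (F x)"
    using borel_measurable_implies_sequence_metric[OF sq_integrable_measurable[OF F], of 0]
    unfolding sp norm_conv_dist by blast
  \<comment> \<open>\<open>s i\<close> is simple on the period only; the extra factor makes it a
    finite combination of indicators on the whole line.\<close>
  have simple: "trig_approx T (\<lambda>x. indicator {0<..T} x * s i x)" for i
  proof -
    have fin: "finite (s i ` {0<..T})" using s(1)[of i] by (simp add: simple_function_def sp)
    have A: "s i -` {y} \<inter> {0<..T} \<in> sets borel" if "y \<in> s i ` {0<..T}" for y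
      using s(1)[of i] that by (auto simp: simple_function_def sp sets_restrict_space)
    have "(\<Sum>y\<in>s i ` {0<..T}. y * indicator (s i -` {y} \<inter> {0<..T}) x) = indicator {0<..T} x * s i x" for x
    proof (cases "x \<in> {0<..T}")
      case True
      then have "(\<Sum>y\<in>s i ` {0<..T}. y * indicator (s i -` {y} \<inter> {0<..T}) x)
         = (\<Sum>y\<in>s i ` {0<..T}. if y = s i x then s i x else 0)"
        by (intro sum.cong refl) (auto simp: indicator_def)
      then show ?thesis using True fin by (simp add: sum.delta)
    qed (auto simp: indicator_def)
    then show ?thesis
      using trig_approx_sum[of "s i ` {0<..T}" T "\<lambda>y x. y * indicator (s i -` {y} \<inter> {0<..T}) x"]
        trig_approx_cmult[OF trig_approx_indicator[OF T A]] by simp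
  qed
  show ?thesis
  proof (rule trig_approx_dominated[OF sq_integrable_measurable[OF F], where H = "\<lambda>i x. indicator {0<..T} x * s i x"])
    show "integrable (period_measure T) (\<lambda>x. (2 * cmod (F x))\<^sup>2)"
      using sq_integrable_norm_sq[OF F] by (simp add: power_mult_distrib)
  qed (use s simple in \<open>auto simp: indicator_def\<close>)
qed

section \<open>Orthogonality of the exponentials and Parseval's identity\<close>

lemma integral_cis_period:
  assumes T: "T > 0"
  shows "(\<integral>x. cis (2 * pi * real_of_int m * x / T) * cnj (cis (2 * pi * real_of_int n * x / T)) \<partial>period_measure T)
     = (if m = n then of_real T else 0)"
proof -
  have eq: "cis (2 * pi * real_of_int m * x / T) * cnj (cis (2 * pi * real_of_int n * x / T))
      = cis (2 * pi * real_of_int (m - n) * x / T)" for x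
    by (simp add: cis_cnj cis_mult diff_divide_distrib ring_distribs)
  have *: "(\<integral>x. cis (2 * pi * real_of_int k * x / T) \<partial>period_measure T) = (if k = 0 then of_real T else 0)" for k
  proof (cases "k = 0")
    case True
    then show ?thesis using T by (simp add: measure_restrict_space space_restrict_space cis_zero scaleR_conv_of_real)
  next
    case False
    define w where "w = 2 * pi * real_of_int k / T"
    have w: "w \<noteq> 0" using False T by (simp add: w_def)
    have "(\<integral>x. cis (w * x) \<partial>period_measure T) = (LBINT x:{0<..T}. cis (w * x))"
      by (subst integral_restrict_space) (auto simp: set_lebesgue_integral_def)
    also have "\<dots> = (LBINT x=ereal 0..ereal T. cis (w * x))"
      using T by (subst interval_integral_Ioc) auto
    also have "\<dots> = cis (w * T) / (\<i> * w) - cis (w * 0) / (\<i> * w)"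
    proof (rule interval_integral_FTC_finite)
      show "continuous_on {min 0 T..max 0 T} (\<lambda>x. cis (w * x))" by (intro continuous_intros)
      show "((\<lambda>x. cis (w * x) / (\<i> * w)) has_vector_derivative cis (w * x)) (at x within {min 0 T..max 0 T})" for x
      proof -
        have "((\<lambda>x. cis (w * x)) has_derivative (\<lambda>t. (w * t) *\<^sub>R (\<i> * cis (w * x)))) (at x within {min 0 T..max 0 T})"
          by (auto intro!: derivative_eq_intros)
        then have "((\<lambda>x. cis (w * x)) has_vector_derivative (w *\<^sub>R (\<i> * cis (w * x)))) (at x within {min 0 T..max 0 T})"
          by (simp add: has_vector_derivative_def mult.commute)
        from has_vector_derivative_divide[OF this, of "\<i> * w"] show ?thesis
          using w by (simp add: scaleR_conv_of_real)
      qed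
    qed
    also have "cis (w * T) = 1"
      using T by (simp add: w_def complex_eq_iff)
    finally show ?thesis using False by (simp add: w_def)
  qed
  show ?thesis unfolding eq * by (simp only: right_minus_eq)
qed

theorem parseval_period:
  assumes T: "T > 0" and F: "sq_integrable (period_measure T) F" and G: "sq_integrable (period_measure T) G"
  shows "((\<lambda>m. (\<integral>x. F x * cnj (cis (2 * pi * real_of_int m * x / T)) \<partial>period_measure T)
            * (\<integral>x. cis (2 * pi * real_of_int m * x / T) * cnj (G x) \<partial>period_measure T))
     has_sum (T * (\<integral>x. F x * cnj (G x) \<partial>period_measure T))) UNIV"
proof (rule orthogonal_expansion_has_sum[OF sq_integrable_cis T integral_cis_period[OF T] F G])
  fix \<epsilon> :: real assume "\<epsilon> > 0"
  then obtain p where p: "trig_poly T p" "(\<integral>x. (cmod (F x - p x))\<^sup>2 \<partial>period_measure T) < \<epsilon>"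
    using trig_approx_sq_integrable[OF T F] unfolding trig_approx_def by blast
  then show "\<exists>S c. finite S \<and> (\<integral>x. (cmod (F x - (\<Sum>m\<in>S. c m * cis (2 * pi * real_of_int m * x / T))))\<^sup>2 \<partial>period_measure T) < \<epsilon>"
    unfolding trig_poly_def by (metis (no_types, lifting) ext)
qed


section \<open>Gabor systems with bounded, compactly supported windows\<close>

lemma integral_shift: "(\<integral>x. f (x + t) \<partial>lborel) = (\<integral>x. f x \<partial>lborel)"
  for f :: "real \<Rightarrow> 'a :: {banach, second_countable_topology}"
  using lborel_integral_real_affine[of 1 f t] by (simp add: add.commute)

lemma integrable_shift: "integrable lborel f \<Longrightarrow> integrable lborel (\<lambda>x. f (x + t))"
  for f :: "real \<Rightarrow> 'a :: {banach, second_countable_topology}"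
  using lborel_integrable_real_affine[of f 1 t] by (simp add: add.commute)

lemma sq_integrable_shift:
  fixes f :: "real \<Rightarrow> complex"
  assumes "sq_integrable lborel f"
  shows "sq_integrable lborel (\<lambda>x. f (x + t))"
proof -
  have [measurable]: "f \<in> borel_measurable borel" using assms by (simp add: sq_integrable_def)
  have "(\<lambda>x. f (x + t)) \<in> borel_measurable borel" by measurable
  then show ?thesis
    using integrable_shift[OF sq_integrable_norm_sq[OF assms], of t] by (simp add: sq_integrable_def)
qed

lemma integrable_period: "integrable lborel f \<Longrightarrow> integrable (period_measure T) f"
  for f :: "real \<Rightarrow> 'a :: {banach, second_countable_topology}"
  using integrable_mult_indicator[of "{0<..T}" lborel f] by (subst integrable_restrict_space) auto

lemma sq_integrable_period: "sq_integrable lborel f \<Longrightarrow> sq_integrable (period_measure T) f"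
  by (auto simp: sq_integrable_def intro: integrable_period measurable_period)

lemma integral_tile:
  fixes w :: "real \<Rightarrow> complex"
  assumes T: "T > 0" and w: "integrable lborel w"
    and supp: "\<And>x. x \<notin> {-(real J * T)<..real J * T} \<Longrightarrow> w x = 0"
  shows "(\<integral>x. w x \<partial>lborel) = (\<Sum>k\<in>{-int J..<int J}. \<integral>x. w (x + real_of_int k * T) \<partial>period_measure T)"
proof -
  have eq: "w x = (\<Sum>k\<in>{-int J..<int J}. indicator {real_of_int k * T<..real_of_int k * T + T} x *\<^sub>R w x)" for x
  proof (cases "x \<in> {-(real J * T)<..real J * T}")
    case True
    \<comment> \<open>The tiles are open on the left and closed on the right, so the tile containing
      x has index ceiling minus one rather than the floor.\<close>
    define k0 where "k0 = \<lceil>x / T\<rceil> - 1"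
    have iff: "x \<in> {real_of_int k * T<..real_of_int k * T + T} \<longleftrightarrow> k = k0" for k
    proof -
      have "x \<in> {real_of_int k * T<..real_of_int k * T + T} \<longleftrightarrow> real_of_int k < x / T \<and> x / T \<le> real_of_int k + 1"
        using T by (auto simp: field_simps)
      also have "\<dots> \<longleftrightarrow> k = k0" 
      proof -
        have "k = k0 \<longleftrightarrow> \<lceil>x / T\<rceil> = k + 1" by (auto simp: k0_def)
        then show ?thesis by (simp only: ceiling_eq_iff) auto
      qed
      finally show ?thesis .
    qed
    have "x / T \<le> real J" "- real J < x / T" using True T by (auto simp: field_simps)
    then have "k0 \<in> {-int J..<int J}" unfolding k0_def by (auto simp: ceiling_le_iff less_ceiling_iff) linarith+
    moreover have "(\<Sum>k\<in>{-int J..<int J}. indicator {real_of_int k * T<..real_of_int k * T + T} x *\<^sub>R w x)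
       = (\<Sum>k\<in>{-int J..<int J}. if k = k0 then w x else 0)"
      using iff by (intro sum.cong refl) (auto simp: indicator_def)
    ultimately show ?thesis by (simp add: sum.delta)
  qed (simp add: supp)
  have "(\<integral>x. w x \<partial>lborel) = (\<integral>x. (\<Sum>k\<in>{-int J..<int J}. indicator {real_of_int k * T<..real_of_int k * T + T} x *\<^sub>R w x) \<partial>lborel)"
    using eq by (intro Bochner_Integration.integral_cong refl) blast
  also have "\<dots> = (\<Sum>k\<in>{-int J..<int J}. \<integral>x. indicator {real_of_int k * T<..real_of_int k * T + T} x *\<^sub>R w x \<partial>lborel)"
    by (intro Bochner_Integration.integral_sum integrable_mult_indicator w) auto
  also have "\<dots> = (\<Sum>k\<in>{-int J..<int J}. \<integral>x. w (x + real_of_int k * T) \<partial>period_measure T)"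
  proof (intro sum.cong refl)
    fix k
    have "(\<integral>x. indicator {real_of_int k * T<..real_of_int k * T + T} x *\<^sub>R w x \<partial>lborel)
       = (\<integral>x. indicator {real_of_int k * T<..real_of_int k * T + T} (x + real_of_int k * T) *\<^sub>R w (x + real_of_int k * T) \<partial>lborel)"
      by (rule integral_shift[symmetric])
    also have "\<dots> = (\<integral>x. indicator {0<..T} x *\<^sub>R w (x + real_of_int k * T) \<partial>lborel)"
      by (intro Bochner_Integration.integral_cong refl) (auto simp: indicator_def)
    also have "\<dots> = (\<integral>x. w (x + real_of_int k * T) \<partial>period_measure T)"
      by (subst integral_restrict_space) auto
    finally show "(\<integral>x. indicator {real_of_int k * T<..real_of_int k * T + T} x *\<^sub>R w x \<partial>lborel)
       = (\<integral>x. w (x + real_of_int k * T) \<partial>period_measure T)" .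
  qed
  finally show ?thesis .
qed

lemma cis_periodic:
  assumes "T > 0"
  shows "cis (2 * pi * real_of_int m * (x + real_of_int k * T) / T) = cis (2 * pi * real_of_int m * x / T)"
proof -
  have "2 * pi * real_of_int m * (x + real_of_int k * T) / T = 2 * pi * real_of_int m * x / T + 2 * pi * real_of_int (m * k)"
    using assms by (simp add: field_simps)
  then show ?thesis by (simp only: cis_mult[symmetric]) (simp add: complex_eq_iff)
qed

lemma sq_integrable_times_cis:
  assumes "sq_integrable lborel u"
  shows "sq_integrable lborel (\<lambda>x. u x * cnj (cis (t * x)))"
proof -
  have [measurable]: "u \<in> borel_measurable borel" using assms by (simp add: sq_integrable_def)
  have "(\<lambda>x. u x * cnj (cis (t * x))) \<in> borel_measurable borel" by measurable
  then show ?thesis using assms by (simp add: sq_integrable_def norm_mult)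
qed

lemma integrable_compact_support:
  fixes u :: "real \<Rightarrow> complex"
  assumes u: "sq_integrable lborel u" and supp: "\<And>x. x \<notin> {-R..R} \<Longrightarrow> u x = 0"
  shows "integrable lborel u"
proof -
  have i: "sq_integrable lborel (indicator {-R..R} :: real \<Rightarrow> complex)"
    unfolding sq_integrable_def
  proof
    have "(\<lambda>x. (cmod (indicator {-R..R} x))\<^sup>2) = (indicator {-R..R} :: real \<Rightarrow> real)"
      by (auto simp: indicator_def)
    then show "integrable lborel (\<lambda>x. (cmod (indicator {-R..R} x))\<^sup>2)"
      by (simp add: integrable_indicator_iff emeasure_lborel_Icc_eq)
  qed auto
  have "u x * cnj (indicator {-R..R} x) = u x" for x
    using supp[of x] by (cases "x \<in> {-R..R}") auto
  then show ?thesis using integrable_mult_cnj[OF u i] by (simp only:)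
qed

text \<open>Poisson summation in disguise: the Fourier coefficients of the periodization of u are samples
  of the Fourier transform of u, so Parseval's identity for the periodizations unfolds to the line.\<close>

lemma parseval_samples:
  assumes T: "T > 0" and u: "sq_integrable lborel u" and v: "sq_integrable lborel v"
    and supp_u: "\<And>x. x \<notin> {-(real J * T)<..real J * T} \<Longrightarrow> u x = 0"
    and supp_v: "\<And>x. x \<notin> {-(real J * T)<..real J * T} \<Longrightarrow> v x = 0"
  shows "((\<lambda>m. (\<integral>x. u x * cnj (cis (2 * pi * real_of_int m * x / T)) \<partial>lborel)
            * cnj (\<integral>x. v x * cnj (cis (2 * pi * real_of_int m * x / T)) \<partial>lborel))
     has_sum (T * (\<Sum>k\<in>{-int (2 * J)..int (2 * J)}. \<integral>x. u (x + real_of_int k * T) * cnj (v x) \<partial>lborel))) UNIV"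
proof -
  define P where "P u x = (\<Sum>k\<in>{-int J..<int J}. u (x + real_of_int k * T))" for u :: "real \<Rightarrow> complex" and x
  let ?e = "\<lambda>m x. cis (2 * pi * real_of_int m * x / T)"
  have P: "sq_integrable (period_measure T) (P u)" if "sq_integrable lborel u" for u
    unfolding P_def by (intro sq_integrable_sum sq_integrable_period sq_integrable_shift that)
  have four: "(\<integral>x. u x * cnj (?e m x) \<partial>lborel) = (\<integral>x. P u x * cnj (?e m x) \<partial>period_measure T)"
    if u: "sq_integrable lborel u" and s: "\<And>x. x \<notin> {-(real J * T)<..real J * T} \<Longrightarrow> u x = 0" for u m
  proof -
    have ue: "sq_integrable lborel (\<lambda>x. u x * cnj (?e m x))"
      using sq_integrable_times_cis[OF u, of "2 * pi * real_of_int m / T"] by simp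
    have "integrable lborel (\<lambda>x. u x * cnj (?e m x))"
      by (rule integrable_compact_support[OF ue, of "real J * T"]) (auto simp: s)
    then have "(\<integral>x. u x * cnj (?e m x) \<partial>lborel)
       = (\<Sum>k\<in>{-int J..<int J}. \<integral>x. u (x + real_of_int k * T) * cnj (?e m (x + real_of_int k * T)) \<partial>period_measure T)"
      by (intro integral_tile[OF T]) (auto simp: s)
    also have "\<dots> = (\<Sum>k\<in>{-int J..<int J}. \<integral>x. u (x + real_of_int k * T) * cnj (?e m x) \<partial>period_measure T)"
      by (simp only: cis_periodic[OF T])
    also have "\<dots> = (\<integral>x. P u x * cnj (?e m x) \<partial>period_measure T)"
      unfolding P_def sum_distrib_right
      by (intro Bochner_Integration.integral_sum[symmetric] integrable_mult_cnj sq_integrable_cis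
          sq_integrable_period sq_integrable_shift u)
    finally show ?thesis .
  qed
  \<comment> \<open>Twice the range of shifts, so that on every tile meeting the support of
    \<open>v\<close> this finite sum already equals the full periodization of
    \<open>u\<close>.\<close>
  define W where "W x = (\<Sum>k\<in>{-int (2 * J)..int (2 * J)}. u (x + real_of_int k * T))" for x
  have W: "sq_integrable lborel W"
    unfolding W_def by (intro sq_integrable_sum sq_integrable_shift u)
  have WP: "W (x + real_of_int l * T) = P u x" if "x \<in> {0<..T}" "l \<in> {-int J..<int J}" for x l
  proof -
    have "W (x + real_of_int l * T) = (\<Sum>k\<in>{-int (2 * J)..int (2 * J)}. u (x + real_of_int (k + l) * T))"
      unfolding W_def by (simp add: algebra_simps)
    also have "\<dots> = (\<Sum>k\<in>{-int (2 * J) + l..int (2 * J) + l}. u (x + real_of_int k * T))"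
      by (rule sum.reindex_bij_witness[where i = "\<lambda>k. k - l" and j = "\<lambda>k. k + l"]) auto
    also have "\<dots> = P u x"
      unfolding P_def
    proof (rule sum.mono_neutral_right)
      show "\<forall>k\<in>{- int (2 * J) + l..int (2 * J) + l} - {- int J..<int J}. u (x + real_of_int k * T) = 0"
      proof
        fix k assume k: "k \<in> {- int (2 * J) + l..int (2 * J) + l} - {- int J..<int J}"
        then consider "k + 1 \<le> - int J" | "k \<ge> int J" by fastforce
        then show "u (x + real_of_int k * T) = 0"
        proof cases
          case 1
          then have "(real_of_int k + 1) * T \<le> - real J * T" using T by (intro mult_right_mono) linarith+
          then have "x + real_of_int k * T \<le> - (real J * T)" using that(1) by (simp add: distrib_right)
          then show ?thesis by (intro supp_u) auto
        next
          case 2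
          have "0 < x" using that(1) by simp
          moreover from 2 have "real J * T \<le> real_of_int k * T" using T by (intro mult_right_mono) linarith+
          ultimately have "x + real_of_int k * T > real J * T" by linarith
          then show ?thesis by (intro supp_u) auto
        qed
      qed
    qed (use that(2) in auto)
    finally show ?thesis .
  qed
  have "(\<integral>x. P u x * cnj (P v x) \<partial>period_measure T)
      = (\<Sum>l\<in>{-int J..<int J}. \<integral>x. P u x * cnj (v (x + real_of_int l * T)) \<partial>period_measure T)"
    unfolding P_def[of v] cnj_sum sum_distrib_left
    by (intro Bochner_Integration.integral_sum integrable_mult_cnj P u sq_integrable_period sq_integrable_shift v)
  also have "\<dots> = (\<Sum>l\<in>{-int J..<int J}. \<integral>x. W (x + real_of_int l * T) * cnj (v (x + real_of_int l * T)) \<partial>period_measure T)"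
    by (intro sum.cong refl Bochner_Integration.integral_cong) (auto simp: WP space_restrict_space)
  also have "\<dots> = (\<integral>x. W x * cnj (v x) \<partial>lborel)"
    by (intro integral_tile[OF T, symmetric] integrable_mult_cnj W v) (simp add: supp_v)
  also have "\<dots> = (\<Sum>k\<in>{-int (2 * J)..int (2 * J)}. \<integral>x. u (x + real_of_int k * T) * cnj (v x) \<partial>lborel)"
    unfolding W_def sum_distrib_right
    by (intro Bochner_Integration.integral_sum integrable_mult_cnj sq_integrable_shift u v)
  finally have eq: "(\<integral>x. P u x * cnj (P v x) \<partial>period_measure T)
      = (\<Sum>k\<in>{-int (2 * J)..int (2 * J)}. \<integral>x. u (x + real_of_int k * T) * cnj (v x) \<partial>lborel)" .
  have cj: "cnj (\<integral>x. P v x * cnj (?e m x) \<partial>period_measure T) = (\<integral>x. ?e m x * cnj (P v x) \<partial>period_measure T)" for m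
    by (subst Bochner_Integration.integral_cnj[symmetric]) (simp add: mult.commute)
  have fu: "(\<integral>x. u x * cnj (?e m x) \<partial>lborel) = (\<integral>x. P u x * cnj (?e m x) \<partial>period_measure T)" for m
    by (rule four[OF u]) (rule supp_u)
  have fv: "(\<integral>x. v x * cnj (?e m x) \<partial>lborel) = (\<integral>x. P v x * cnj (?e m x) \<partial>period_measure T)" for m
    by (rule four[OF v]) (rule supp_v)
  show ?thesis
    using parseval_period[OF T P[OF u] P[OF v]]
    by (simp only: fu fv eq cj)
qed

section \<open>Row sums and Bessel bounds of Gabor systems\<close>

lemma L2_iff_sq_integrable: "L2 f \<longleftrightarrow> sq_integrable lborel f"
  by (simp add: L2_def sq_integrable_def)

lemma overlap:
  fixes a R x :: real
  assumes "a > 0" "R \<ge> 0"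
  shows "finite {n::int. \<bar>x - real_of_int n * a\<bar> \<le> R}"
    and "real (card {n::int. \<bar>x - real_of_int n * a\<bar> \<le> R}) \<le> 2 * R / a + 1"
proof -
  have eq: "{n::int. \<bar>x - real_of_int n * a\<bar> \<le> R} = {\<lceil>(x - R) / a\<rceil>..\<lfloor>(x + R) / a\<rfloor>}"
    using assms by (auto simp: abs_le_iff ceiling_le_iff le_floor_iff field_simps)
  show "finite {n::int. \<bar>x - real_of_int n * a\<bar> \<le> R}" by (simp add: eq)
  have "real_of_int \<lfloor>(x + R) / a\<rfloor> - real_of_int \<lceil>(x - R) / a\<rceil> + 1 \<le> (x + R) / a - (x - R) / a + 1"
    using of_int_floor_le[of "(x + R) / a"] le_of_int_ceiling[of "(x - R) / a"] by linarith
  also have "\<dots> = 2 * R / a + 1" using assms by (simp add: field_simps)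
  finally have "real_of_int (\<lfloor>(x + R) / a\<rfloor> - \<lceil>(x - R) / a\<rceil> + 1) \<le> 2 * R / a + 1" by simp
  moreover have "2 * R / a + 1 \<ge> 0" using assms by simp
  ultimately show "real (card {n::int. \<bar>x - real_of_int n * a\<bar> \<le> R}) \<le> 2 * R / a + 1"
    unfolding eq card_atLeastAtMost_int by linarith
qed

definition window :: "real \<Rightarrow> real \<Rightarrow> (real \<Rightarrow> complex) \<Rightarrow> bool" where
  "window C R \<phi> \<longleftrightarrow> C \<ge> 0 \<and> R \<ge> 0 \<and> \<phi> \<in> borel_measurable borel \<and> (\<forall>x. cmod (\<phi> x) \<le> C) \<and> (\<forall>x. \<bar>x\<bar> > R \<longrightarrow> \<phi> x = 0)"

lemma L2_times_window:
  assumes f: "L2 f" and \<phi>: "window C R \<phi>"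
  shows "sq_integrable lborel (\<lambda>x. f x * cnj (\<phi> (x - t)))"
proof -
  have [measurable]: "f \<in> borel_measurable borel" "\<phi> \<in> borel_measurable borel"
    using f \<phi> by (auto simp: L2_def window_def)
  have "integrable lborel (\<lambda>x. C\<^sup>2 * (cmod (f x))\<^sup>2)" using f by (simp add: L2_def)
  then have "integrable lborel (\<lambda>x. (cmod (f x * cnj (\<phi> (x - t))))\<^sup>2)"
  proof (rule Bochner_Integration.integrable_bound)
    show "AE x in lborel. norm ((cmod (f x * cnj (\<phi> (x - t))))\<^sup>2) \<le> norm (C\<^sup>2 * (cmod (f x))\<^sup>2)"
      using \<phi> by (intro AE_I2) (auto simp: norm_mult power_mult_distrib window_def mult.commute[of "(cmod (f _))\<^sup>2"]
          intro!: mult_right_mono power_mono)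
  qed measurable
  moreover have "(\<lambda>x. f x * cnj (\<phi> (x - t))) \<in> borel_measurable borel" by measurable
  ultimately show ?thesis by (simp add: sq_integrable_def)
qed

lemma L2_inner_gabor:
  assumes "b > 0"
  shows "L2_inner f (gabor a b \<phi> (m, n))
    = (\<integral>x. f x * cnj (\<phi> (x - real_of_int n * a)) * cnj (cis (2 * pi * real_of_int m * x / (1 / b))) \<partial>lborel)"
proof -
  have "exp (2 * pi * \<i> * complex_of_real (real_of_int m * b * x)) = cis (2 * pi * real_of_int m * x / (1 / b))" for x
    by (simp add: cis_conv_exp mult_ac)
  then show ?thesis
    unfolding L2_inner_def gabor_def modul_def transl_def by (simp add: mult_ac)
qed

lemma L2_inner_commute: "L2_inner f h = cnj (L2_inner h f)"
  unfolding L2_inner_def by (subst Bochner_Integration.integral_cnj[symmetric]) (simp add: mult.commute)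

lemma L2_inner_self: "L2_inner f f = complex_of_real (L2_normsq f)"
  unfolding L2_inner_def L2_normsq_def integral_complex_of_real[symmetric]
  by (simp only: complex_norm_square)

text \<open>For fixed \<open>n\<close> the coefficients in m are Fourier samples of \<open>f\<close>
  times a translated window, so \<open>parseval_samples\<close> applies with period 1/b. A shift k/b
  longer than 2*R moves one translated window off the other; hence finitely many k suffice, with
  \<open>K\<close> the same for all \<open>n\<close>, and this uniformity later allows summation
  over n inside the integrals.\<close>

lemma gabor_row_has_sum:
  assumes b: "b > 0" and f: "L2 f" and f': "L2 f'" and \<psi>: "window C R \<psi>" and \<phi>: "window C' R \<phi>"
    and K: "2 * R \<le> real K / b"
  shows "((\<lambda>m. L2_inner f (gabor a b \<psi> (m, n)) * L2_inner (gabor a b \<phi> (m, n)) f') has_sum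
     (complex_of_real (1 / b) * (\<Sum>k\<in>{-int K..int K}. \<integral>x. f (x + real_of_int k / b) * cnj (\<psi> (x + real_of_int k / b - real_of_int n * a))
         * cnj (f' x * cnj (\<phi> (x - real_of_int n * a))) \<partial>lborel))) UNIV"
proof -
  define u where "u x = f x * cnj (\<psi> (x - real_of_int n * a))" for x
  define v where "v x = f' x * cnj (\<phi> (x - real_of_int n * a))" for x
  have uv: "sq_integrable lborel u" "sq_integrable lborel v"
    unfolding u_def v_def using L2_times_window f f' \<psi> \<phi> by blast+
  have s: "u x = 0" "v x = 0" if "\<bar>x - real_of_int n * a\<bar> > R" for x
    using that \<psi> \<phi> by (auto simp: u_def v_def window_def)
  \<comment> \<open>\<open>J0\<close> depends on \<open>n\<close>, because the translated windows
    move away; the surplus shifts are discarded in favour of \<open>K\<close> below. Adding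
    \<open>K\<close> to \<open>J0\<close> keeps the range up to \<open>K\<close> inside the range up
    to 2*J.\<close>
  obtain J0 :: nat where J0: "(R + \<bar>real_of_int n * a\<bar>) * b < real J0" using reals_Archimedean2 by blast
  define J where "J = J0 + K"
  have J: "R + \<bar>real_of_int n * a\<bar> < real J * (1 / b)"
    using J0 b by (simp add: J_def field_simps)
  have out: "\<bar>x - real_of_int n * a\<bar> > R" if "x \<notin> {-(real J * (1 / b))<..real J * (1 / b)}" for x
    using that J by (auto simp del: times_divide_eq_right)
  have T: "1 / b > 0" using b by simp
  note * = parseval_samples[where J = J, OF T uv s(1)[OF out] s(2)[OF out]]
  have e1: "(\<Sum>k\<in>{-int (2 * J)..int (2 * J)}. \<integral>x. u (x + real_of_int k * (1 / b)) * cnj (v x) \<partial>lborel)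
     = (\<Sum>k\<in>{-int K..int K}. \<integral>x. u (x + real_of_int k * (1 / b)) * cnj (v x) \<partial>lborel)"
  proof (rule sum.mono_neutral_right)
    show "\<forall>k\<in>{-int (2 * J)..int (2 * J)} - {-int K..int K}. (\<integral>x. u (x + real_of_int k * (1 / b)) * cnj (v x) \<partial>lborel) = 0"
    proof
      fix k assume "k \<in> {-int (2 * J)..int (2 * J)} - {-int K..int K}"
      then have "real K < \<bar>real_of_int k\<bar>" by auto
      then have "real K / b < \<bar>real_of_int k / b\<bar>" using b by (simp add: divide_strict_right_mono)
      then have big: "2 * R < \<bar>real_of_int k / b\<bar>" using K by linarith
      have "u (x + real_of_int k * (1 / b)) * cnj (v x) = 0" for x
      proof (cases "\<bar>x - real_of_int n * a\<bar> > R")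
        case False
        then have "\<bar>x + real_of_int k * (1 / b) - real_of_int n * a\<bar> > R" using big by auto
        then show ?thesis using s by simp
      qed (simp add: s)
      then show "(\<integral>x. u (x + real_of_int k * (1 / b)) * cnj (v x) \<partial>lborel) = 0"
        by (simp only: Bochner_Integration.integral_zero)
    qed
  qed (auto simp: J_def)
  have e2: "L2_inner (gabor a b \<phi> (m, n)) f' = cnj (\<integral>x. v x * cnj (cis (2 * pi * real_of_int m * x / (1 / b))) \<partial>lborel)" for m
    unfolding v_def L2_inner_gabor[OF b, symmetric] by (rule L2_inner_commute)
  have e3: "L2_inner f (gabor a b \<psi> (m, n)) = (\<integral>x. u x * cnj (cis (2 * pi * real_of_int m * x / (1 / b))) \<partial>lborel)" for m
    unfolding u_def by (rule L2_inner_gabor[OF b])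
  show ?thesis using *[unfolded e1] unfolding e2 e3 by (simp add: u_def v_def)
qed

lemma gabor_row_sq_has_sum:
  assumes b: "b > 0" and f: "L2 f" and \<phi>: "window C R \<phi>" and K: "2 * R \<le> real K / b"
  shows "((\<lambda>m. (cmod (L2_inner f (gabor a b \<phi> (m, n))))\<^sup>2) has_sum
     Re (complex_of_real (1 / b) * (\<Sum>k\<in>{-int K..int K}. \<integral>x. f (x + real_of_int k / b) * cnj (\<phi> (x + real_of_int k / b - real_of_int n * a))
         * cnj (f x * cnj (\<phi> (x - real_of_int n * a))) \<partial>lborel))) UNIV"
proof -
  have "L2_inner f (gabor a b \<phi> (m, n)) * L2_inner (gabor a b \<phi> (m, n)) f
      = complex_of_real ((cmod (L2_inner f (gabor a b \<phi> (m, n))))\<^sup>2)" for m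
    unfolding L2_inner_commute[of "gabor a b \<phi> (m, n)"] by (simp only: complex_norm_square)
  then show ?thesis using has_sum_Re[OF gabor_row_has_sum[OF b f f \<phi> \<phi> K, of a n]] by (simp only: Re_complex_of_real)
qed

text \<open>A row is at most (2K+1)/b times the squared norm of \<open>f\<close> multiplied by the
  n-th translated window, and at each point at most 2R/a + 1 translates are nonzero. Summing the
  rows therefore costs only a constant.\<close>

lemma gabor_bessel_finite:
  assumes a: "a > 0" and b: "b > 0" and \<phi>: "window C R \<phi>"
  obtains B where "B > 0" "\<And>f F. L2 f \<Longrightarrow> finite F \<Longrightarrow> (\<Sum>k\<in>F. (cmod (L2_inner f (gabor a b \<phi> k)))\<^sup>2) \<le> B * L2_normsq f"
proof -
  obtain K :: nat where "2 * R * b < real K" using reals_Archimedean2 by blast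
  then have K: "2 * R \<le> real K / b" using b by (simp add: field_simps)
  have C: "C \<ge> 0" "R \<ge> 0" using \<phi> by (auto simp: window_def)
  define B0 where "B0 = 1 / b * ((2 * real K + 1) * (C\<^sup>2 * (2 * R / a + 1)))"
  have B0: "B0 \<ge> 0" using a b C by (simp add: B0_def)
  have main: "(\<Sum>k\<in>F. (cmod (L2_inner f (gabor a b \<phi> k)))\<^sup>2) \<le> B0 * L2_normsq f" if f: "L2 f" and F: "finite F" for f F
  proof -
    define u where "u n x = f x * cnj (\<phi> (x - real_of_int n * a))" for n x
    have u: "sq_integrable lborel (u n)" for n unfolding u_def using L2_times_window[OF f \<phi>] by blast
    have row: "(\<Sum>m\<in>S. (cmod (L2_inner f (gabor a b \<phi> (m, n))))\<^sup>2) \<le> 1 / b * ((2 * real K + 1) * (\<integral>x. (cmod (u n x))\<^sup>2 \<partial>lborel))"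
      if "finite S" for S n
    proof -
      have "(\<Sum>m\<in>S. (cmod (L2_inner f (gabor a b \<phi> (m, n))))\<^sup>2)
         \<le> Re (complex_of_real (1 / b) * (\<Sum>k\<in>{-int K..int K}. \<integral>x. u n (x + real_of_int k / b) * cnj (u n x) \<partial>lborel))"
        unfolding u_def
        by (rule finite_sum_le_has_sum[OF gabor_row_sq_has_sum[OF b f \<phi> K] that]) auto
      also have "\<dots> \<le> cmod (complex_of_real (1 / b) * (\<Sum>k\<in>{-int K..int K}. \<integral>x. u n (x + real_of_int k / b) * cnj (u n x) \<partial>lborel))"
        by (rule complex_Re_le_cmod)
      also have "\<dots> = 1 / b * cmod (\<Sum>k\<in>{-int K..int K}. \<integral>x. u n (x + real_of_int k / b) * cnj (u n x) \<partial>lborel)"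
        using b by (simp add: norm_mult norm_divide)
      also have "\<dots> \<le> 1 / b * (\<Sum>k\<in>{-int K..int K}. \<integral>x. (cmod (u n x))\<^sup>2 \<partial>lborel)"
      proof (intro mult_left_mono order_trans[OF norm_sum] sum_mono)
        fix k
        show "cmod (\<integral>x. u n (x + real_of_int k / b) * cnj (u n x) \<partial>lborel) \<le> (\<integral>x. (cmod (u n x))\<^sup>2 \<partial>lborel)"
          using integral_mult_cnj_le[OF sq_integrable_shift[OF u] u zero_less_one, of n "real_of_int k / b" n]
            integral_shift[of "\<lambda>x. (cmod (u n x))\<^sup>2" "real_of_int k / b"] by simp
      qed (use b in auto)
      also have "\<dots> = 1 / b * ((2 * real K + 1) * (\<integral>x. (cmod (u n x))\<^sup>2 \<partial>lborel))"
        by (simp add: nat_add_distrib)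
      finally show ?thesis .
    qed
    \<comment> \<open>Enlarging \<open>F\<close> to the product of its projections lets the sum be
      taken row by row.\<close>
    have "(\<Sum>k\<in>F. (cmod (L2_inner f (gabor a b \<phi> k)))\<^sup>2) \<le> (\<Sum>k\<in>fst ` F \<times> snd ` F. (cmod (L2_inner f (gabor a b \<phi> k)))\<^sup>2)"
      using F by (intro sum_mono2) (auto simp: rev_image_eqI)
    also have "\<dots> = (\<Sum>n\<in>snd ` F. \<Sum>m\<in>fst ` F. (cmod (L2_inner f (gabor a b \<phi> (m, n))))\<^sup>2)"
      by (subst sum.swap) (simp add: sum.cartesian_product)
    also have "\<dots> \<le> (\<Sum>n\<in>snd ` F. 1 / b * ((2 * real K + 1) * (\<integral>x. (cmod (u n x))\<^sup>2 \<partial>lborel)))"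
      using F by (intro sum_mono row) auto
    also have "\<dots> = 1 / b * ((2 * real K + 1) * (\<integral>x. (\<Sum>n\<in>snd ` F. (cmod (u n x))\<^sup>2) \<partial>lborel))"
      by (subst Bochner_Integration.integral_sum) (simp_all add: sum_distrib_left sq_integrable_norm_sq[OF u])
    also have "(\<integral>x. (\<Sum>n\<in>snd ` F. (cmod (u n x))\<^sup>2) \<partial>lborel) \<le> (\<integral>x. (C\<^sup>2 * (2 * R / a + 1)) * (cmod (f x))\<^sup>2 \<partial>lborel)"
    proof (rule integral_mono)
      show "integrable lborel (\<lambda>x. \<Sum>n\<in>snd ` F. (cmod (u n x))\<^sup>2)"
        by (intro Bochner_Integration.integrable_sum sq_integrable_norm_sq u)
      show "integrable lborel (\<lambda>x. (C\<^sup>2 * (2 * R / a + 1)) * (cmod (f x))\<^sup>2)"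
        using f by (auto simp: L2_def)
      fix x
      have "(\<Sum>n\<in>snd ` F. (cmod (u n x))\<^sup>2) = (\<Sum>n\<in>snd ` F \<inter> {n. \<bar>x - real_of_int n * a\<bar> \<le> R}. (cmod (u n x))\<^sup>2)"
        using F \<phi> by (intro sum.mono_neutral_right) (auto simp: u_def window_def, meson not_le)
      also have "\<dots> \<le> (\<Sum>n\<in>{n. \<bar>x - real_of_int n * a\<bar> \<le> R}. (cmod (u n x))\<^sup>2)"
        using overlap(1)[OF a C(2)] by (intro sum_mono2) auto
      also have "\<dots> \<le> (\<Sum>n\<in>{n. \<bar>x - real_of_int n * a\<bar> \<le> R}. C\<^sup>2 * (cmod (f x))\<^sup>2)"
        using \<phi> by (intro sum_mono) (auto simp: u_def norm_mult power_mult_distrib window_def mult.commute[of "(cmod (f _))\<^sup>2"]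
            intro!: mult_right_mono power_mono)
      also have "\<dots> = real (card {n. \<bar>x - real_of_int n * a\<bar> \<le> R}) * (C\<^sup>2 * (cmod (f x))\<^sup>2)" by simp
      also have "\<dots> \<le> (2 * R / a + 1) * (C\<^sup>2 * (cmod (f x))\<^sup>2)"
        by (intro mult_right_mono overlap(2) a C) auto
      finally show "(\<Sum>n\<in>snd ` F. (cmod (u n x))\<^sup>2) \<le> (C\<^sup>2 * (2 * R / a + 1)) * (cmod (f x))\<^sup>2"
        by (simp only: mult_ac)
    qed
    also have "\<dots> = (C\<^sup>2 * (2 * R / a + 1)) * L2_normsq f" by (simp add: L2_normsq_def)
    finally show ?thesis
      using b by (simp add: B0_def mult_left_mono divide_right_mono mult.assoc)
  qed
  have "0 \<le> L2_normsq f" for f by (simp add: L2_normsq_def)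
  then have "B0 * L2_normsq f \<le> (B0 + 1) * L2_normsq f" for f by (intro mult_right_mono) auto
  \<comment> \<open>\<open>B0\<close> may be zero; adding 1 provides the strict positivity.\<close>
  then show ?thesis using main B0 by (intro that[of "B0 + 1"]) (auto intro: order_trans)
qed

lemma gabor_bessel:
  assumes a: "a > 0" and b: "b > 0" and \<phi>: "window C R \<phi>"
  obtains B where "B > 0" "\<And>f. L2 f \<Longrightarrow> (\<lambda>k. (cmod (L2_inner f (gabor a b \<phi> k)))\<^sup>2) summable_on UNIV"
    "\<And>f. L2 f \<Longrightarrow> (\<Sum>\<^sub>\<infinity>k. (cmod (L2_inner f (gabor a b \<phi> k)))\<^sup>2) \<le> B * L2_normsq f"
proof -
  obtain B where B: "B > 0" "\<And>f F. L2 f \<Longrightarrow> finite F \<Longrightarrow> (\<Sum>k\<in>F. (cmod (L2_inner f (gabor a b \<phi> k)))\<^sup>2) \<le> B * L2_normsq f"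
    using gabor_bessel_finite[OF assms] by blast
  have s: "(\<lambda>k. (cmod (L2_inner f (gabor a b \<phi> k)))\<^sup>2) summable_on UNIV" if "L2 f" for f
    by (rule nonneg_bdd_above_summable_on) (auto intro!: bdd_aboveI[of _ "B * L2_normsq f"] B that)
  show ?thesis
    by (rule that[OF B(1) s]) (auto intro!: infsum_le_finite_sums s B)
qed


section \<open>Dual windows and frame bounds\<close>

lemma symmetric_int_intervals_cofinal:
  "filterlim (\<lambda>N::nat. {-int N..int N}) (finite_subsets_at_top UNIV) sequentially"
  unfolding filterlim_finite_subsets_at_top
proof (intro allI impI)
  fix X :: "int set" assume "finite X \<and> X \<subseteq> UNIV"
  then have X: "finite (abs ` X)" by simp
  define N0 where "N0 = nat (Max (insert 0 (abs ` X)))"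
  have "X \<subseteq> {-int N..int N}" if "N \<ge> N0" for N
  proof
    fix x assume "x \<in> X"
    then have "\<bar>x\<bar> \<le> Max (insert 0 (abs ` X))" using X by (intro Max_ge) auto
    then show "x \<in> {-int N..int N}" using that unfolding N0_def by (auto simp: abs_le_iff)
  qed
  then show "\<forall>\<^sub>F N in sequentially. finite {-int N..int N} \<and> X \<subseteq> {-int N..int N} \<and> {-int N..int N} \<subseteq> UNIV"
    by (auto simp: eventually_sequentially)
qed

text \<open>Absolute summability, from the two Bessel bounds, permits summing along rows first. Each
  row is a sum of integrals over finitely many shifts k; with the sum over n moved inside, the
  duality relation removes all k except 0 and leaves a factor \<open>b\<close> that cancels
  1/b.\<close>

lemma gabor_expansion:
  assumes a: "a > 0" and b: "b > 0" and g: "window Cg R g" and h: "window Ch R h"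
    and dual: "\<And>x k::int. (\<Sum>n | \<bar>x - real_of_int n * a\<bar> \<le> R. cnj (h (x + real_of_int k / b - real_of_int n * a)) * g (x - real_of_int n * a))
        = (if k = 0 then of_real b else 0)"
    and f: "L2 f" and f': "L2 f'"
  shows "((\<lambda>k. L2_inner f (gabor a b h k) * L2_inner (gabor a b g k) f') has_sum L2_inner f f') UNIV"
proof -
  define c where "c k = L2_inner f (gabor a b h k) * L2_inner (gabor a b g k) f'" for k
  have C: "Cg \<ge> 0" "Ch \<ge> 0" "R \<ge> 0" using g h by (auto simp: window_def)
  obtain K :: nat where "2 * R * b < real K" using reals_Archimedean2 by blast
  then have K: "2 * R \<le> real K / b" using b by (simp add: field_simps)
  have "(\<lambda>k. norm (c k)) summable_on UNIV"
  proof (rule Infinite_Sum.abs_summable_on_comparison_test)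
    have "(\<lambda>k. (cmod (L2_inner f (gabor a b h k)))\<^sup>2) summable_on UNIV" "(\<lambda>k. (cmod (L2_inner f' (gabor a b g k)))\<^sup>2) summable_on UNIV"
      using gabor_bessel[OF a b h] gabor_bessel[OF a b g] f f' by metis+
    then have "(\<lambda>k. 1 / 2 * (cmod (L2_inner f (gabor a b h k)))\<^sup>2 + 1 / (2 * 1) * (cmod (L2_inner f' (gabor a b g k)))\<^sup>2) summable_on UNIV"
      by (intro summable_on_add summable_on_cmult_right)
    then show "(\<lambda>k. norm (1 / 2 * (cmod (L2_inner f (gabor a b h k)))\<^sup>2 + 1 / (2 * 1) * (cmod (L2_inner f' (gabor a b g k)))\<^sup>2)) summable_on UNIV"
      by (simp only: summable_on_iff_abs_summable_on_real[symmetric])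
    fix k
    have "cmod (c k) \<le> 1 / 2 * (cmod (L2_inner f (gabor a b h k)))\<^sup>2 + 1 / (2 * 1) * (cmod (L2_inner f' (gabor a b g k)))\<^sup>2"
      unfolding c_def L2_inner_commute[of "gabor a b g k"] by (rule norm_mult_cnj_le) simp
    then show "norm (c k) \<le> norm (1 / 2 * (cmod (L2_inner f (gabor a b h k)))\<^sup>2 + 1 / (2 * 1) * (cmod (L2_inner f' (gabor a b g k)))\<^sup>2)"
      by simp
  qed
  then have "c summable_on UNIV" by (rule abs_summable_summable)
  then obtain S where S: "(c has_sum S) UNIV" by (auto simp: summable_on_def)
  \<comment> \<open>Rows run over the first index, while the iterated sum has its outer index first;
    hence the swap.\<close>
  moreover have "range prod.swap = (UNIV :: (int \<times> int) set)" by (metis surj_def swap_swap)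
  ultimately have "(c \<circ> prod.swap has_sum S) UNIV"
    using has_sum_reindex[of prod.swap UNIV c S] by (simp only: inj_swap)
  then have S': "((\<lambda>p. c (snd p, fst p)) has_sum S) (UNIV \<times> UNIV)"
    by (simp add: o_def prod.swap_def)
  define I where "I k n = (\<integral>x. f (x + real_of_int k / b) * cnj (h (x + real_of_int k / b - real_of_int n * a))
         * cnj (f' x * cnj (g (x - real_of_int n * a))) \<partial>lborel)" for k n
  define z where "z n = complex_of_real (1 / b) * (\<Sum>k\<in>{-int K..int K}. I k n)" for n
  have "((\<lambda>m. c (m, n)) has_sum z n) UNIV" for n
    unfolding c_def z_def I_def by (rule gabor_row_has_sum[OF b f f' h g K])
  then have "(z has_sum S) UNIV"
    using has_sum_SigmaD[OF S', of z] by simp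
  \<comment> \<open>Dominated convergence works along sequences, so the unconditional sum is read
    off along symmetric intervals.\<close>
  then have lim1: "(\<lambda>N. \<Sum>n\<in>{-int N..int N}. z n) \<longlonglongrightarrow> S"
    unfolding has_sum_def by (rule filterlim_compose[OF _ symmetric_int_intervals_cofinal])
  define s where "s N k x = (\<Sum>n\<in>{-int N..int N}. cnj (h (x + real_of_int k / b - real_of_int n * a)) * g (x - real_of_int n * a))"
    for N k x
  have s_eq: "\<forall>\<^sub>F N in sequentially. s N k x = (if k = 0 then of_real b else 0)" for k x
  proof -
    have "\<forall>\<^sub>F N in sequentially. {n. \<bar>x - real_of_int n * a\<bar> \<le> R} \<subseteq> {-int N..int N}"
      using symmetric_int_intervals_cofinal overlap(1)[OF a C(3), of x]
      unfolding filterlim_finite_subsets_at_top by (auto elim!: eventually_mono)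
    then show ?thesis
    proof eventually_elim
      case (elim N)
      have "s N k x = (\<Sum>n | \<bar>x - real_of_int n * a\<bar> \<le> R. cnj (h (x + real_of_int k / b - real_of_int n * a)) * g (x - real_of_int n * a))"
        unfolding s_def using elim g by (intro sum.mono_neutral_right) (auto simp: window_def)
      then show ?case by (simp add: dual)
    qed
  qed
  have s_bound: "cmod (s N k x) \<le> (2 * R / a + 1) * (Ch * Cg)" for N k x
  proof -
    have "s N k x = (\<Sum>n\<in>{-int N..int N} \<inter> {n. \<bar>x - real_of_int n * a\<bar> \<le> R}. cnj (h (x + real_of_int k / b - real_of_int n * a)) * g (x - real_of_int n * a))"
      unfolding s_def using g by (intro sum.mono_neutral_right) (auto simp: window_def, meson not_le)
    also have "cmod \<dots> \<le> (\<Sum>n\<in>{-int N..int N} \<inter> {n. \<bar>x - real_of_int n * a\<bar> \<le> R}. Ch * Cg)"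
      using g h C by (intro order_trans[OF norm_sum] sum_mono) (auto simp: window_def norm_mult intro!: mult_mono)
    also have "\<dots> \<le> (\<Sum>n\<in>{n. \<bar>x - real_of_int n * a\<bar> \<le> R}. Ch * Cg)"
      using C overlap(1)[OF a C(3)] by (intro sum_mono2) auto
    also have "\<dots> = real (card {n. \<bar>x - real_of_int n * a\<bar> \<le> R}) * (Ch * Cg)" by simp
    also have "\<dots> \<le> (2 * R / a + 1) * (Ch * Cg)"
      using C by (intro mult_right_mono overlap(2) a) auto
    finally show ?thesis .
  qed
  have [measurable]: "f \<in> borel_measurable borel" "f' \<in> borel_measurable borel" "g \<in> borel_measurable borel" "h \<in> borel_measurable borel"
    using f f' g h by (auto simp: L2_def window_def)
  have ff': "integrable lborel (\<lambda>x. f (x + real_of_int k / b) * cnj (f' x))" for k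
    using f f' by (intro integrable_mult_cnj sq_integrable_shift) (auto simp: L2_iff_sq_integrable)
  have Is: "(\<Sum>n\<in>{-int N..int N}. I k n) = (\<integral>x. f (x + real_of_int k / b) * cnj (f' x) * s N k x \<partial>lborel)" for N k
  proof -
    have "(\<Sum>n\<in>{-int N..int N}. I k n) = (\<integral>x. (\<Sum>n\<in>{-int N..int N}. f (x + real_of_int k / b) * cnj (h (x + real_of_int k / b - real_of_int n * a))
         * cnj (f' x * cnj (g (x - real_of_int n * a)))) \<partial>lborel)"
      unfolding I_def
      using sq_integrable_shift[OF L2_times_window[OF f h], of "real_of_int k / b"] L2_times_window[OF f' g]
      by (intro Bochner_Integration.integral_sum[symmetric] integrable_mult_cnj)
    also have "\<dots> = (\<integral>x. f (x + real_of_int k / b) * cnj (f' x) * s N k x \<partial>lborel)"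
      unfolding s_def sum_distrib_left by (intro Bochner_Integration.integral_cong sum.cong refl) (simp add: mult_ac)
    finally show ?thesis .
  qed
  have lim_I: "(\<lambda>N. \<Sum>n\<in>{-int N..int N}. I k n) \<longlonglongrightarrow> (if k = 0 then of_real b * L2_inner f f' else 0)" for k
  proof -
    have "(\<lambda>N. \<integral>x. f (x + real_of_int k / b) * cnj (f' x) * s N k x \<partial>lborel)
       \<longlonglongrightarrow> (\<integral>x. f (x + real_of_int k / b) * cnj (f' x) * (if k = 0 then of_real b else 0) \<partial>lborel)"
    proof (rule integral_dominated_convergence[where w = "\<lambda>x. cmod (f (x + real_of_int k / b) * cnj (f' x)) * ((2 * R / a + 1) * (Ch * Cg))"])
      show "integrable lborel (\<lambda>x. cmod (f (x + real_of_int k / b) * cnj (f' x)) * ((2 * R / a + 1) * (Ch * Cg)))"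
        by (intro integrable_mult_left integrable_norm ff')
      show "AE x in lborel. (\<lambda>N. f (x + real_of_int k / b) * cnj (f' x) * s N k x)
          \<longlonglongrightarrow> f (x + real_of_int k / b) * cnj (f' x) * (if k = 0 then of_real b else 0)"
        by (intro AE_I2 tendsto_intros tendsto_eventually s_eq)
      show "AE x in lborel. norm (f (x + real_of_int k / b) * cnj (f' x) * s N k x)
          \<le> cmod (f (x + real_of_int k / b) * cnj (f' x)) * ((2 * R / a + 1) * (Ch * Cg))" for N
        unfolding norm_mult[of "_ * _" "s N k _"] by (intro AE_I2 mult_left_mono s_bound) auto
      show "(\<lambda>x. f (x + real_of_int k / b) * cnj (f' x) * s N k x) \<in> borel_measurable lborel" for N
        unfolding s_def by measurable
    qed measurable
    moreover have "(\<integral>x. f (x + real_of_int k / b) * cnj (f' x) * (if k = 0 then of_real b else 0) \<partial>lborel)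
        = (if k = 0 then of_real b * L2_inner f f' else 0)"
      by (simp add: L2_inner_def)
    ultimately show ?thesis by (simp only: Is)
  qed
  have "(\<lambda>N. complex_of_real (1 / b) * (\<Sum>k\<in>{-int K..int K}. \<Sum>n\<in>{-int N..int N}. I k n))
      \<longlonglongrightarrow> complex_of_real (1 / b) * (\<Sum>k\<in>{-int K..int K}. if k = 0 then of_real b * L2_inner f f' else 0)"
    by (intro tendsto_mult tendsto_const tendsto_sum lim_I)
  moreover have "complex_of_real (1 / b) * (\<Sum>k\<in>{-int K..int K}. if k = 0 then of_real b * L2_inner f f' else 0) = L2_inner f f'"
    using b by (simp add: sum.delta)
  moreover have "complex_of_real (1 / b) * (\<Sum>k\<in>{-int K..int K}. \<Sum>n\<in>{-int N..int N}. I k n) = (\<Sum>n\<in>{-int N..int N}. z n)" for N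
    unfolding z_def sum_distrib_left by (rule sum.swap)
  ultimately have "(\<lambda>N. \<Sum>n\<in>{-int N..int N}. z n) \<longlonglongrightarrow> L2_inner f f'" by simp
  with lim1 have "S = L2_inner f f'" using LIMSEQ_unique by blast
  then show ?thesis using S by (simp add: c_def[abs_def])
qed

text \<open>The expansion writes the squared norm as a sum of products of coefficients. The weight
  1/B in the mean inequality makes the part coming from \<psi> at most half the squared norm, which
  is absorbed on the left.\<close>

lemma frame_lower_bound:
  assumes exp: "((\<lambda>k. L2_inner f (\<psi> k) * L2_inner (\<phi> k) f) has_sum L2_inner f f) UNIV"
    and s\<psi>: "(\<lambda>k. (cmod (L2_inner f (\<psi> k)))\<^sup>2) summable_on UNIV"
    and s\<phi>: "(\<lambda>k. (cmod (L2_inner f (\<phi> k)))\<^sup>2) summable_on UNIV"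
    and B: "B > 0" "(\<Sum>\<^sub>\<infinity>k. (cmod (L2_inner f (\<psi> k)))\<^sup>2) \<le> B * L2_normsq f"
  shows "1 / B * L2_normsq f \<le> (\<Sum>\<^sub>\<infinity>k. (cmod (L2_inner f (\<phi> k)))\<^sup>2)"
proof -
  define P where "P = (\<Sum>\<^sub>\<infinity>k. (cmod (L2_inner f (\<psi> k)))\<^sup>2)"
  define Q where "Q = (\<Sum>\<^sub>\<infinity>k. (cmod (L2_inner f (\<phi> k)))\<^sup>2)"
  have 1: "((\<lambda>k. 1 / B / 2 * (cmod (L2_inner f (\<psi> k)))\<^sup>2 + 1 / (2 * (1 / B)) * (cmod (L2_inner f (\<phi> k)))\<^sup>2) has_sum
     (1 / B / 2 * P + 1 / (2 * (1 / B)) * Q)) UNIV"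
    unfolding P_def Q_def by (intro has_sum_add has_sum_cmult_right has_sum_infsum s\<psi> s\<phi>)
  have "Re (L2_inner f f) \<le> 1 / B / 2 * P + 1 / (2 * (1 / B)) * Q"
  proof (rule has_sum_mono[OF has_sum_Re[OF exp] 1])
    fix k
    have "Re (L2_inner f (\<psi> k) * L2_inner (\<phi> k) f) \<le> cmod (L2_inner f (\<psi> k) * cnj (L2_inner f (\<phi> k)))"
      unfolding L2_inner_commute[of "\<phi> k"] by (rule complex_Re_le_cmod)
    also have "\<dots> \<le> 1 / B / 2 * (cmod (L2_inner f (\<psi> k)))\<^sup>2 + 1 / (2 * (1 / B)) * (cmod (L2_inner f (\<phi> k)))\<^sup>2"
      using B by (intro norm_mult_cnj_le) auto
    finally show "Re (L2_inner f (\<psi> k) * L2_inner (\<phi> k) f)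
      \<le> 1 / B / 2 * (cmod (L2_inner f (\<psi> k)))\<^sup>2 + 1 / (2 * (1 / B)) * (cmod (L2_inner f (\<phi> k)))\<^sup>2" .
  qed
  then have "L2_normsq f \<le> 1 / B / 2 * P + B / 2 * Q" by (simp add: L2_inner_self)
  moreover have "1 / B / 2 * P \<le> 1 / B / 2 * (B * L2_normsq f)"
    using B unfolding P_def by (intro mult_left_mono) auto
  ultimately have "L2_normsq f \<le> B * Q" using B by simp
  then show ?thesis using B by (simp add: Q_def field_simps)
qed

lemma L2_gabor:
  assumes \<phi>: "window C R \<phi>" and b: "b > 0"
  shows "L2 (gabor a b \<phi> k)"
proof -
  obtain m n where k: "k = (m, n)" by (cases k)
  have [measurable]: "\<phi> \<in> borel_measurable borel" using \<phi> by (simp add: window_def)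
  have L: "L2 (indicator {real_of_int n * a - R..real_of_int n * a + R})"
    unfolding L2_def
  proof
    have "(\<lambda>x. (cmod (indicator {real_of_int n * a - R..real_of_int n * a + R} x))\<^sup>2) = (indicator {real_of_int n * a - R..real_of_int n * a + R} :: real \<Rightarrow> real)"
      by (auto simp: indicator_def)
    then show "integrable lborel (\<lambda>x. (cmod (indicator {real_of_int n * a - R..real_of_int n * a + R} x))\<^sup>2)"
      by (simp add: integrable_indicator_iff emeasure_lborel_Icc_eq)
  qed auto
  have "cmod (gabor a b \<phi> k x) = cmod (indicator {real_of_int n * a - R..real_of_int n * a + R} x * cnj (\<phi> (x - real_of_int n * a)))" for x
    using \<phi> by (auto simp: k gabor_def modul_def transl_def norm_mult indicator_def window_def)
  moreover have "gabor a b \<phi> k \<in> borel_measurable lborel"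
    unfolding k gabor_def modul_def transl_def by simp
  ultimately show ?thesis
    using L2_times_window[OF L \<phi>, of "real_of_int n * a"] by (simp add: L2_def sq_integrable_def)
qed

theorem gabor_dual_frames:
  assumes a: "a > 0" and b: "b > 0" and g: "window Cg R g" and h: "window Ch R h"
    and dual: "\<And>x k::int. (\<Sum>n | \<bar>x - real_of_int n * a\<bar> \<le> R. cnj (h (x + real_of_int k / b - real_of_int n * a)) * g (x - real_of_int n * a))
        = (if k = 0 then of_real b else 0)"
  shows "dual_frames_L2 (gabor a b g) (gabor a b h)"
proof -
  have exp: "((\<lambda>k. L2_inner f (gabor a b h k) * L2_inner (gabor a b g k) f') has_sum L2_inner f f') UNIV" if "L2 f" "L2 f'" for f f'
    using gabor_expansion[OF a b g h dual that] .
  \<comment> \<open>Conjugating the expansion exchanges the two systems, so the lower-bound argument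
    also covers \<open>h\<close>.\<close>
  have exp': "((\<lambda>k. L2_inner f (gabor a b g k) * L2_inner (gabor a b h k) f) has_sum L2_inner f f) UNIV" if "L2 f" for f
  proof -
    have "((\<lambda>k. cnj (L2_inner f (gabor a b h k) * L2_inner (gabor a b g k) f)) has_sum cnj (L2_inner f f)) UNIV"
      using exp[OF that that] by (simp only: has_sum_cnj_iff)
    moreover have "cnj (L2_inner f (gabor a b h k) * L2_inner (gabor a b g k) f) = L2_inner f (gabor a b g k) * L2_inner (gabor a b h k) f" for k
      using L2_inner_commute[of f "gabor a b g k"] L2_inner_commute[of "gabor a b h k" f] by (simp add: mult.commute)
    moreover have "cnj (L2_inner f f) = L2_inner f f" using L2_inner_commute[of f f] by simp
    ultimately show ?thesis by simp
  qed
  obtain B where B: "B > 0" "\<And>f. L2 f \<Longrightarrow> (\<lambda>k. (cmod (L2_inner f (gabor a b g k)))\<^sup>2) summable_on UNIV"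
    "\<And>f. L2 f \<Longrightarrow> (\<Sum>\<^sub>\<infinity>k. (cmod (L2_inner f (gabor a b g k)))\<^sup>2) \<le> B * L2_normsq f"
    using gabor_bessel[OF a b g] by blast
  obtain B' where B': "B' > 0" "\<And>f. L2 f \<Longrightarrow> (\<lambda>k. (cmod (L2_inner f (gabor a b h k)))\<^sup>2) summable_on UNIV"
    "\<And>f. L2 f \<Longrightarrow> (\<Sum>\<^sub>\<infinity>k. (cmod (L2_inner f (gabor a b h k)))\<^sup>2) \<le> B' * L2_normsq f"
    using gabor_bessel[OF a b h] by blast
  have frameI: "frame_L2 \<phi>" if "\<And>k. L2 (\<phi> k)" "A > 0" "\<And>f. L2 f \<Longrightarrow> (\<lambda>k. (cmod (L2_inner f (\<phi> k)))\<^sup>2) summable_on UNIV"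
      "\<And>f. L2 f \<Longrightarrow> A * L2_normsq f \<le> (\<Sum>\<^sub>\<infinity>k. (cmod (L2_inner f (\<phi> k)))\<^sup>2)"
      "\<And>f. L2 f \<Longrightarrow> (\<Sum>\<^sub>\<infinity>k. (cmod (L2_inner f (\<phi> k)))\<^sup>2) \<le> D * L2_normsq f" for \<phi> A D
    unfolding frame_L2_def
  proof (rule conjI, use that in blast, rule exI[of _ A], rule exI[of _ "max A D"], intro conjI allI impI)
    fix f assume f: "L2 f"
    have "D * L2_normsq f \<le> max A D * L2_normsq f" by (intro mult_right_mono) (auto simp: L2_normsq_def)
    then show "(\<Sum>\<^sub>\<infinity>k. (cmod (L2_inner f (\<phi> k)))\<^sup>2) \<le> max A D * L2_normsq f" using that(5)[OF f] by linarith
  qed (use that in auto)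
  have "frame_L2 (gabor a b g)"
    using frame_lower_bound[OF exp B'(2) B(2) B'(1) B'(3)] B B'
    by (intro frameI[of _ "1 / B'" B] L2_gabor[OF g b]) auto
  moreover have "frame_L2 (gabor a b h)"
    using frame_lower_bound[OF exp' B(2) B'(2) B(1) B(3)] B B'
    by (intro frameI[of _ "1 / B" B'] L2_gabor[OF h b]) auto
  ultimately show ?thesis unfolding dual_frames_L2_def using exp by blast
qed


section \<open>Inverting the blocks\<close>

text \<open>Here \<open>y\<close> is the column carrying the first zero and \<open>n\<close> the
  number of steps to the column carrying the second, so a pair i \<le> j becomes 0 \<le> n. The case
  n = 0 is condition (i) of the theorem.\<close>

definition chain_nondegenerate :: "(real \<Rightarrow> complex) \<Rightarrow> real \<Rightarrow> real \<Rightarrow> bool" where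
  "chain_nondegenerate g a c \<longleftrightarrow>
     (\<forall>y (n::nat). 0 \<le> y \<longrightarrow> y + real n * c \<le> a \<longrightarrow> g y \<noteq> 0 \<or> g (y + real n * c - a) \<noteq> 0)"

text \<open>The solution X of X_0 = 1/g(y) and X_m * g(y - m*c) = - X_(m-1) * g(y - m*c - a): the
  functional that recovers the column at \<open>y\<close> by eliminating the columns y - c, y - 2c,
  ... one after the other. It stops where y - m*c leaves [0,a].\<close>

definition chain_inverse :: "(real \<Rightarrow> complex) \<Rightarrow> real \<Rightarrow> real \<Rightarrow> real \<Rightarrow> nat \<Rightarrow> complex" where
  "chain_inverse g a c y m =
     (if real m * c \<le> y then 1 / g y * (\<Prod>l\<in>{1..m}. - g (y - real l * c - a) / g (y - real l * c)) else 0)"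

lemma chain_inverse_Suc:
  assumes "c > 0" "real (Suc m) * c \<le> y" "g (y - real (Suc m) * c) \<noteq> 0"
  shows "chain_inverse g a c y (Suc m) * g (y - real (Suc m) * c) = - chain_inverse g a c y m * g (y - real (Suc m) * c - a)"
proof -
  have "real m * c \<le> y" using assms(1,2) by (simp add: distrib_right)
  then show ?thesis using assms(2,3) by (simp add: chain_inverse_def)
qed

text \<open>For k > 0 all arguments are at least \<open>a\<close>. For k = 0 only m = 0 survives,
  giving 1. For k = -q with q*c \<le> y only m = q - 1 and m = q survive, and they cancel by the
  recursion. For larger q the arguments belonging to nonzero coefficients are at most -a, so the
  block ends without a remainder.\<close>

lemma chain_inverse_row_sum:
  assumes a: "a > 0" and c: "c > 0" and g0: "\<And>x. \<bar>x\<bar> \<ge> a \<Longrightarrow> g x = 0"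
    and y: "0 \<le> y" "y \<le> a" and M: "a < real M * c"
    and nz: "\<And>l::nat. real l * c \<le> y \<Longrightarrow> g (y - real l * c) \<noteq> 0"
  shows "(\<Sum>m<M. chain_inverse g a c y m * g (y + real_of_int k * (a + c) + real m * a)) = (if k = 0 then 1 else 0)"
proof -
  let ?t = "\<lambda>m. chain_inverse g a c y m * g (y + real_of_int k * (a + c) + real m * a)"
  have M0: "M > 0" using M a by (cases M) auto
  consider "k > 0" | "k = 0" | q where "q \<ge> 1" "k = - int q" "real q * c \<le> y" | q where "k = - int q" "real q * c > y"
  proof (cases "k < 0")
    case True
    then have "nat (-k) \<ge> 1" "k = - int (nat (-k))" by auto
    then show ?thesis using that(3,4) by (metis not_le)
  qed (use that in force)
  then show ?thesis
  proof cases
    case 1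
    have "?t m = 0" for m
    proof -
      define z where "z = real_of_int k * (a + c)"
      have z: "a + c \<le> z" unfolding z_def using mult_right_mono[of 1 "real_of_int k" "a + c"] 1 a c by simp
      have "0 \<le> real m * a" using a by simp
      with z have "y + z + real m * a \<ge> a" using y(1) c by linarith
      then have "y + real_of_int k * (a + c) + real m * a \<ge> a" by (simp only: z_def)
      then show ?thesis using g0 a by simp
    qed
    then have "(\<Sum>m<M. ?t m) = 0" by (intro sum.neutral ballI)
    then show ?thesis using 1 by simp
  next
    case 2
    have "?t m = 0" if "m \<noteq> 0" for m
    proof -
      have "1 * a \<le> real m * a" using that a by (intro mult_right_mono) auto
      then have "y + real_of_int k * (a + c) + real m * a \<ge> a" using y 2 by simp
      then show ?thesis using g0 a by simp
    qed
    then have "(\<Sum>m<M. ?t m) = (\<Sum>m\<in>{0}. ?t m)"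
      using M0 by (intro sum.mono_neutral_right) auto
    then show ?thesis using 2 y nz[of 0] by (simp add: chain_inverse_def)
  next
    case (3 q)
    obtain p where p: "q = Suc p" using 3(1) by (cases q) auto
    have arg: "y + real_of_int k * (a + c) + real m * a = (y - real q * c) + (real m - real q) * a" for m
      by (simp add: 3 algebra_simps)
    have "?t m = 0" if "m \<noteq> q" "m \<noteq> p" for m
    proof -
      have "m \<ge> q + 1 \<or> m + 2 \<le> q" using that p by arith
      then consider "m \<ge> q + 1" | "m + 2 \<le> q" by blast
      then have "\<bar>y + real_of_int k * (a + c) + real m * a\<bar> \<ge> a"
      proof cases
        case 1
        then have "1 * a \<le> (real m - real q) * a" using a by (intro mult_right_mono) auto
        then show ?thesis unfolding arg using 3(3) by linarith
      next
        case 2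
        then have "(real m - real q) * a \<le> (-2) * a" using a by (intro mult_right_mono) auto
        moreover have "real q * c \<ge> 0" using c by simp
        ultimately show ?thesis unfolding arg using y by linarith
      qed
      then show ?thesis using g0 by simp
    qed
    moreover have "q < M"
    proof -
      have "real q * c < real M * c" using 3(3) y M by linarith
      then show ?thesis using c by simp
    qed
    ultimately have "(\<Sum>m<M. ?t m) = (\<Sum>m\<in>{p, q}. ?t m)"
      using p by (intro sum.mono_neutral_right) auto
    also have "\<dots> = ?t p + ?t q" using p by simp
    also have "?t q = chain_inverse g a c y q * g (y - real q * c)" unfolding arg by simp
    also have "?t p = chain_inverse g a c y p * g (y - real q * c - a)" unfolding arg by (simp add: p algebra_simps)
    finally show ?thesis
      using chain_inverse_Suc[OF c, of p y g a] 3 nz[of q] p by simp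
  next
    case (4 q)
    have "?t m = 0" for m
    proof (cases "real m * c \<le> y")
      case True
      then have "real m * c < real q * c" using 4 by linarith
      then have "m < q" using c by simp
      then have "(real m - real q) * a \<le> (-1) * a" using a by (intro mult_right_mono) auto
      then have "y + real_of_int k * (a + c) + real m * a \<le> - a"
        using 4 by (simp add: algebra_simps)
      then show ?thesis using g0 a by simp
    qed (simp add: chain_inverse_def)
    then have "(\<Sum>m<M. ?t m) = 0" by (intro sum.neutral ballI)
    moreover have "k \<noteq> 0" using 4 y by (cases "q = 0") auto
    ultimately show ?thesis by simp
  qed
qed

lemma chain_inverse_bound:
  assumes c: "c > 0" and e: "e > 0" and C: "\<And>x. cmod (g x) \<le> C" and M: "y < real M * c"
    and nz: "\<And>l::nat. real l * c \<le> y \<Longrightarrow> e \<le> cmod (g (y - real l * c))"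
  shows "cmod (chain_inverse g a c y m) \<le> 1 / e * (1 + C / e) ^ M"
proof (cases "real m * c \<le> y")
  case True
  have C0: "C \<ge> 0" using C[of 0] norm_ge_zero order_trans by blast
  have "0 \<le> y" using True c by (meson mult_nonneg_nonneg of_nat_0_le_iff less_imp_le order_trans)
  then have e0: "e \<le> cmod (g y)" using nz[of 0] by simp
  \<comment> \<open>The 1 makes the base at least 1, so the exponent m can be raised to the common
    \<open>M\<close>.\<close>
  have l: "cmod (- g (y - real l * c - a) / g (y - real l * c)) \<le> 1 + C / e" if "l \<in> {1..m}" for l
  proof -
    have "real l * c \<le> real m * c" using that c by (intro mult_right_mono) auto
    then have "e \<le> cmod (g (y - real l * c))" using True by (intro nz) linarith
    then have "cmod (- g (y - real l * c - a) / g (y - real l * c)) \<le> C / e"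
      using C e C0 by (simp add: norm_divide frac_le)
    then show ?thesis by linarith
  qed
  have mM: "m \<le> M"
  proof -
    have "real m * c < real M * c" using True M by linarith
    then show ?thesis using c by simp
  qed
  have "cmod (\<Prod>l\<in>{1..m}. - g (y - real l * c - a) / g (y - real l * c)) \<le> (\<Prod>l\<in>{1..m}. 1 + C / e)"
    unfolding prod_norm[symmetric] by (intro prod_mono conjI l norm_ge_zero)
  also have "\<dots> = (1 + C / e) ^ m" by simp
  also have "\<dots> \<le> (1 + C / e) ^ M" using mM C0 e by (intro power_increasing) auto
  finally have p: "cmod (\<Prod>l\<in>{1..m}. - g (y - real l * c - a) / g (y - real l * c)) \<le> (1 + C / e) ^ M" .
  have "cmod (1 / g y) \<le> 1 / e" using e0 e by (simp add: norm_divide frac_le)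
  then show ?thesis
    unfolding chain_inverse_def using True p e by (simp only: if_True norm_mult) (intro mult_mono, auto)
next
  case False
  have "C \<ge> 0" using C[of 0] norm_ge_zero order_trans by blast
  then show ?thesis using False e by (simp add: chain_inverse_def)
qed

text \<open>For each n the sum of the two moduli is continuous and positive on a compact interval,
  so it has a positive minimum. Only n with n*c \<le> a matter, hence finitely many minima are
  compared.\<close>

lemma chain_nondegenerate_uniform:
  assumes nd: "chain_nondegenerate g a c" and g: "continuous_on UNIV g" and c: "c > 0"
  obtains e where "e > 0" "\<And>y n. 0 \<le> y \<Longrightarrow> y + real n * c \<le> a \<Longrightarrow> e \<le> cmod (g y) \<or> e \<le> cmod (g (y + real n * c - a))"
proof -
  have "\<exists>e>0. \<forall>y\<in>{0..a - real n * c}. e \<le> cmod (g y) + cmod (g (y + real n * c - a))" for n :: nat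
  proof (cases "{0..a - real n * c} = {}")
    case False
    have "continuous_on {0..a - real n * c} (\<lambda>y. cmod (g y) + cmod (g (y + real n * c - a)))"
      by (intro continuous_intros continuous_on_compose2[OF g]) auto
    then obtain z where z: "z \<in> {0..a - real n * c}"
      "\<And>y. y \<in> {0..a - real n * c} \<Longrightarrow> cmod (g z) + cmod (g (z + real n * c - a)) \<le> cmod (g y) + cmod (g (y + real n * c - a))"
      using continuous_attains_inf[OF compact_Icc False] by blast
    have "g z \<noteq> 0 \<or> g (z + real n * c - a) \<noteq> 0" using nd z(1) unfolding chain_nondegenerate_def by auto
    then have "cmod (g z) + cmod (g (z + real n * c - a)) > 0" by (auto simp: add_pos_nonneg add_nonneg_pos)
    then show ?thesis using z(2) by blast
  qed (auto intro: exI[of _ 1])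
  then obtain e where e: "\<And>n::nat. e n > 0" "\<And>n y. y \<in> {0..a - real n * c} \<Longrightarrow> e n \<le> cmod (g y) + cmod (g (y + real n * c - a))"
    by metis
  obtain M :: nat where "a / c < real M" using reals_Archimedean2 by blast
  then have M: "a < real M * c" using c by (simp add: field_simps)
  \<comment> \<open>Halved, because a sum of two moduli that is at least 2*e0 has a term that is at
    least e0.\<close>
  define e0 where "e0 = Min (e ` {..M}) / 2"
  show ?thesis
  proof
    show "e0 > 0" unfolding e0_def using e(1) by (subst half_gt_zero_iff, subst Min_gr_iff) auto
    fix y and n :: nat assume y: "0 \<le> y" "y + real n * c \<le> a"
    have "real n * c < real M * c" using y M by linarith
    then have "n \<le> M" using c by simp
    then have "2 * e0 \<le> e n" unfolding e0_def by simp
    also have "\<dots> \<le> cmod (g y) + cmod (g (y + real n * c - a))" using y by (intro e(2)) auto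
    finally show "e0 \<le> cmod (g y) \<or> e0 \<le> cmod (g (y + real n * c - a))" by linarith
  qed
qed

text \<open>No pivot of \<open>chain_inverse\<close> at \<open>y\<close> is below the threshold
  \<open>e\<close>.\<close>

definition forward :: "(real \<Rightarrow> complex) \<Rightarrow> real \<Rightarrow> real \<Rightarrow> real \<Rightarrow> bool" where
  "forward g c e y \<longleftrightarrow> (\<forall>l::nat. real l * c \<le> y \<longrightarrow> e \<le> cmod (g (y - real l * c)))"

text \<open>A block is inverted by forward substitution up to the first small entry g(y+jc), and by backward
  substitution from there on; the latter is forward substitution for the reflected window.\<close>

definition dual_window :: "(real \<Rightarrow> complex) \<Rightarrow> real \<Rightarrow> real \<Rightarrow> real \<Rightarrow> real \<Rightarrow> complex" where
  "dual_window g a c e t =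
     (if forward g c e (t - real_of_int \<lfloor>t / a\<rfloor> * a)
      then if 0 \<le> \<lfloor>t / a\<rfloor> then cnj (chain_inverse g a c (t - real_of_int \<lfloor>t / a\<rfloor> * a) (nat \<lfloor>t / a\<rfloor>)) / (a + c) else 0
      else if \<lfloor>t / a\<rfloor> < 0
        then cnj (chain_inverse (\<lambda>x. g (- x)) a c (a - (t - real_of_int \<lfloor>t / a\<rfloor> * a)) (nat (- \<lfloor>t / a\<rfloor> - 1))) / (a + c) else 0)"

text \<open>Reflection sends y + m*a to (a - y) + (- m - 1)*a, which explains the index in the
  second branch. Dividing by a + c, which will equal 1/b, supplies the factor b of the duality
  relation, and the conjugate is undone there.\<close>

lemma dual_window_eq:
  assumes a: "a > 0" and y: "0 \<le> y" "y < a"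
  shows "dual_window g a c e (y + real_of_int m * a) =
     (if forward g c e y then if 0 \<le> m then cnj (chain_inverse g a c y (nat m)) / (a + c) else 0
      else if m < 0 then cnj (chain_inverse (\<lambda>x. g (- x)) a c (a - y) (nat (- m - 1))) / (a + c) else 0)"
proof -
  have "\<lfloor>(y + real_of_int m * a) / a\<rfloor> = m"
    using a y by (simp add: floor_eq_iff field_simps)
  then show ?thesis unfolding dual_window_def by simp
qed

lemma floor_decomp:
  fixes a t :: real
  assumes "a > 0"
  obtains y m where "t = y + real_of_int m * a" "0 \<le> y" "y < a"
proof
  show "t = (t - real_of_int \<lfloor>t / a\<rfloor> * a) + real_of_int \<lfloor>t / a\<rfloor> * a" by simp
  show "0 \<le> t - real_of_int \<lfloor>t / a\<rfloor> * a" "t - real_of_int \<lfloor>t / a\<rfloor> * a < a"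
    using floor_divide_lower[OF assms, of t] floor_divide_upper[OF assms, of t] by (auto simp: distrib_right)
qed

text \<open>One small pivot g(y - p*c) excludes every small g(y + l*c - a): the two points are the
  ends of a chain of p + l steps, to which the separation applies. The latter values are the pivots
  of the reflected elimination.\<close>

lemma not_forward_backward:
  assumes sep: "\<And>y n. 0 \<le> y \<Longrightarrow> y + real n * c \<le> a \<Longrightarrow> e \<le> cmod (g y) \<or> e \<le> cmod (g (y + real n * c - a))"
    and nf: "\<not> forward g c e y" and l: "real l * c \<le> a - y"
  shows "e \<le> cmod (g (- (a - y - real l * c)))"
proof -
  obtain p :: nat where p: "real p * c \<le> y" "cmod (g (y - real p * c)) < e"
    using nf unfolding forward_def by (auto simp: not_le)
  have "e \<le> cmod (g (y - real p * c)) \<or> e \<le> cmod (g (y - real p * c + real (p + l) * c - a))"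
    using p l by (intro sep) (auto simp: algebra_simps)
  then show ?thesis using p(2) by (auto simp: algebra_simps)
qed

lemma chain_inverse_nonzero: "chain_inverse g a c y m \<noteq> 0 \<Longrightarrow> real m * c \<le> y"
  by (auto simp: chain_inverse_def split: if_splits)

text \<open>A nonzero coefficient of index m needs m*c \<le> a < M*c, so m < M. Forward values then
  sit in the cells 0 to M - 1 of length \<open>a\<close>, backward values in the cells -M to
  -1.\<close>

lemma dual_window_support:
  assumes a: "a > 0" and c: "c > 0" and M: "a < real M * c" and nz: "dual_window g a c e t \<noteq> 0"
  shows "t \<in> {-(a * real M)..a * real M}"
proof -
  obtain y m where t: "t = y + real_of_int m * a" "0 \<le> y" "y < a" using floor_decomp[OF a] by blast
  have lt: "k < M" if "real k * c \<le> a" for k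
  proof -
    have "real k * c < real M * c" using that M by linarith
    then show ?thesis using c by simp
  qed
  show ?thesis
  proof (cases "forward g c e y")
    case True
    then have "0 \<le> m \<and> chain_inverse g a c y (nat m) \<noteq> 0"
      using nz by (auto simp: t dual_window_eq[OF a t(2,3)] split: if_splits)
    then have m: "0 \<le> m" "real (nat m) * c \<le> y" using chain_inverse_nonzero by blast+
    then have "nat m < M" using t by (intro lt) linarith
    then have "(real_of_int m + 1) * a \<le> real M * a" using m a by (intro mult_right_mono) linarith+
    moreover have "0 \<le> real_of_int m * a" using m a by simp
    moreover have "0 \<le> a * real M" using a by simp
    ultimately show ?thesis using t a by (auto simp: algebra_simps)
  next
    case False
    then have "m < 0 \<and> chain_inverse (\<lambda>x. g (- x)) a c (a - y) (nat (- m - 1)) \<noteq> 0"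
      using nz by (auto simp: t dual_window_eq[OF a t(2,3)] split: if_splits)
    then have m: "m < 0" "real (nat (- m - 1)) * c \<le> a - y" using chain_inverse_nonzero by blast+
    then have "nat (- m - 1) < M" using t by (intro lt) linarith
    then have "- real M * a \<le> real_of_int m * a" using m a by (intro mult_right_mono) linarith+
    moreover have "real_of_int m * a \<le> (-1) * a" using m a by (intro mult_right_mono) auto
    moreover have "0 \<le> a * real M" using a by simp
    ultimately show ?thesis using t a by (auto simp: algebra_simps)
  qed
qed

lemma chain_inverse_measurable[measurable]:
  assumes [measurable]: "g \<in> borel_measurable borel"
  shows "(\<lambda>y. chain_inverse g a c y m) \<in> borel_measurable borel"
  unfolding chain_inverse_def by measurable

lemma dual_window_measurable:
  assumes [measurable]: "g \<in> borel_measurable borel"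
  shows "dual_window g a c e \<in> borel_measurable borel"
proof -
  have [measurable]: "Measurable.pred borel (forward g c e)"
    unfolding forward_def by measurable
  \<comment> \<open>The index varies with t but takes countably many values, so measurability for
    each fixed index is enough.\<close>
  have [measurable]: "(\<lambda>t. chain_inverse g a c (t - real_of_int \<lfloor>t / a\<rfloor> * a) (nat \<lfloor>t / a\<rfloor>)) \<in> borel_measurable borel"
    by (rule measurable_compose_countable[where f = "\<lambda>i t. chain_inverse g a c (t - real_of_int \<lfloor>t / a\<rfloor> * a) i"]) measurable
  have [measurable]: "(\<lambda>t. chain_inverse (\<lambda>x. g (- x)) a c (a - (t - real_of_int \<lfloor>t / a\<rfloor> * a)) (nat (- \<lfloor>t / a\<rfloor> - 1))) \<in> borel_measurable borel"
    by (rule measurable_compose_countable[where f = "\<lambda>i t. chain_inverse (\<lambda>x. g (- x)) a c (a - (t - real_of_int \<lfloor>t / a\<rfloor> * a)) i"]) measurable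
  show ?thesis unfolding dual_window_def[abs_def] by measurable
qed

lemma dual_window_bounded:
  assumes a: "a > 0" and c: "c > 0" and e: "e > 0" and C: "\<And>x. cmod (g x) \<le> C" and M: "a < real M * c"
    and sep: "\<And>y n. 0 \<le> y \<Longrightarrow> y + real n * c \<le> a \<Longrightarrow> e \<le> cmod (g y) \<or> e \<le> cmod (g (y + real n * c - a))"
  shows "cmod (dual_window g a c e t) \<le> 1 / e * (1 + C / e) ^ M / (a + c)"
proof -
  obtain y m where t: "t = y + real_of_int m * a" "0 \<le> y" "y < a" using floor_decomp[OF a] by blast
  have C0: "C \<ge> 0" using C[of 0] norm_ge_zero order_trans by blast
  have ac: "cmod (complex_of_real a + complex_of_real c) = a + c"
    using a c by (metis add_pos_pos norm_of_real abs_of_pos of_real_add)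
  define D where "D = 1 / e * (1 + C / e) ^ M"
  have "cmod (chain_inverse g a c y k) \<le> D" if "forward g c e y" for k
    unfolding D_def using that t M by (intro chain_inverse_bound c e C) (auto simp: forward_def)
  moreover have "cmod (chain_inverse (\<lambda>x. g (- x)) a c (a - y) k) \<le> D" if "\<not> forward g c e y" for k
    unfolding D_def using t M by (intro chain_inverse_bound c e C not_forward_backward[OF sep that]) auto
  moreover have "0 \<le> D / (a + c)" using a c e C0 by (simp add: D_def)
  ultimately show ?thesis
    unfolding D_def[symmetric] t(1) dual_window_eq[OF a t(2,3)]
    using a c by (auto simp: norm_divide ac intro!: divide_right_mono)
qed

lemma sum_neutral_eq:
  assumes "finite A" "finite B" "\<And>x. x \<in> A - B \<Longrightarrow> F x = 0" "\<And>x. x \<in> B - A \<Longrightarrow> F x = 0"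
  shows "sum F A = sum F B"
  using assms by (intro sum.mono_neutral_cong) auto

text \<open>Writing x + k*(a + c) = y + p*a, all values of the dual window in the sum lie on y +
  a*Z, so a single branch of the definition applies throughout. Reindexing by p - n, or by n - p - 1
  after reflection, leaves the row sum of \<open>chain_inverse\<close> for the column -k,
  respectively k.\<close>

lemma dual_window_row_sum:
  assumes a: "a > 0" and c: "c > 0" and e: "e > 0" and g0: "\<And>x. \<bar>x\<bar> \<ge> a \<Longrightarrow> g x = 0"
    and sep: "\<And>y n. 0 \<le> y \<Longrightarrow> y + real n * c \<le> a \<Longrightarrow> e \<le> cmod (g y) \<or> e \<le> cmod (g (y + real n * c - a))"
    and R: "a \<le> R"
  shows "(\<Sum>n | \<bar>x - real_of_int n * a\<bar> \<le> R. cnj (dual_window g a c e (x + real_of_int k * (a + c) - real_of_int n * a)) * g (x - real_of_int n * a))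
     = (if k = 0 then 1 / (complex_of_real a + complex_of_real c) else 0)"
proof -
  obtain M :: nat where "a / c < real M" using reals_Archimedean2 by blast
  then have M: "a < real M * c" using c by (simp add: field_simps)
  obtain y p where t: "x + real_of_int k * (a + c) = y + real_of_int p * a" "0 \<le> y" "y < a" using floor_decomp[OF a] by blast
  define F where "F n = cnj (dual_window g a c e (x + real_of_int k * (a + c) - real_of_int n * a)) * g (x - real_of_int n * a)" for n
  have arg: "x + real_of_int k * (a + c) - real_of_int n * a = y + real_of_int (p - n) * a" for n
    unfolding t(1) by (simp add: algebra_simps)
  have argg: "x - real_of_int n * a = y + real_of_int (- k) * (a + c) + real_of_int (p - n) * a" for n
    using t(1) by (simp add: algebra_simps)
  have out: "F n = 0" if "n \<notin> {n. \<bar>x - real_of_int n * a\<bar> \<le> R}" for n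
    using that g0 R by (auto simp: F_def not_le)
  have fin: "finite {n. \<bar>x - real_of_int n * a\<bar> \<le> R}" using overlap(1)[OF a] R a by simp
  have lt: "k < M" if "real k * c \<le> a" for k
  proof -
    have "real k * c < real M * c" using that M by linarith
    then show ?thesis using c by simp
  qed
  have "(\<Sum>n | \<bar>x - real_of_int n * a\<bar> \<le> R. F n) = (if k = 0 then 1 / (complex_of_real a + complex_of_real c) else 0)"
  proof (cases "forward g c e y")
    case True
    have Fn: "F n = (if n \<le> p then chain_inverse g a c y (nat (p - n)) * g (x - real_of_int n * a) / (a + c) else 0)" for n
      unfolding F_def arg dual_window_eq[OF a t(2,3)] using True by simp
    have "(\<Sum>n | \<bar>x - real_of_int n * a\<bar> \<le> R. F n) = sum F ((\<lambda>m. p - int m) ` {..<M})"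
    proof (rule sum_neutral_eq[OF fin])
      fix n assume n: "n \<in> {n. \<bar>x - real_of_int n * a\<bar> \<le> R} - (\<lambda>m. p - int m) ` {..<M}"
      show "F n = 0"
      proof (rule ccontr)
        assume "F n \<noteq> 0"
        then have "n \<le> p \<and> chain_inverse g a c y (nat (p - n)) \<noteq> 0" by (auto simp: Fn split: if_splits)
        then have "n \<le> p" "real (nat (p - n)) * c \<le> y" using chain_inverse_nonzero by blast+
        then have "nat (p - n) < M" "n = p - int (nat (p - n))" using t(3) by (auto intro!: lt)
        then show False using n by blast
      qed
    qed (use out in auto)
    also have "\<dots> = (\<Sum>m<M. F (p - int m))"
      by (subst sum.reindex) (auto simp: inj_on_def)
    also have "\<dots> = (\<Sum>m<M. chain_inverse g a c y m * g (y + real_of_int (- k) * (a + c) + real m * a)) / (a + c)"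
    proof -
      have "x - real_of_int (p - int m) * a = y + real_of_int (- k) * (a + c) + real m * a" for m
        unfolding argg by simp
      then show ?thesis unfolding sum_divide_distrib Fn by (intro sum.cong refl) (simp only:, simp)
    qed
    also have "\<dots> = (if - k = 0 then 1 else 0) / (a + c)"
      using True e t by (subst chain_inverse_row_sum[OF a c g0 _ _ M]) (auto simp: forward_def)
    finally show ?thesis by simp
  next
    case False
    have Fn: "F n = (if p < n then chain_inverse (\<lambda>x. g (- x)) a c (a - y) (nat (n - p - 1)) * g (x - real_of_int n * a) / (a + c) else 0)" for n
      unfolding F_def arg dual_window_eq[OF a t(2,3)] using False by (simp add: algebra_simps)
    have "(\<Sum>n | \<bar>x - real_of_int n * a\<bar> \<le> R. F n) = sum F ((\<lambda>m. p + 1 + int m) ` {..<M})"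
    proof (rule sum_neutral_eq[OF fin])
      fix n assume n: "n \<in> {n. \<bar>x - real_of_int n * a\<bar> \<le> R} - (\<lambda>m. p + 1 + int m) ` {..<M}"
      show "F n = 0"
      proof (rule ccontr)
        assume "F n \<noteq> 0"
        then have "p < n \<and> chain_inverse (\<lambda>x. g (- x)) a c (a - y) (nat (n - p - 1)) \<noteq> 0"
          by (auto simp: Fn split: if_splits)
        then have "p < n" "real (nat (n - p - 1)) * c \<le> a - y" using chain_inverse_nonzero by blast+
        then have "nat (n - p - 1) < M" "n = p + 1 + int (nat (n - p - 1))" using t(2) by (auto intro!: lt)
        then show False using n by blast
      qed
    qed (use out in auto)
    also have "\<dots> = (\<Sum>m<M. F (p + 1 + int m))"
      by (subst sum.reindex) (auto simp: inj_on_def)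
    also have "\<dots> = (\<Sum>m<M. chain_inverse (\<lambda>x. g (- x)) a c (a - y) m * g (- (a - y + real_of_int k * (a + c) + real m * a))) / (a + c)"
    proof -
      have "x - real_of_int (p + 1 + int m) * a = - (a - y + real_of_int k * (a + c) + real m * a)" for m
        unfolding argg by (simp add: algebra_simps)
      then show ?thesis unfolding sum_divide_distrib Fn by (intro sum.cong refl) (simp only:, simp)
    qed
    also have "\<dots> = (if k = 0 then 1 else 0) / (a + c)"
    proof (subst chain_inverse_row_sum[OF a c _ _ _ M, of "\<lambda>x. g (- x)"])
      fix l :: nat assume "real l * c \<le> a - y"
      then show "g (- (a - y - real l * c)) \<noteq> 0"
        using not_forward_backward[OF sep False, of l] e by auto
    qed (use t g0 in auto)
    finally show ?thesis by simp
  qed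
  then show ?thesis by (simp add: F_def)
qed


section \<open>Frames and degenerate blocks\<close>

text \<open>The endpoints are included: \<open>g\<close> vanishes outside its support and hence, by
  continuity, on the closure of that complement. With \<alpha> \<le> a this makes the matrices
  bidiagonal even for points at the ends of [0,a].\<close>

lemma V_zero_outside:
  assumes g: "g \<in> V \<alpha>" and x: "\<bar>x\<bar> \<ge> \<alpha>"
  shows "g x = 0"
proof -
  have cont: "continuous_on UNIV g" and cl: "closure {x. g x \<noteq> 0} = {-\<alpha>..\<alpha>}"
    using g by (auto simp: V_def)
  have out: "g x = 0" if "\<bar>x\<bar> > \<alpha>" for x
    using that cl closure_subset[of "{x. g x \<noteq> 0}"] by force
  have c0: "closed {x. g x = 0}" using continuous_closed_preimage_constant[OF cont closed_UNIV, of 0] by simp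
  have "{\<alpha><..} \<subseteq> {x. g x = 0}" "{..<-\<alpha>} \<subseteq> {x. g x = 0}" using out by auto
  then have "closure {\<alpha><..} \<subseteq> {x. g x = 0}" "closure {..<-\<alpha>} \<subseteq> {x. g x = 0}"
    using c0 closure_minimal by blast+
  then have "{\<alpha>..} \<subseteq> {x. g x = 0}" "{..-\<alpha>} \<subseteq> {x. g x = 0}" by simp_all
  moreover have "x \<in> {\<alpha>..} \<or> x \<in> {..-\<alpha>}" using x by auto
  ultimately show ?thesis by blast
qed

lemma V_window:
  assumes g: "g \<in> V \<alpha>" and "\<alpha> \<le> R" "\<alpha> > 0"
  obtains C where "window C R g"
proof -
  have cont: "continuous_on UNIV g" using g by (auto simp: V_def)
  have "bounded (g ` {-\<alpha>..\<alpha>})"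
    by (intro compact_imp_bounded compact_continuous_image continuous_on_subset[OF cont]) auto
  then obtain C where "C > 0" "\<forall>z\<in>g ` {-\<alpha>..\<alpha>}. cmod z \<le> C"
    unfolding bounded_pos by blast
  then have C: "\<And>x. x \<in> {-\<alpha>..\<alpha>} \<Longrightarrow> cmod (g x) \<le> C" "C > 0" by auto
  have "cmod (g x) \<le> C" for x
    using C V_zero_outside[OF g, of x] by (cases "x \<in> {-\<alpha>..\<alpha>}") (auto simp: abs_le_iff)
  then have "window C R g"
    using C assms V_zero_outside[OF g] by (auto simp: window_def intro!: borel_measurable_continuous_onI cont)
  then show ?thesis by (rule that)
qed

lemma nondegenerate_dual_frames:
  assumes g: "g \<in> V \<alpha>" and \<alpha>: "\<alpha> > 0" "\<alpha> \<le> a" and a: "a > 0" and b: "b > 0" and c: "c > 0"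
    and b_eq: "1 / b = a + c" and M: "a < real M * c" "M \<ge> 1" and nd: "chain_nondegenerate g a c"
  shows "\<exists>h. L2 h \<and> (\<forall>x. x \<notin> {-(a * real M) .. a * real M} \<longrightarrow> h x = 0) \<and> dual_frames_L2 (gabor a b g) (gabor a b h)"
proof -
  have cont: "continuous_on UNIV g" using g by (auto simp: V_def)
  obtain e where e: "e > 0" and sep: "\<And>y n. 0 \<le> y \<Longrightarrow> y + real n * c \<le> a \<Longrightarrow> e \<le> cmod (g y) \<or> e \<le> cmod (g (y + real n * c - a))"
    using chain_nondegenerate_uniform[OF nd cont c] by blast
  define h where "h = dual_window g a c e"
  \<comment> \<open>One radius for both windows: it covers the support of \<open>h\<close>, and that
    of \<open>g\<close> since \<alpha> \<le> a \<le> R.\<close>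
  define R where "R = a * real M"
  have R: "a \<le> R" using M(2) a by (simp add: R_def)
  have ac: "complex_of_real a + complex_of_real c = 1 / complex_of_real b"
    unfolding of_real_add[symmetric] b_eq[symmetric] by simp
  have R\<alpha>: "\<alpha> \<le> R" using R \<alpha> by simp
  obtain C where gw: "window C R g" using V_window[OF g R\<alpha> \<alpha>(1)] .
  have g0: "g x = 0" if "\<bar>x\<bar> \<ge> a" for x using V_zero_outside[OF g, of x] that \<alpha> by simp
  have supp: "h x = 0" if "x \<notin> {-(a * real M)..a * real M}" for x
    using dual_window_support[OF a c M(1), of g e x] that by (auto simp: h_def)
  obtain D where D: "\<And>t. cmod (h t) \<le> D"
    using dual_window_bounded[OF a c e _ M(1) sep, of C] gw by (auto simp: h_def window_def)
  have hw: "window D R h"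
    unfolding window_def
  proof (intro conjI allI impI D)
    show "0 \<le> D" using D[of 0] norm_ge_zero order_trans by blast
    show "0 \<le> R" using R a by simp
    show "h \<in> borel_measurable borel"
      using dual_window_measurable[of g a c e] gw by (simp add: h_def window_def)
    show "h x = 0" if "R < \<bar>x\<bar>" for x using that by (intro supp) (auto simp: R_def)
  qed
  have kb: "real_of_int k / b = real_of_int k * (a + c)" for k by (simp add: b_eq[symmetric])
  have "dual_frames_L2 (gabor a b g) (gabor a b h)"
  proof (rule gabor_dual_frames[OF a b gw hw])
    fix x and k :: int
    show "(\<Sum>n | \<bar>x - real_of_int n * a\<bar> \<le> R. cnj (h (x + real_of_int k / b - real_of_int n * a)) * g (x - real_of_int n * a))
        = (if k = 0 then complex_of_real b else 0)"
      using dual_window_row_sum[OF a c e g0 sep R, of x k] by (simp add: kb h_def ac)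
  qed
  moreover have "L2 h"
    using L2_gabor[OF hw b, of a "(0, 0)"] by (simp add: gabor_def modul_def transl_def)
  ultimately show ?thesis using supp by blast
qed

text \<open>Take a pair of zeros with the fewest steps n between them. The first row of the block
  vanishes because g(y) = 0, the last because g(y + n*c - a) = 0, and the rows in between determine
  the entries recursively. The normalization d 0 = 1 later keeps the test function away from
  zero.\<close>

lemma kernel_vector:
  assumes a: "a > 0" and c: "c > 0" and g0: "\<And>x. \<bar>x\<bar> \<ge> a \<Longrightarrow> g x = 0" and nd: "\<not> chain_nondegenerate g a c"
  obtains y :: real and n :: nat and d :: "nat \<Rightarrow> complex" where "0 \<le> y" "d 0 = 1"
    "\<And>p::int. (\<Sum>j\<le>n. d j * g (y + real j * (a + c) - real_of_int p * a)) = 0"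
proof -
  define viol where "viol y n \<longleftrightarrow> 0 \<le> y \<and> y + real n * c \<le> a \<and> g y = 0 \<and> g (y + real n * c - a) = 0" for y and n :: nat
  have "\<exists>n y. viol y n" using nd unfolding chain_nondegenerate_def viol_def by blast
  define n where "n = (LEAST n. \<exists>y. viol y n)"
  have "\<exists>y. viol y n" unfolding n_def by (rule LeastI_ex) fact
  then obtain y where y: "viol y n" by blast
  have min: "\<not> viol y' n'" if "n' < n" for y' n' using not_less_Least[of n' "\<lambda>n. \<exists>y. viol y n"] that unfolding n_def by blast
  \<comment> \<open>A zero here would start a shorter chain with the same end, against minimality;
    so the recursion below never divides by zero.\<close>
  have nz: "g (y + real j * c) \<noteq> 0" if "0 < j" "j \<le> n" for j
  proof
    assume "g (y + real j * c) = 0"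
    then have "viol (y + real j * c) (n - j)" using y that c by (auto simp: viol_def of_nat_diff algebra_simps)
    then show False using min[of "n - j"] that by auto
  qed
  \<comment> \<open>Solves row j + 1, which reads d_j * g(y + j*c - a) + d_(j+1) * g(y + (j+1)*c) =
    0.\<close>
  define d where "d = rec_nat 1 (\<lambda>j dj. - g (y + real j * c - a) * dj / g (y + real (Suc j) * c))"
  have d0: "d 0 = 1" and dS: "\<And>j. d (Suc j) = - g (y + real j * c - a) * d j / g (y + real (Suc j) * c)" by (auto simp: d_def)
  have yj: "0 \<le> y + real j * c" "y + real j * c \<le> a" if "j \<le> n" for j
  proof -
    have "real j * c \<le> real n * c" using that c by (intro mult_right_mono) auto
    moreover have "0 \<le> real j * c" using c by simp
    ultimately show "0 \<le> y + real j * c" "y + real j * c \<le> a" using y by (auto simp: viol_def)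
  qed
  have ker: "(\<Sum>j\<le>n. d j * g (y + real j * (a + c) - real_of_int p * a)) = 0" for p :: int
  proof -
    let ?t = "\<lambda>j. d j * g (y + real j * (a + c) - real_of_int p * a)"
    have arg: "y + real j * (a + c) - real_of_int p * a = (y + real j * c) + (real j - real_of_int p) * a" for j
      by (simp add: algebra_simps)
    have z: "?t j = 0" if "j \<le> n" "int j \<noteq> p" "int j + 1 \<noteq> p" for j
    proof -
      have "int j \<ge> p + 1 \<or> int j + 2 \<le> p" using that by arith
      then have "\<bar>y + real j * (a + c) - real_of_int p * a\<bar> \<ge> a"
      proof
        assume "int j \<ge> p + 1"
        then have "1 * a \<le> (real j - real_of_int p) * a" using a by (intro mult_right_mono) linarith+
        then show ?thesis unfolding arg using yj[OF that(1)] by linarith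
      next
        assume "int j + 2 \<le> p"
        then have "(real j - real_of_int p) * a \<le> (-2) * a" using a by (intro mult_right_mono) linarith+
        then show ?thesis unfolding arg using yj[OF that(1)] by linarith
      qed
      then show ?thesis using g0 by simp
    qed
    consider "p < 0 \<or> p > int n + 1" | "p = 0" | "p = int n + 1" | q where "p = int (Suc q)" "Suc q \<le> n"
    proof (cases "0 < p \<and> p \<le> int n")
      case True
      then have "p = int (Suc (nat (p - 1)))" "Suc (nat (p - 1)) \<le> n" by auto
      then show ?thesis using that by blast
    qed (use that in force)
    then show ?thesis
    proof cases
      case 1
      show ?thesis by (intro sum.neutral ballI z) (use 1 in auto)
    next
      case 2
      have "?t j = 0" if "j \<le> n" for j
        using z[OF that] y 2 by (cases "j = 0") (auto simp: viol_def)
      then show ?thesis by (intro sum.neutral ballI) (simp only: atMost_iff)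
    next
      case 3
      have "?t j = 0" if "j \<le> n" for j
      proof (cases "j = n")
        case True
        then show ?thesis using y unfolding arg by (simp add: 3 viol_def)
      next
        case False
        then show ?thesis using z[OF that] that 3 by auto
      qed
      then show ?thesis by (intro sum.neutral ballI) (simp only: atMost_iff)
    next
      case (4 q)
      have "(\<Sum>j\<le>n. ?t j) = (\<Sum>j\<in>{q, Suc q}. ?t j)"
        using 4 by (intro sum.mono_neutral_right ballI z) auto
      also have "\<dots> = d q * g (y + real q * c - a) + d (Suc q) * g (y + real (Suc q) * c)"
        unfolding arg by (simp add: 4)
      also have "\<dots> = 0" using nz[of "Suc q"] 4 by (simp add: dS)
      finally show ?thesis .
    qed
  qed
  show ?thesis using that[of y d n] y d0 ker by (auto simp: viol_def)
qed

text \<open>The test function equals conj (d j) on an interval of length \<delta> starting at y +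
  j*T. Its squared norm is at least \<delta>, whereas each row sum is at most a constant times
  \<eta>*\<delta>, because the kernel relation holds at \<open>y\<close> and, by continuity, up to
  \<eta> nearby. Only finitely many rows contribute, so a small \<eta> contradicts the lower
  bound.\<close>

lemma frame_imp_nondegenerate:
  assumes g: "g \<in> V \<alpha>" and \<alpha>: "\<alpha> > 0" "\<alpha> \<le> a" and a: "a > 0" and b: "b > 0" and c: "c > 0"
    and b_eq: "1 / b = a + c" and frame: "frame_L2 (gabor a b g)"
  shows "chain_nondegenerate g a c"
proof (rule ccontr)
  assume nd: "\<not> chain_nondegenerate g a c"
  have cont: "continuous_on UNIV g" using g by (auto simp: V_def)
  have g0: "g x = 0" if "\<bar>x\<bar> \<ge> a" for x using V_zero_outside[OF g, of x] that \<alpha> by simp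
  obtain C where gw: "window C a g" using V_window[OF g \<alpha>(2,1)] .
  then have C: "C \<ge> 0" "\<And>x. cmod (g x) \<le> C" and [measurable]: "g \<in> borel_measurable borel" by (auto simp: window_def)
  define T where "T = a + c"
  have T: "T > 0" using a c by (simp add: T_def)
  obtain y n d where y: "0 \<le> y" and d0: "d 0 = 1"
    and ker: "\<And>p::int. (\<Sum>j\<le>n. d j * g (y + real j * T - real_of_int p * a)) = 0"
    using kernel_vector[OF a c g0 nd] unfolding T_def by metis
  obtain A where A: "A > 0" "\<And>f. L2 f \<Longrightarrow> (\<lambda>k. (cmod (L2_inner f (gabor a b g k)))\<^sup>2) summable_on UNIV"
     "\<And>f. L2 f \<Longrightarrow> A * L2_normsq f \<le> (\<Sum>\<^sub>\<infinity>k. (cmod (L2_inner f (gabor a b g k)))\<^sup>2)"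
    using frame unfolding frame_L2_def by metis
  \<comment> \<open>The defect of the kernel relation in row p when the base point is moved by
    s.\<close>
  define \<Phi> where "\<Phi> p s = (\<Sum>j\<le>n. d j * g (y + s + real j * T - real_of_int p * a))" for p :: int and s
  \<comment> \<open>The test function will live between \<open>y\<close> and y + (n + 1)*T, so for
    |p| > P the translate of \<open>g\<close> by p*a misses it.\<close>
  obtain P :: nat where "(y + (real n + 1) * T + a) / a < real P" using reals_Archimedean2 by blast
  then have P: "y + (real n + 1) * T + a < real P * a" using a by (simp add: field_simps)
  define W where "W = {-int P..int P}"
  define D where "D = (\<Sum>j\<le>n. cmod (d j))"
  have D: "D \<ge> 0" by (simp add: D_def sum_nonneg)
  \<comment> \<open>The factor in the final upper bound Q * \<eta> * \<delta>: \<open>T\<close>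
    comes from Parseval, \<open>C\<close> bounds \<open>g\<close>, and \<open>D\<close> * \<delta>
    bounds the L1 norm of the test function.\<close>
  define Q where "Q = real (card W) * (T * (C * D))"
  have Q: "Q \<ge> 0" using C D T by (simp add: Q_def)
  \<comment> \<open>Chosen so that Q * \<eta> < A; the 1 avoids division by zero.\<close>
  define \<eta> where "\<eta> = A / (Q + 1)"
  have \<eta>: "\<eta> > 0" using A Q by (simp add: \<eta>_def)
  have "\<forall>\<^sub>F s in nhds 0. \<forall>p\<in>W. cmod (\<Phi> p s) < \<eta>"
  proof (rule eventually_ball_finite)
    show "finite W" by (simp add: W_def)
    show "\<forall>p\<in>W. \<forall>\<^sub>F s in nhds 0. cmod (\<Phi> p s) < \<eta>"
    proof
      fix p
      have "continuous_on UNIV (\<Phi> p)"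
        unfolding \<Phi>_def by (intro continuous_intros continuous_on_compose2[OF cont]) auto
      then have "isCont (\<Phi> p) 0" by (simp add: continuous_on_eq_continuous_at)
      then have "(\<Phi> p \<longlongrightarrow> \<Phi> p 0) (nhds 0)" by (simp add: tendsto_nhds_iff isCont_def)
      moreover have "\<Phi> p 0 = 0" using ker[of p] by (simp add: \<Phi>_def)
      ultimately show "\<forall>\<^sub>F s in nhds 0. cmod (\<Phi> p s) < \<eta>"
        using \<eta> by (auto dest: tendstoD[of _ _ _ \<eta>] simp: dist_norm)
    qed
  qed
  then obtain \<delta>0 where \<delta>0: "\<delta>0 > 0" "\<And>s p. \<bar>s\<bar> < \<delta>0 \<Longrightarrow> p \<in> W \<Longrightarrow> cmod (\<Phi> p s) < \<eta>"
    unfolding eventually_nhds_metric by (auto simp: dist_real_def)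
  \<comment> \<open>The bound by \<open>T\<close> keeps the pieces of the test function
    disjoint.\<close>
  define \<delta> where "\<delta> = min \<delta>0 T"
  have \<delta>: "\<delta> > 0" "\<delta> \<le> T" "\<delta> \<le> \<delta>0" using \<delta>0 T by (auto simp: \<delta>_def)
  \<comment> \<open>Conjugated because the frame coefficients pair the test function with the
    conjugate of \<open>g\<close>.\<close>
  define e where "e j = (if 0 \<le> j \<and> j \<le> int n then cnj (d (nat j)) else 0)" for j :: int
  define f where "f x = (if x - y - real_of_int \<lfloor>(x - y) / T\<rfloor> * T < \<delta> then e \<lfloor>(x - y) / T\<rfloor> else 0)" for x
  have f_eq: "f (y + s + real_of_int j * T) = (if s < \<delta> then e j else 0)" if "0 \<le> s" "s < T" for s j
  proof -
    have "\<lfloor>(y + s + real_of_int j * T - y) / T\<rfloor> = j" using T that by (simp add: floor_eq_iff field_simps)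
    then show ?thesis by (simp add: f_def)
  qed
  have [measurable]: "f \<in> borel_measurable borel" unfolding f_def[abs_def] by measurable
  have f_le: "cmod (f x) \<le> (\<Sum>j\<le>n. cmod (d j) * indicator {y + real j * T..<y + real j * T + \<delta>} x)" for x
  proof -
    obtain s l where "x - y = s + real_of_int l * T" "0 \<le> s" "s < T" using floor_decomp[OF T] by blast
    then have x: "x = y + s + real_of_int l * T" "0 \<le> s" "s < T" by auto
    show ?thesis
    proof (cases "s < \<delta> \<and> 0 \<le> l \<and> l \<le> int n")
      case True
      then have "cmod (f x) = cmod (d (nat l)) * indicator {y + real (nat l) * T..<y + real (nat l) * T + \<delta>} x"
        using x by (simp add: f_eq e_def)
      also have "\<dots> \<le> (\<Sum>j\<le>n. cmod (d j) * indicator {y + real j * T..<y + real j * T + \<delta>} x)"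
        using True by (intro member_le_sum[of "nat l" "{..n}" "\<lambda>j. cmod (d j) * indicator {y + real j * T..<y + real j * T + \<delta>} x"]) auto
      finally show ?thesis .
    next
      case False
      then have "f x = 0" using x by (auto simp: f_eq e_def)
      then show ?thesis by (simp add: sum_nonneg)
    qed
  qed
  have int_ind: "integrable lborel (\<lambda>x. \<Sum>j\<le>n. cmod (d j) * indicator {y + real j * T..<y + real j * T + \<delta>} x)"
    using \<delta> by (intro Bochner_Integration.integrable_sum integrable_mult_right) (simp add: integrable_indicator_iff)
  have f_int: "integrable lborel (\<lambda>x. cmod (f x))"
    by (rule Bochner_Integration.integrable_bound[OF int_ind]) (auto intro!: AE_I2 order_trans[OF f_le])
  have f_L1: "(\<integral>x. cmod (f x) \<partial>lborel) \<le> D * \<delta>"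
  proof -
    have "(\<integral>x. cmod (f x) \<partial>lborel) \<le> (\<integral>x. (\<Sum>j\<le>n. cmod (d j) * indicator {y + real j * T..<y + real j * T + \<delta>} x) \<partial>lborel)"
      by (intro integral_mono f_int int_ind f_le)
    also have "\<dots> = (\<Sum>j\<le>n. cmod (d j) * \<delta>)"
      using \<delta> by (subst Bochner_Integration.integral_sum) (auto simp: integrable_indicator_iff)
    finally show ?thesis by (simp add: D_def sum_distrib_right)
  qed
  have f_D: "cmod (f x) \<le> D" for x
    using f_le[of x] by (rule order_trans) (unfold D_def, intro sum_mono, auto split: split_indicator)
  have f_L2: "L2 f"
    unfolding L2_def
  proof
    have "integrable lborel (\<lambda>x. D * cmod (f x))" using f_int by simp
    then show "integrable lborel (\<lambda>x. (cmod (f x))\<^sup>2)"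
      by (rule Bochner_Integration.integrable_bound)
         (auto intro!: AE_I2 mult_right_mono f_D simp: power2_eq_square D)
  qed simp
  have f_norm: "\<delta> \<le> L2_normsq f"
  proof -
    have "\<delta> = (\<integral>x. indicator {y..<y + \<delta>} x \<partial>lborel)" using \<delta> by simp
    also have "\<dots> \<le> L2_normsq f"
      unfolding L2_normsq_def
    proof (rule integral_mono)
      show "integrable lborel (\<lambda>x. indicator {y..<y + \<delta>} x :: real)" using \<delta> by (simp add: integrable_indicator_iff)
      show "integrable lborel (\<lambda>x. (cmod (f x))\<^sup>2)" using f_L2 by (simp add: L2_def)
      show "indicator {y..<y + \<delta>} x \<le> (cmod (f x))\<^sup>2" for x
      proof (cases "x \<in> {y..<y + \<delta>}")
        case True
        then have "f x = 1" using f_eq[of "x - y" 0] \<delta> by (simp add: e_def d0)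
        then show ?thesis using True by simp
      qed simp
    qed
    finally show ?thesis .
  qed
  obtain K0 :: nat where "2 * a * b < real K0" using reals_Archimedean2 by blast
  then have K0: "2 * a \<le> real K0 / b" using b by (simp add: field_simps)
  \<comment> \<open>\<open>K0\<close> accounts for the width of the window; adding \<open>n\<close>
    lets the shifts from any piece of the test function reach all the others.\<close>
  define K where "K = K0 + n"
  have K: "2 * a \<le> real K / b"
  proof -
    have "real K0 / b \<le> real K / b" using b by (intro divide_right_mono) (auto simp: K_def)
    then show ?thesis using K0 by linarith
  qed
  have kb: "real_of_int k / b = real_of_int k * T" for k by (simp add: b_eq[symmetric] T_def)
  have conv: "(\<Sum>k\<in>{-int K..int K}. f (x + real_of_int k * T) * cnj (g (x + real_of_int k * T - real_of_int p * a))) = cnj (\<Phi> p s)"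
    if x: "x = y + s + real_of_int l * T" "0 \<le> s" "s < \<delta>" "0 \<le> l" "l \<le> int n" for x s l p
  proof -
    have s: "s < T" using x \<delta> by linarith
    have "(\<Sum>k\<in>{-int K..int K}. f (x + real_of_int k * T) * cnj (g (x + real_of_int k * T - real_of_int p * a)))
       = (\<Sum>k\<in>{-int K..int K}. e (l + k) * cnj (g (y + s + real_of_int (l + k) * T - real_of_int p * a)))"
    proof (intro sum.cong refl)
      fix k
      have "x + real_of_int k * T = y + s + real_of_int (l + k) * T" by (simp add: x algebra_simps)
      then show "f (x + real_of_int k * T) * cnj (g (x + real_of_int k * T - real_of_int p * a))
          = e (l + k) * cnj (g (y + s + real_of_int (l + k) * T - real_of_int p * a))"
        using f_eq[OF x(2) s, of "l + k"] x(3) by simp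
    qed
    also have "\<dots> = (\<Sum>j\<in>{l - int K..l + int K}. e j * cnj (g (y + s + real_of_int j * T - real_of_int p * a)))"
      by (rule sum.reindex_bij_witness[where i = "\<lambda>j. j - l" and j = "\<lambda>k. l + k"]) auto
    also have "\<dots> = (\<Sum>j\<in>int ` {..n}. e j * cnj (g (y + s + real_of_int j * T - real_of_int p * a)))"
    proof (rule sum.mono_neutral_right)
      show "\<forall>j\<in>{l - int K..l + int K} - int ` {..n}. e j * cnj (g (y + s + real_of_int j * T - real_of_int p * a)) = 0"
      proof
        fix j assume j: "j \<in> {l - int K..l + int K} - int ` {..n}"
        have "\<not> (0 \<le> j \<and> j \<le> int n)"
        proof
          assume "0 \<le> j \<and> j \<le> int n"
          then have "j = int (nat j)" "nat j \<le> n" by auto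
          then show False using j by blast
        qed
        then show "e j * cnj (g (y + s + real_of_int j * T - real_of_int p * a)) = 0" by (auto simp: e_def)
      qed
      show "int ` {..n} \<subseteq> {l - int K..l + int K}" using x by (auto simp: K_def)
    qed auto
    also have "\<dots> = cnj (\<Phi> p s)"
      by (subst sum.reindex) (auto simp: \<Phi>_def e_def)
    finally show ?thesis .
  qed
  define u where "u p x = f x * cnj (g (x - real_of_int p * a))" for p :: int and x
  have u: "sq_integrable lborel (u p)" for p unfolding u_def using L2_times_window[OF f_L2 gw] by blast
  define \<sigma> where "\<sigma> p = Re (complex_of_real (1 / b) * (\<Sum>k\<in>{-int K..int K}. \<integral>x. u p (x + real_of_int k / b) * cnj (u p x) \<partial>lborel))" for p
  have row: "((\<lambda>m. (cmod (L2_inner f (gabor a b g (m, p))))\<^sup>2) has_sum \<sigma> p) UNIV" for p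
    unfolding \<sigma>_def u_def by (rule gabor_row_sq_has_sum[OF b f_L2 gw K])
  have \<sigma>_out: "\<sigma> p = 0" if "p \<notin> W" for p
  proof -
    have "u p x = 0" for x
    proof -
      obtain s l where "x - y = s + real_of_int l * T" "0 \<le> s" "s < T" using floor_decomp[OF T] by blast
      then have x: "x = y + s + real_of_int l * T" "0 \<le> s" "s < T" by auto
      show ?thesis
      proof (cases "0 \<le> l \<and> l \<le> int n")
        case True
        have "real_of_int l * T \<le> real n * T" "0 \<le> real_of_int l * T" using True T by (auto intro!: mult_right_mono)
        moreover have "(real n + 1) * T = real n * T + T" by (simp add: distrib_right)
        ultimately have x2: "0 \<le> x" "x < y + (real n + 1) * T" using x y by linarith+
        have "real P < \<bar>real_of_int p\<bar>" using that by (auto simp: W_def)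
        then have "real P * a \<le> \<bar>real_of_int p\<bar> * a" using a by (intro mult_right_mono) auto
        then have "real P * a \<le> \<bar>real_of_int p * a\<bar>" using a by (simp add: abs_mult)
        then have "\<bar>x - real_of_int p * a\<bar> \<ge> a" using x2 P by linarith
        then show ?thesis by (simp add: u_def g0)
      next
        case False
        then have "f x = 0" using x by (auto simp: f_eq e_def)
        then show ?thesis by (simp add: u_def)
      qed
    qed
    then show ?thesis by (simp add: \<sigma>_def)
  qed
  have \<sigma>_le: "\<sigma> p \<le> T * (\<eta> * (C * (D * \<delta>)))" if p: "p \<in> W" for p
  proof -
    \<comment> \<open>Summing the shifts before integrating brings out the cancellation: on the
      support of the test function this sum is conj (\<Phi> p s), hence at most \<eta> in
      modulus.\<close>
    define U where "U x = (\<Sum>k\<in>{-int K..int K}. u p (x + real_of_int k / b))" for x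
    have U: "sq_integrable lborel U" unfolding U_def by (intro sq_integrable_sum sq_integrable_shift u)
    have "(\<Sum>k\<in>{-int K..int K}. \<integral>x. u p (x + real_of_int k / b) * cnj (u p x) \<partial>lborel) = (\<integral>x. U x * cnj (u p x) \<partial>lborel)"
      unfolding U_def sum_distrib_right
      by (intro Bochner_Integration.integral_sum[symmetric] integrable_mult_cnj sq_integrable_shift u)
    then have "\<sigma> p = Re (complex_of_real (1 / b) * (\<integral>x. U x * cnj (u p x) \<partial>lborel))" by (simp only: \<sigma>_def)
    also have "\<dots> \<le> cmod (complex_of_real (1 / b) * (\<integral>x. U x * cnj (u p x) \<partial>lborel))" by (rule complex_Re_le_cmod)
    also have "\<dots> = T * cmod (\<integral>x. U x * cnj (u p x) \<partial>lborel)"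
      unfolding b_eq T_def[symmetric] using T by (simp add: norm_mult)
    also have "\<dots> \<le> T * (\<integral>x. \<eta> * (C * cmod (f x)) \<partial>lborel)"
    proof (intro mult_left_mono order_trans[OF integral_norm_bound] integral_mono)
      show "integrable lborel (\<lambda>x. cmod (U x * cnj (u p x)))" by (intro integrable_norm integrable_mult_cnj U u)
      show "integrable lborel (\<lambda>x. \<eta> * (C * cmod (f x)))" using f_int by simp
      fix x
      obtain s l where "x - y = s + real_of_int l * T" "0 \<le> s" "s < T" using floor_decomp[OF T] by blast
      then have x: "x = y + s + real_of_int l * T" "0 \<le> s" "s < T" by auto
      show "cmod (U x * cnj (u p x)) \<le> \<eta> * (C * cmod (f x))"
      proof (cases "s < \<delta> \<and> 0 \<le> l \<and> l \<le> int n")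
        case True
        have "U x = cnj (\<Phi> p s)" unfolding U_def u_def kb using conv[OF x(1,2), of p] True by blast
        then have "cmod (U x) \<le> \<eta>" using \<delta>0(2)[OF _ p, of s] True x \<delta> by simp
        moreover have "cmod (u p x) \<le> C * cmod (f x)"
          using mult_left_mono[OF C(2), of "cmod (f x)" "x - real_of_int p * a"] by (simp add: u_def norm_mult mult.commute)
        ultimately show ?thesis unfolding norm_mult complex_mod_cnj using \<eta> by (intro mult_mono) auto
      next
        case False
        then have "f x = 0" using x by (auto simp: f_eq e_def)
        then show ?thesis by (simp add: u_def)
      qed
    qed (use T in auto)
    also have "\<dots> = T * (\<eta> * (C * (\<integral>x. cmod (f x) \<partial>lborel)))" by simp
    also have "\<dots> \<le> T * (\<eta> * (C * (D * \<delta>)))" using T \<eta> C f_L1 by (intro mult_left_mono) auto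
    finally show ?thesis .
  qed
  have "(\<Sum>\<^sub>\<infinity>k. (cmod (L2_inner f (gabor a b g k)))\<^sup>2) \<le> Q * \<eta> * \<delta>"
  proof (rule infsum_le_finite_sums[OF A(2)[OF f_L2]])
    fix F :: "(int \<times> int) set" assume F: "finite F" "F \<subseteq> UNIV"
    have "(\<Sum>k\<in>F. (cmod (L2_inner f (gabor a b g k)))\<^sup>2) \<le> (\<Sum>k\<in>fst ` F \<times> snd ` F. (cmod (L2_inner f (gabor a b g k)))\<^sup>2)"
      using F by (intro sum_mono2) (auto simp: rev_image_eqI)
    also have "\<dots> = (\<Sum>p\<in>snd ` F. \<Sum>m\<in>fst ` F. (cmod (L2_inner f (gabor a b g (m, p))))\<^sup>2)"
      by (subst sum.swap) (simp add: sum.cartesian_product)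
    also have "\<dots> \<le> (\<Sum>p\<in>snd ` F. \<sigma> p)"
      using F by (intro sum_mono finite_sum_le_has_sum[OF row]) auto
    also have "\<dots> = (\<Sum>p\<in>snd ` F \<inter> W. \<sigma> p)"
      using F \<sigma>_out by (intro sum.mono_neutral_right) auto
    also have "\<dots> \<le> (\<Sum>p\<in>snd ` F \<inter> W. T * (\<eta> * (C * (D * \<delta>))))" by (intro sum_mono \<sigma>_le) auto
    also have "\<dots> \<le> (\<Sum>p\<in>W. T * (\<eta> * (C * (D * \<delta>))))"
      using T \<eta> C D \<delta> by (intro sum_mono2) (auto simp: W_def)
    also have "\<dots> = Q * \<eta> * \<delta>" by (simp add: Q_def)
    finally show "(\<Sum>k\<in>F. (cmod (L2_inner f (gabor a b g k)))\<^sup>2) \<le> Q * \<eta> * \<delta>" .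
  qed
  moreover have "A * \<delta> \<le> A * L2_normsq f" using A(1) f_norm by (intro mult_left_mono) auto
  ultimately have "A * \<delta> \<le> Q * \<eta> * \<delta>" using A(3)[OF f_L2] by linarith
  then have "A \<le> Q * \<eta>" using \<delta> by simp
  moreover have "Q * \<eta> < A" using A(1) Q by (simp add: \<eta>_def field_simps)
  ultimately show False by simp
qed

section \<open>Conditions (i) to (iv) and pairs of zeros\<close>

lemma Rfun_at_top:
  assumes g: "g \<in> V \<alpha>" and \<alpha>: "\<alpha> \<le> a" and c: "c > 0" and c_eq: "(1 - a * b) / b = c"
    and y: "a - \<alpha> < y" "y \<le> \<alpha> - real n * c" "g y = 0" and n: "1 \<le> n"
    and num: "\<And>k. 1 \<le> k \<Longrightarrow> k < n \<Longrightarrow> g (y + real k * c - a) \<noteq> 0"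
  shows "filterlim (\<lambda>t. cmod (Rfun g a b n t)) at_top (at y within {a - \<alpha> <.. \<alpha> - (1 - a * b) * real n / b})"
proof -
  have cont: "continuous_on UNIV g" and fin: "finite {x \<in> {-\<alpha>..\<alpha>}. g x = 0}" using g by (auto simp: V_def)
  have gt: "isCont g x" for x using cont by (simp add: continuous_on_eq_continuous_at)
  have ck: "(1 - a * b) * real k / b = real k * c" for k unfolding c_eq[symmetric] by simp
  let ?F = "at y within {a - \<alpha> <.. \<alpha> - real n * c}"
  \<comment> \<open>The quotient is split so that the leading factor 1/g(t) enters \<open>D\<close>
    as k = 0: at \<open>y\<close> the numerator is positive and the denominator vanishes, whatever
    its other factors do.\<close>
  define N where "N t = (\<Prod>k\<in>{1..<n}. cmod (g (t + real k * c - a)))" for t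
  define D where "D t = (\<Prod>k<n. cmod (g (t + real k * c)))" for t
  have R: "cmod (Rfun g a b n t) = N t / D t" for t
  proof -
    have "{..<n} = insert 0 {1..<n}" using n by auto
    then have "D t = cmod (g t) * (\<Prod>k\<in>{1..<n}. cmod (g (t + real k * c)))" by (simp add: D_def)
    then show ?thesis
      unfolding Rfun_def N_def ck by (simp add: norm_mult norm_divide prod_norm[symmetric] prod_dividef)
  qed
  have tend: "((\<lambda>t. cmod (g (t + z))) \<longlongrightarrow> cmod (g (y + z))) ?F" for z
    by (intro tendsto_norm isCont_tendsto_compose[OF gt] tendsto_intros)
  have Nl: "(N \<longlongrightarrow> N y) ?F"
    unfolding N_def by (intro tendsto_prod) (use tend[of "real _ * c - a"] in \<open>simp add: add_diff_eq\<close>)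
  have Dl: "(D \<longlongrightarrow> D y) ?F" unfolding D_def by (intro tendsto_prod tend)
  have D0: "D y = 0" unfolding D_def using n y(3) by (auto intro!: prod_zero bexI[of _ 0])
  have Ny: "N y > 0" unfolding N_def using num by (intro prod_pos) auto
  \<comment> \<open>The points where some factor of the denominator vanishes. They are finitely many
    because \<open>g\<close> has finitely many zeros in its support interval, so near
    \<open>y\<close>, but not at \<open>y\<close>, the denominator is positive.\<close>
  define Z where "Z = (\<Union>k<n. (\<lambda>x. x - real k * c) ` {x \<in> {-\<alpha>..\<alpha>}. g x = 0})"
  have "finite Z" unfolding Z_def using fin by auto
  then have "\<forall>\<^sub>F t in at y. t \<notin> Z"
    using islimpt_finite[of Z y] by (simp add: islimpt_iff_eventually)
  then have "\<forall>\<^sub>F t in ?F. t \<notin> Z" by (auto simp: eventually_at_filter elim: eventually_mono)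
  then have "\<forall>\<^sub>F t in ?F. t \<notin> Z \<and> t \<in> {a - \<alpha> <.. \<alpha> - real n * c}"
    by (intro eventually_conj) (auto simp: eventually_at_filter)
  then have Dpos: "\<forall>\<^sub>F t in ?F. 0 < D t"
  proof eventually_elim
    case (elim t)
    have "g (t + real k * c) \<noteq> 0" if "k < n" for k
    proof
      assume z: "g (t + real k * c) = 0"
      have "real k * c \<le> real n * c" using that c by (intro mult_right_mono) auto
      moreover have "0 \<le> real k * c" using c by simp
      ultimately have "t + real k * c \<in> {-\<alpha>..\<alpha>}" using elim \<alpha> y by auto
      then have "t \<in> Z" unfolding Z_def using z that by (auto intro!: bexI[of _ k] image_eqI[of _ _ "t + real k * c"])
      then show False using elim by simp
    qed
    then show ?case unfolding D_def by (intro prod_pos) auto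
  qed
  have "filterlim (\<lambda>t. N t / D t) at_top ?F"
    by (rule LIM_at_top_divide[OF Nl Ny _ Dpos]) (use Dl D0 in simp)
  then show ?thesis by (simp only: R ck)
qed

text \<open>Given a forbidden pair, (i) places it strictly inside the overlap region, so
  \<open>y\<close> belongs to the domains of R_1, ..., R_n. By induction on k the numerator of R_k
  at \<open>y\<close> is nonzero, so R_k blows up there and (ii) yields g(y + k*c - a) \<noteq> 0;
  for k = n this contradicts the pair.\<close>

lemma conditions_imp_nondegenerate:
  assumes g: "g \<in> V \<alpha>" and \<alpha>: "\<alpha> > 0" "\<alpha> \<le> a" and b: "b > 0" and c: "c > 0" and c_eq: "(1 - a * b) / b = c"
    and M: "a < real M * c"
    and i: "\<forall>x\<in>{-a..0}. cmod (g x) + cmod (g (x + a)) > 0"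
    and ii: "\<forall>n y. plus_pt g \<alpha> a b M n y \<longrightarrow> g (y + (1 - a*b) * real n / b - a) \<noteq> 0"
  shows "chain_nondegenerate g a c"
  unfolding chain_nondegenerate_def
proof (intro allI impI, rule ccontr)
  fix y and n :: nat assume y: "0 \<le> y" "y + real n * c \<le> a" and "\<not> (g y \<noteq> 0 \<or> g (y + real n * c - a) \<noteq> 0)"
  then have z: "g y = 0" "g (y + real n * c - a) = 0" by auto
  have ck: "(1 - a * b) * real k / b = real k * c" for k unfolding c_eq[symmetric] by simp
  have i': "g x \<noteq> 0 \<or> g (x - a) \<noteq> 0" if "0 \<le> x" "x \<le> a" for x
    using i[rule_format, of "x - a"] that by auto
  have nc: "0 \<le> real n * c" using c by simp
  have n: "n \<ge> 1" using z i'[of y] y by (cases n) auto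
  have y1: "a - \<alpha> < y"
  proof (rule ccontr)
    assume "\<not> a - \<alpha> < y"
    then have "g (y - a) = 0" using y \<alpha> by (intro V_zero_outside[OF g]) linarith
    then show False using i'[of y] z y nc by auto
  qed
  have y2: "y + real n * c < \<alpha>"
  proof (rule ccontr)
    assume "\<not> y + real n * c < \<alpha>"
    then have "g (y + real n * c) = 0" by (intro V_zero_outside[OF g]) linarith
    then show False using i'[of "y + real n * c"] z y nc by auto
  qed
  \<comment> \<open>Both bounds in the definition of \<open>kappa\<close> follow from the position
    of the pair: k*c \<le> a < M*c gives k \<le> M - 1, and k*c < \<alpha> is the other one.\<close>
  have kap: "k \<le> kappa \<alpha> a b M" if "k \<le> n" for k
  proof -
    have kn: "real k * c \<le> real n * c" using that c by (intro mult_right_mono) auto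
    then have "real k * c < real M * c" using y M by linarith
    then have "k < M" using c by simp
    moreover have "(1 - a * b) * real k \<le> b * \<alpha>"
    proof -
      have "(1 - a * b) * real k / b \<le> \<alpha>" unfolding ck using kn y y2 by linarith
      then show ?thesis using b by (simp add: pos_divide_le_eq mult.commute)
    qed
    ultimately show ?thesis
      unfolding kappa_def by (intro Greatest_le_nat[where b = "M - 1"]) auto
  qed
  have "1 \<le> k \<longrightarrow> k \<le> n \<longrightarrow> g (y + real k * c - a) \<noteq> 0" for k
  proof (induction k rule: less_induct)
    case (less k)
    show ?case
    proof (intro impI)
      assume k: "1 \<le> k" "k \<le> n"
      have kn: "real k * c \<le> real n * c" using k c by (intro mult_right_mono) auto
      have "filterlim (\<lambda>t. cmod (Rfun g a b k t)) at_top (at y within {a - \<alpha> <.. \<alpha> - (1 - a * b) * real k / b})"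
        using less.IH k y2 kn by (intro Rfun_at_top[OF g \<alpha>(2) c c_eq y1 _ z(1)]) auto
      then have "plus_pt g \<alpha> a b M k y"
        using kap[OF k(2)] k y1 y2 kn z(1) by (auto simp: plus_pt_def ck)
      then show "g (y + real k * c - a) \<noteq> 0" using ii by (auto simp: ck)
    qed
  qed
  then show False using n z(2) by blast
qed

text \<open>Each condition excludes a particular chain: (i) the chains with n = 0, (ii) the chain
  starting at y_+, (iii) the one starting at y_- - n*c + a and ending at y_-, and (iv) the one from
  y_+ to y_-, which has n_+ + n_- steps.\<close>

lemma nondegenerate_imp_conditions:
  assumes \<alpha>: "\<alpha> \<le> a" and c: "c > 0" and c_eq: "(1 - a * b) / b = c" and nd: "chain_nondegenerate g a c"
  shows "\<forall>x\<in>{-a..0}. cmod (g x) + cmod (g (x + a)) > 0"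
    and "plus_pt g \<alpha> a b M n y \<Longrightarrow> g (y + (1 - a*b) * real n / b - a) \<noteq> 0"
    and "minus_pt g \<alpha> a b M n y \<Longrightarrow> g (y - (1 - a*b) * real n / b + a) \<noteq> 0"
    and "plus_pt g \<alpha> a b M n1 y1 \<Longrightarrow> minus_pt g \<alpha> a b M n2 y2 \<Longrightarrow>
               y1 + (1 - a*b) * real n1 / b \<noteq> y2 - (1 - a*b) * real n2 / b + a"
proof -
  have ck: "(1 - a * b) * real k / b = real k * c" for k unfolding c_eq[symmetric] by simp
  have nd': "g y \<noteq> 0 \<or> g (y + real n * c - a) \<noteq> 0" if "0 \<le> y" "y + real n * c \<le> a" for y n
    using nd that unfolding chain_nondegenerate_def by blast
  show "\<forall>x\<in>{-a..0}. cmod (g x) + cmod (g (x + a)) > 0"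
  proof
    fix x assume "x \<in> {-a..0}"
    then have "g (x + a) \<noteq> 0 \<or> g x \<noteq> 0" using nd'[of "x + a" 0] by simp
    then show "cmod (g x) + cmod (g (x + a)) > 0" by (auto simp: add_pos_nonneg add_nonneg_pos)
  qed
  show "g (y + (1 - a*b) * real n / b - a) \<noteq> 0" if "plus_pt g \<alpha> a b M n y"
    using that nd'[of y n] \<alpha> by (auto simp: plus_pt_def ck)
  show "g (y - (1 - a*b) * real n / b + a) \<noteq> 0" if "minus_pt g \<alpha> a b M n y"
    using that nd'[of "y - real n * c + a" n] \<alpha> by (auto simp: minus_pt_def ck)
  show "y1 + (1 - a*b) * real n1 / b \<noteq> y2 - (1 - a*b) * real n2 / b + a"
    if "plus_pt g \<alpha> a b M n1 y1" "minus_pt g \<alpha> a b M n2 y2"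
  proof
    assume "y1 + (1 - a*b) * real n1 / b = y2 - (1 - a*b) * real n2 / b + a"
    then have eq: "y1 + real (n1 + n2) * c = y2 + a" unfolding ck by (simp add: algebra_simps)
    then show False using nd'[of y1 "n1 + n2"] that \<alpha> by (auto simp: plus_pt_def minus_pt_def)
  qed
qed

theorem theorem2p1:
  fixes \<alpha> a b :: real and M :: nat and g :: "real \<Rightarrow> complex"
  assumes "\<alpha> > 0" and "g \<in> V \<alpha>" and "a > 0" and "b > 0"
    and "\<alpha> \<le> a" and "a < 2 * \<alpha>"
    and "M \<ge> 2"
    and "(real M - 1) / real M \<le> a * b" and "a * b < real M / (real M + 1)"
  shows "(frame_L2 (gabor a b g) \<longleftrightarrow>
           (\<forall>x\<in>{-a..0}. cmod (g x) + cmod (g (x + a)) > 0) \<and>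
           (\<forall>n y. plus_pt g \<alpha> a b M n y \<longrightarrow> g (y + (1 - a*b) * real n / b - a) \<noteq> 0) \<and>
           (\<forall>n y. minus_pt g \<alpha> a b M n y \<longrightarrow> g (y - (1 - a*b) * real n / b + a) \<noteq> 0) \<and>
           (\<forall>n1 y1 n2 y2. plus_pt g \<alpha> a b M n1 y1 \<longrightarrow> minus_pt g \<alpha> a b M n2 y2 \<longrightarrow>
               y1 + (1 - a*b) * real n1 / b \<noteq> y2 - (1 - a*b) * real n2 / b + a))
         \<and> (frame_L2 (gabor a b g) \<longrightarrow>
             (\<exists>h. L2 h \<and> (\<forall>x. x \<notin> {-(a * real M) .. a * real M} \<longrightarrow> h x = 0)
                  \<and> dual_frames_L2 (gabor a b g) (gabor a b h)))"
proof -
  define c where "c = (1 - a * b) / b"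
  \<comment> \<open>Clearing the denominator of M/(M+1); division by \<open>b\<close> then turns
    this into a < M*c.\<close>
  have ab: "a * b < real M * (1 - a * b)" using assms(9) by (simp add: field_simps)
  have "real M / (real M + 1) < 1" by simp
  then have "a * b < 1" using assms(9) by linarith
  then have c: "c > 0" using assms(4) by (simp add: c_def)
  have M: "a < real M * c" using ab assms(4) by (simp add: c_def field_simps)
  have b_eq: "1 / b = a + c" using assms(4) by (simp add: c_def field_simps)
  have c_eq: "(1 - a * b) / b = c" by (simp add: c_def)
  have M1: "M \<ge> 1" using assms(7) by simp
  have dual: "\<exists>h. L2 h \<and> (\<forall>x. x \<notin> {-(a * real M) .. a * real M} \<longrightarrow> h x = 0) \<and> dual_frames_L2 (gabor a b g) (gabor a b h)"
    if "chain_nondegenerate g a c"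
    by (rule nondegenerate_dual_frames[OF assms(2,1,5,3,4) c b_eq M M1 that])
  have nd: "chain_nondegenerate g a c" if "frame_L2 (gabor a b g)"
    by (rule frame_imp_nondegenerate[OF assms(2,1,5,3,4) c b_eq that])
  have frame: "frame_L2 (gabor a b g)" if "chain_nondegenerate g a c"
    using dual[OF that] unfolding dual_frames_L2_def by blast
  show ?thesis (is "(_ \<longleftrightarrow> ?conds) \<and> _")
  proof (intro conjI impI)
    show "frame_L2 (gabor a b g) \<longleftrightarrow> ?conds"
    proof
      assume "frame_L2 (gabor a b g)"
      then show ?conds using nondegenerate_imp_conditions[OF assms(5) c c_eq nd] by blast
    next
      assume ?conds
      then show "frame_L2 (gabor a b g)"
        using conditions_imp_nondegenerate[OF assms(2,1,5,4) c c_eq M] by (intro frame) blast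
    qed
  qed (use dual nd in blast)
qed

end
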